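(* Let $d\ge2$, let $\Omega$ be a compact subset of $\mathbb R^d$ with smooth boundary, and let $0<m<|\Omega|$. Let $E_0$ be a solution of the constrained isoperimetric problem $$\min\{P(E):\ E\subset\Omega,\ |E|=m\}.$$ Then, for every $\alpha\in(0,d-1)$ and $Q>0$, $$\inf\{\mathcal F_{\alpha,Q}(E):\ E\text{ compact},\ E\subset\Omega,\ |E|=m\}=P(E_0)+Q^2\,\mathcal I_\alpha(\Omega).$$
   Context: $|E|$ is Lebesgue measure in $\mathbb R^d$. "Compact subset with smooth boundary" means that $\Omega$ is the closure of a bounded open set with smooth boundary. $P(E)$ is the perimeter of $E$ in $\mathbb R^d$ in the sense of De Giorgi (equal to $\mathcal H^{d-1}(\partial E)$ when $E$ has smooth boundary); in the constrained isoperimetric problem $E$ ranges over measurable subsets of $\Omega$. For $\alpha\in(0,d)$ and $E$ compact, the Riesz potential energy is $$\mathcal I_\alpha(E)=\inf\left\{\int_{\mathbb R^d\times\mathbb R^d}\frac{d\mu(x)\,d\mu(y)}{|x-y|^\alpha}:\ \mu \text{ non-negative Borel measure on }\mathbb R^d,\ \mu(E)=1\right\},$$ and $\mathcal F_{\alpha,Q}(E)=P(E)+Q^2\,\mathcal I_\alpha(E)$. *)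

theory Defs
  imports "HOL-Analysis.Analysis"
begin

(* C^k on the whole space. In finite dimension, continuity of all iterated directional
   derivatives of order at most k is continuity of the derivatives of order at most k. *)
primrec Ck :: "nat \<Rightarrow> ('a::euclidean_space \<Rightarrow> 'b::real_normed_vector) \<Rightarrow> bool" where
  "Ck 0 f \<longleftrightarrow> continuous_on UNIV f"
| "Ck (Suc k) f \<longleftrightarrow>
     f differentiable_on UNIV \<and> (\<forall>v. Ck k (\<lambda>x. frechet_derivative f (at x) v))"

definition smooth :: "('a::euclidean_space \<Rightarrow> 'b::real_normed_vector) \<Rightarrow> bool" where
  "smooth f \<longleftrightarrow> (\<forall>k. Ck k f)"

(* Near each boundary point U is, after a rotation of the coordinates, the region above the graph
   of a smooth function of d - 1 variables. The direction \<nu> plays the role of the last coordinate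
   vector; only the values of \<gamma> on the hyperplane orthogonal to \<nu> are used, and any smooth function
   on that hyperplane extends smoothly to the whole space. *)
definition smooth_boundary :: "'a::euclidean_space set \<Rightarrow> bool" where
  "smooth_boundary U \<longleftrightarrow>
     (\<forall>x\<in>frontier U. \<exists>r>0. \<exists>\<nu> (\<gamma> :: 'a \<Rightarrow> real). norm \<nu> = 1 \<and> smooth \<gamma> \<and>
        U \<inter> ball x r = {y \<in> ball x r. y \<bullet> \<nu> > \<gamma> (y - (y \<bullet> \<nu>) *\<^sub>R \<nu>)})"

definition compact_smooth_domain :: "'a::euclidean_space set \<Rightarrow> bool" where
  "compact_smooth_domain \<Omega> \<longleftrightarrow>
     (\<exists>U. open U \<and> bounded U \<and> smooth_boundary U \<and> \<Omega> = closure U)"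

definition divergence :: "('a::euclidean_space \<Rightarrow> 'a) \<Rightarrow> 'a \<Rightarrow> real" where
  "divergence \<phi> x = (\<Sum>b\<in>Basis. frechet_derivative \<phi> (at x) b \<bullet> b)"

(* De Giorgi perimeter, meaningful for Lebesgue measurable E. The truncation of negative reals
   by ennreal is harmless, since the field 0 is admissible. *)
definition perimeter :: "'a::euclidean_space set \<Rightarrow> ennreal" where
  "perimeter E =
     (SUP \<phi> \<in> {\<phi> :: 'a \<Rightarrow> 'a. Ck 1 \<phi> \<and> compact (closure {x. \<phi> x \<noteq> 0}) \<and> (\<forall>x. norm (\<phi> x) \<le> 1)}.
        ennreal (LINT x:E|lebesgue. divergence \<phi> x))"

(* The quotient is taken in ennreal, so that the kernel is infinite on the diagonal for \<alpha> > 0. *)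
definition riesz_kernel :: "real \<Rightarrow> 'a::euclidean_space \<Rightarrow> 'a \<Rightarrow> ennreal" where
  "riesz_kernel \<alpha> x y = 1 / ennreal (norm (x - y) powr \<alpha>)"

(* The double integral is written as an iterated one: by Tonelli it is the integral over the product
   measure when \<mu> is sigma-finite, and it avoids the library's product measure when \<mu> is not. *)
definition riesz_energy :: "real \<Rightarrow> 'a::euclidean_space set \<Rightarrow> ennreal" where
  "riesz_energy \<alpha> E =
     (INF \<mu> \<in> {\<mu> :: 'a measure. sets \<mu> = sets borel \<and> emeasure \<mu> E = 1}.
        \<integral>\<^sup>+ x. (\<integral>\<^sup>+ y. riesz_kernel \<alpha> x y \<partial>\<mu>) \<partial>\<mu>)"

definition charged_energy :: "real \<Rightarrow> real \<Rightarrow> 'a::euclidean_space set \<Rightarrow> ennreal" where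
  "charged_energy \<alpha> Q E = perimeter E + ennreal (Q\<^sup>2) * riesz_energy \<alpha> E"

definition isoperimetric_solution :: "'a::euclidean_space set \<Rightarrow> real \<Rightarrow> 'a set \<Rightarrow> bool" where
  "isoperimetric_solution \<Omega> m E\<^sub>0 \<longleftrightarrow>
     (E\<^sub>0 \<in> sets lebesgue \<and> E\<^sub>0 \<subseteq> \<Omega> \<and> measure lebesgue E\<^sub>0 = m) \<and>
     (\<forall>E. E \<in> sets lebesgue \<and> E \<subseteq> \<Omega> \<and> measure lebesgue E = m \<longrightarrow> perimeter E\<^sub>0 \<le> perimeter E)"

end

theory Submission
  imports Defs
begin

text \<open>
  De Giorgi's perimeter ignores Lebesgue null sets, but the Riesz energy does not: for
  \<open>\<alpha> < d - 1\<close> pieces of hyperplanes carry charges of finite energy. Hence, for the upper bound,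
  a compact null set \<open>F\<close> in \<open>\<Omega>\<close> whose energy is almost that of \<open>\<Omega>\<close> can be added for free to
  a compact set \<open>A\<close> in \<open>\<Omega>\<close> of volume \<open>m\<close> whose perimeter is almost that of \<open>E\<^sub>0\<close>.

  The set \<open>F\<close> arises by spreading an almost optimal charge of \<open>\<Omega>\<close> uniformly over finitely many
  small hyperplane pieces, which the interior corkscrew condition places inside \<open>\<Omega>\<close>.

  The set \<open>A\<close> is \<open>X \<inter> \<Omega>\<close>, where \<open>X\<close> is a level set of a mollification of \<open>E\<^sub>0\<close> (coarea inequality)
  whose volume is corrected by small cubes. Intersecting with \<open>\<Omega>\<close> costs almost no perimeter,
  since \<open>P(X \<inter> \<Omega>) \<le> P(X) + P(\<Omega>) - P(X \<union> \<Omega>)\<close> by submodularity, and \<open>P(X \<union> \<Omega>)\<close> is almost at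
  least \<open>P(\<Omega>)\<close> by lower semicontinuity.
\<close>

section \<open>Test fields and integration by parts\<close>

text \<open>The lower bound needs no construction: enlarging a compact set in \<Omega> to \<Omega>
  lowers the Riesz energy, and \<open>E\<^sub>0\<close> has least perimeter. The work lies in the
  compact set \<open>A\<close>, since \<open>E\<^sub>0\<close> is merely measurable while
  \<open>A\<close> must be compact, inside \<Omega> and of volume exactly \<open>m\<close>. A level
  set of a mollification leaves \<Omega>, and its volume may err to either side. Therefore a small
  cube is removed beforehand: the volume lost exceeds the later error, so the level set is certainly
  too small, and a single growing cube restores the volume. The removal is itself an intersection,
  with a large box minus the cube, and is estimated by the same submodularity argument as the
  intersection with \<Omega>. That argument presupposes finite perimeter of \<Omega>, which is read
  off the volumes of thin tubes around the boundary. For the charge, a displacement that is small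
  against the distance of two points hardly changes their interaction. Close pairs are controlled
  because a charge of finite energy has little energy near the diagonal.\<close>

definition test_field :: "('a::euclidean_space \<Rightarrow> 'a) \<Rightarrow> bool" where
  "test_field \<phi> \<longleftrightarrow> Ck 1 \<phi> \<and> compact (closure {x. \<phi> x \<noteq> 0}) \<and> (\<forall>x. norm (\<phi> x) \<le> 1)"

definition C1_grad :: "('a::euclidean_space \<Rightarrow> real) \<Rightarrow> ('a \<Rightarrow> 'a) \<Rightarrow> bool" where
  "C1_grad f g \<longleftrightarrow> (\<forall>x. (f has_derivative (\<lambda>v. g x \<bullet> v)) (at x)) \<and> continuous_on UNIV g"

lemma perimeter_le_iff:
  assumes "0 \<le> c"
  shows "perimeter E \<le> ennreal c \<longleftrightarrow>
    (\<forall>\<phi>. test_field \<phi> \<longrightarrow> (LINT x:E|lebesgue. divergence \<phi> x) \<le> c)"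
  using assms by (auto simp: perimeter_def test_field_def SUP_le_iff ennreal_le_iff)

lemma test_field_has_derivative:
  assumes "test_field \<phi>"
  shows "(\<phi> has_derivative frechet_derivative \<phi> (at x)) (at x)"
  using assms unfolding test_field_def
  by (auto simp: differentiable_on_def frechet_derivative_works)

lemma test_field_continuous:
  assumes "test_field \<phi>"
  shows "continuous_on UNIV \<phi>"
  using assms unfolding test_field_def
  by (auto intro: differentiable_imp_continuous_on)

lemma test_field_continuous_derivative:
  assumes "test_field \<phi>"
  shows "continuous_on UNIV (\<lambda>x. frechet_derivative \<phi> (at x) v)"
  using assms unfolding test_field_def by auto

lemma continuous_on_divergence:
  assumes "test_field \<phi>"
  shows "continuous_on UNIV (divergence \<phi>)"
  unfolding divergence_def
  by (intro continuous_intros test_field_continuous_derivative assms)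

lemma frechet_derivative_zero_outside_closure:
  fixes \<phi> :: "'a::euclidean_space \<Rightarrow> 'b::real_normed_vector"
  assumes "x \<notin> closure {x. \<phi> x \<noteq> 0}"
  shows "frechet_derivative \<phi> (at x) = (\<lambda>v. 0)"
proof -
  have "((\<lambda>x. 0) has_derivative (\<lambda>v. 0)) (at x)" by simp
  then have "(\<phi> has_derivative (\<lambda>v. 0)) (at x)"
  proof (rule has_derivative_transform_within_open)
    show "open (- closure {x. \<phi> x \<noteq> 0})" by (rule open_Compl[OF closed_closure])
    show "x \<in> - closure {x. \<phi> x \<noteq> 0}" using assms by simp
    fix y assume "y \<in> - closure {x. \<phi> x \<noteq> 0}"
    then show "0 = \<phi> y" using closure_subset[of "{x. \<phi> x \<noteq> 0}"] by auto
  qed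
  then show ?thesis by (metis frechet_derivative_at)
qed

lemma divergence_zero_outside_closure:
  fixes \<phi> :: "'a::euclidean_space \<Rightarrow> 'a"
  assumes "x \<notin> closure {x. \<phi> x \<noteq> 0}"
  shows "divergence \<phi> x = 0"
  by (simp add: divergence_def frechet_derivative_zero_outside_closure[OF assms])

lemma test_field_support:
  fixes \<phi> :: "'a::euclidean_space \<Rightarrow> 'a"
  assumes "test_field \<phi>"
  obtains R where "R > 0" "\<And>x. norm x > R \<Longrightarrow> \<phi> x = 0"
    "\<And>x v. norm x > R \<Longrightarrow> frechet_derivative \<phi> (at x) v = 0"
    "\<And>x. norm x > R \<Longrightarrow> divergence \<phi> x = 0"
proof -
  have "bounded (closure {x. \<phi> x \<noteq> 0})"
    using assms compact_imp_bounded unfolding test_field_def by auto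
  then obtain R where R: "R > 0" "\<And>x. x \<in> closure {x. \<phi> x \<noteq> 0} \<Longrightarrow> norm x \<le> R"
    using bounded_pos by metis
  show ?thesis
  proof
    show "R > 0" by fact
    fix x :: 'a assume "norm x > R"
    then have *: "x \<notin> closure {x. \<phi> x \<noteq> 0}" using R(2) by fastforce
    then show "divergence \<phi> x = 0" by (rule divergence_zero_outside_closure)
    show "frechet_derivative \<phi> (at x) v = 0" for v
      using frechet_derivative_zero_outside_closure[OF *] by simp
    show "\<phi> x = 0" using * closure_subset[of "{x. \<phi> x \<noteq> 0}"] by auto
  qed
qed

lemma continuous_bounded_support:
  fixes f :: "'a::euclidean_space \<Rightarrow> 'b::{banach, second_countable_topology}"
  assumes "continuous_on UNIV f" "\<And>x. norm x > R \<Longrightarrow> f x = 0"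
  shows "integrable lborel f" and "\<exists>M\<ge>0. \<forall>x. norm (f x) \<le> M"
proof -
  have 1: "integrable lborel (\<lambda>x. indicator (cball 0 R) x *\<^sub>R f x)"
    by (rule borel_integrable_compact) (auto intro: continuous_on_subset[OF assms(1)])
  have "(\<lambda>x. indicator (cball 0 R) x *\<^sub>R f x) = f"
    using assms(2) by (force simp: indicator_def)
  with 1 show "integrable lborel f" by simp
  have "compact (f ` cball 0 R)"
    using assms(1) by (intro compact_continuous_image) (auto intro: continuous_on_subset)
  then have "bounded (f ` cball 0 R)" by (rule compact_imp_bounded)
  then obtain M where M: "M > 0" "\<forall>y\<in>f ` cball 0 R. norm y \<le> M"
    unfolding bounded_pos by blast
  have "norm (f x) \<le> M" for x
    using M assms(2)[of x] by (cases "norm x > R") auto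
  then show "\<exists>M\<ge>0. \<forall>x. norm (f x) \<le> M" using M(1) by (intro exI[of _ M]) auto
qed

lemma test_field_divergence_bounds:
  assumes "test_field \<phi>"
  shows "integrable lborel (divergence \<phi>)" and "\<exists>M>0. \<forall>x. \<bar>divergence \<phi> x\<bar> \<le> M"
proof -
  obtain R where R: "R > 0" "\<And>x. norm x > R \<Longrightarrow> divergence \<phi> x = 0"
    using test_field_support[OF assms] by metis
  note c = continuous_bounded_support[OF continuous_on_divergence[OF assms] R(2), simplified]
  show "integrable lborel (divergence \<phi>)" by (rule c(1))
  obtain M where "M \<ge> 0" "\<forall>x. \<bar>divergence \<phi> x\<bar> \<le> M" using c(2) by auto
  then show "\<exists>M>0. \<forall>x. \<bar>divergence \<phi> x\<bar> \<le> M"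
    by (intro exI[of _ "M + 1"]) (auto intro: order_trans)
qed

section \<open>Translation invariance and difference quotients\<close>

lemma integral_translate:
  fixes f :: "'a::euclidean_space \<Rightarrow> 'b::{banach, second_countable_topology}"
  assumes [measurable]: "f \<in> borel_measurable borel"
  shows "(\<integral>x. f (x + c) \<partial>lborel) = (\<integral>x. f x \<partial>lborel)"
proof -
  have "(\<integral>x. f x \<partial>lborel) = (\<integral>x. f x \<partial>distr lborel borel ((+) c))"
    by (simp add: lborel_distr_plus)
  also have "\<dots> = (\<integral>x. f (c + x) \<partial>lborel)"
    by (subst integral_distr) auto
  finally show ?thesis by (simp add: add.commute)
qed

lemma integrable_translate:
  fixes f :: "'a::euclidean_space \<Rightarrow> 'b::{banach, second_countable_topology}"
  assumes "integrable lborel f"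
  shows "integrable lborel (\<lambda>x. f (x + c))"
proof -
  have [measurable]: "f \<in> borel_measurable borel" using borel_measurable_integrable[OF assms] by simp
  have "integrable (distr lborel borel ((+) c)) f" using assms by (simp add: lborel_distr_plus)
  then show ?thesis by (subst (asm) integrable_distr_eq) (auto simp: add.commute)
qed

text \<open>Turns a derivative along a line into multiplication by a number, the shape in which
  \<open>has_field_derivative_def\<close> expects it.\<close>

lemma linear_line:
  assumes "(h has_derivative D) F"
  shows "(\<lambda>r. D (r *\<^sub>R b)) = (*) (D b :: real)"
proof -
  have "linear D" using assms has_derivative_linear by blast
  then show ?thesis by (auto simp: linear_scale[OF \<open>linear D\<close>] mult.commute)
qed

text \<open>Mean value theorem along the line. The bound is uniform in the step \<open>t\<close> and
  supplies the dominating functions for limits of difference quotients.\<close>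

lemma difference_quotient_bound:
  fixes h :: "'a::euclidean_space \<Rightarrow> real"
  assumes der: "\<And>x. (h has_derivative D x) (at x)" and M: "\<And>x. \<bar>D x b\<bar> \<le> M" and "t > 0"
  shows "\<bar>(h (x + t *\<^sub>R b) - h x) / t\<bar> \<le> M"
proof -
  let ?k = "\<lambda>s. h (x + s *\<^sub>R b)"
  have "(?k has_real_derivative (D (x + s *\<^sub>R b) b)) (at s)" for s
  proof -
    have "((\<lambda>s. x + s *\<^sub>R b) has_derivative (\<lambda>r. r *\<^sub>R b)) (at s)"
      by (auto intro!: derivative_eq_intros)
    from has_derivative_compose[OF this der]
    show ?thesis by (simp only: linear_line[OF der] has_field_derivative_def)
  qed
  then obtain z where z: "?k t - ?k 0 = (t - 0) * D (x + z *\<^sub>R b) b"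
    using MVT2[OF \<open>t > 0\<close>, of ?k "\<lambda>s. D (x + s *\<^sub>R b) b"] by blast
  then have "(h (x + t *\<^sub>R b) - h x) / t = D (x + z *\<^sub>R b) b" using \<open>t > 0\<close> by (simp add: field_simps)
  then show ?thesis using M by simp
qed

lemma difference_quotient_tendsto:
  fixes h :: "'a::euclidean_space \<Rightarrow> real"
  assumes der: "(h has_derivative D) (at x)" and t: "t \<longlonglongrightarrow> 0" "\<And>n. t n > (0::real)"
  shows "(\<lambda>n. (h (x + t n *\<^sub>R b) - h x) / t n) \<longlonglongrightarrow> D b"
proof -
  let ?k = "\<lambda>s. h (x + s *\<^sub>R b)"
  have 1: "((\<lambda>s. x + s *\<^sub>R b) has_derivative (\<lambda>r. r *\<^sub>R b)) (at 0)"
    by (auto intro!: derivative_eq_intros)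
  have der': "(h has_derivative D) (at (x + 0 *\<^sub>R b))" using der by simp
  from has_derivative_compose[OF 1 der']
  have "(?k has_real_derivative D b) (at 0)" by (simp only: linear_line[OF der] has_field_derivative_def)
  then have "((\<lambda>s. (?k (0 + s) - ?k 0) / s) \<longlongrightarrow> D b) (at 0)" by (simp add: DERIV_def)
  then have "((\<lambda>s. (h (x + s *\<^sub>R b) - h x) / s) \<longlongrightarrow> D b) (at 0)" by simp
  moreover have "filterlim t (at 0) sequentially"
    using t by (auto simp: filterlim_at less_imp_neq[symmetric])
  ultimately show ?thesis by (rule filterlim_compose)
qed

text \<open>The difference quotients of a compactly supported function integrate to zero by
  translation invariance.\<close>

lemma integral_directional_derivative_zero:
  fixes h :: "'a::euclidean_space \<Rightarrow> real"
  assumes der: "\<And>x. (h has_derivative D x) (at x)"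
    and cont: "continuous_on UNIV (\<lambda>x. D x b)"
    and supp: "\<And>x. norm x > R \<Longrightarrow> h x = 0" "\<And>x. norm x > R \<Longrightarrow> D x b = 0"
  shows "(\<integral>x. D x b \<partial>lborel) = 0"
proof -
  define t where "t = (\<lambda>n. 1 / real (Suc n))"
  have t: "t \<longlonglongrightarrow> 0" "\<And>n. t n > 0" "\<And>n. t n \<le> 1"
    unfolding t_def using LIMSEQ_Suc[OF lim_1_over_n] by auto
  have hc: "continuous_on UNIV h"
    by (intro continuous_at_imp_continuous_on ballI has_derivative_continuous[OF der])
  have [measurable]: "h \<in> borel_measurable borel" "(\<lambda>x. D x b) \<in> borel_measurable borel"
    using hc cont by (auto intro: borel_measurable_continuous_onI)
  have hi: "integrable lborel h" using continuous_bounded_support(1)[OF hc supp(1)] .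
  obtain M where M: "M \<ge> 0" "\<And>x. \<bar>D x b\<bar> \<le> M"
    using continuous_bounded_support(2)[OF cont supp(2)] by auto
  let ?s = "\<lambda>n x. (h (x + t n *\<^sub>R b) - h x) / t n"
  have zero: "(\<integral>x. ?s n x \<partial>lborel) = 0" for n
  proof -
    have "(\<integral>x. h (x + t n *\<^sub>R b) - h x \<partial>lborel) = 0"
      using hi integrable_translate[OF hi] by (subst Bochner_Integration.integral_diff) (auto simp: integral_translate)
    then show ?thesis by simp
  qed
  \<comment> \<open>Steps are at most 1, so all quotients vanish outside the ball of radius
    \<open>\<bar>R\<bar> + norm b\<close>.\<close>
  let ?w = "\<lambda>x::'a. indicator (cball 0 (\<bar>R\<bar> + norm b)) x * M"
  have "(\<lambda>n. \<integral>x. ?s n x \<partial>lborel) \<longlonglongrightarrow> (\<integral>x. D x b \<partial>lborel)"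
  proof (rule integral_dominated_convergence[where w = ?w])
    show "integrable lborel ?w"
      by (intro integrable_mult_left integrable_real_indicator) (auto simp: emeasure_lborel_cball_finite[unfolded infinity_ennreal_def])
    show "AE x in lborel. (\<lambda>n. ?s n x) \<longlonglongrightarrow> D x b"
      using difference_quotient_tendsto[OF der t(1,2)] by auto
    show "AE x in lborel. norm (?s n x) \<le> ?w x" for n
    proof (rule AE_I2)
      fix x :: 'a
      show "norm (?s n x) \<le> ?w x"
      proof (cases "x \<in> cball 0 (\<bar>R\<bar> + norm b)")
        case True
        then show ?thesis using difference_quotient_bound[OF der M(2) t(2)] by simp
      next
        case False
        then have n: "norm x > \<bar>R\<bar> + norm b" by simp
        have "norm (t n *\<^sub>R b) \<le> norm b" using t(2,3)[of n] by (simp add: mult_left_le_one_le)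
        moreover have "norm x \<le> norm (x + t n *\<^sub>R b) + norm (t n *\<^sub>R b)"
          using norm_triangle_ineq4[of "x + t n *\<^sub>R b" "t n *\<^sub>R b"] by simp
        ultimately have "norm (x + t n *\<^sub>R b) > R" using n by linarith
        moreover have "norm x > R" using n norm_ge_zero[of b] by linarith
        ultimately show ?thesis using supp False by simp
      qed
    qed
  qed auto
  then have "(\<lambda>n. 0) \<longlonglongrightarrow> (\<integral>x. D x b \<partial>lborel)" unfolding zero .
  then show ?thesis using LIMSEQ_unique tendsto_const by metis
qed

text \<open>The divergence of the product field is the sum over the basis of the derivative of
  \<open>f x * (\<phi> x \<bullet> b)\<close> in direction \<open>b\<close>. Each summand has
  compact support and integrates to zero, even if \<open>f\<close> itself has no compact
  support.\<close>

lemma integral_by_parts: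
  assumes f: "C1_grad f g" and \<phi>: "test_field \<phi>"
  shows "(\<integral>x. f x * divergence \<phi> x \<partial>lborel) = - (\<integral>x. g x \<bullet> \<phi> x \<partial>lborel)"
proof -
  obtain R where R: "R > 0" "\<And>x. norm x > R \<Longrightarrow> \<phi> x = 0"
    "\<And>x v. norm x > R \<Longrightarrow> frechet_derivative \<phi> (at x) v = 0"
    "\<And>x. norm x > R \<Longrightarrow> divergence \<phi> x = 0"
    using test_field_support[OF \<phi>] by metis
  have df: "(f has_derivative (\<lambda>v. g x \<bullet> v)) (at x)" for x using f unfolding C1_grad_def by blast
  have cg: "continuous_on UNIV g" using f unfolding C1_grad_def by blast
  have cf: "continuous_on UNIV f"
    by (intro continuous_at_imp_continuous_on ballI has_derivative_continuous[OF df])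
  note c = test_field_continuous[OF \<phi>] test_field_continuous_derivative[OF \<phi>] continuous_on_divergence[OF \<phi>]
  define D where "D = (\<lambda>b x v. (g x \<bullet> v) * (\<phi> x \<bullet> b) + f x * (frechet_derivative \<phi> (at x) v \<bullet> b))"
  have der: "((\<lambda>x. f x * (\<phi> x \<bullet> b)) has_derivative D b x) (at x)" for b x
  proof -
    have "((\<lambda>x. \<phi> x \<bullet> b) has_derivative (\<lambda>v. frechet_derivative \<phi> (at x) v \<bullet> b)) (at x)"
      by (rule has_derivative_inner_left[OF test_field_has_derivative[OF \<phi>]])
    from has_derivative_mult[OF df this] show ?thesis
      unfolding D_def by (simp add: add.commute)
  qed
  have cD: "continuous_on UNIV (\<lambda>x. D b x b)" for b
    unfolding D_def by (intro continuous_intros c cf cg)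
  have outside: "D b x b = 0" if "norm x > R" for b x
    using R that by (simp add: D_def)
  have z: "(\<integral>x. D b x b \<partial>lborel) = 0" for b
    by (rule integral_directional_derivative_zero[OF der cD, of R]) (use R outside in auto)
  have i: "integrable lborel (\<lambda>x. D b x b)" for b
    using continuous_bounded_support(1)[OF cD outside] .
  have "(\<integral>x. (\<Sum>b\<in>Basis. D b x b) \<partial>lborel) = 0"
    using i z by (subst Bochner_Integration.integral_sum) auto
  moreover have "(\<Sum>b\<in>Basis. D b x b) = g x \<bullet> \<phi> x + f x * divergence \<phi> x" for x
    unfolding D_def divergence_def sum.distrib sum_distrib_left
    by (subst euclidean_inner) simp
  moreover have "integrable lborel (\<lambda>x. g x \<bullet> \<phi> x)"
    by (rule continuous_bounded_support(1)[where R = R]) (use R in \<open>auto intro!: continuous_intros c cg\<close>)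
  moreover have "integrable lborel (\<lambda>x. f x * divergence \<phi> x)"
    by (rule continuous_bounded_support(1)[where R = R]) (use R in \<open>auto intro!: continuous_intros c cf\<close>)
  ultimately show ?thesis by simp
qed

lemma integral_divergence_le_gradient:
  assumes f: "C1_grad f g" and \<phi>: "test_field \<phi>" and g: "integrable lborel (\<lambda>x. norm (g x))"
  shows "(\<integral>x. f x * divergence \<phi> x \<partial>lborel) \<le> (\<integral>x. norm (g x) \<partial>lborel)"
proof -
  obtain R where R: "\<And>x. norm x > R \<Longrightarrow> \<phi> x = 0"
    using test_field_support[OF \<phi>] by metis
  have cg: "continuous_on UNIV g" using f unfolding C1_grad_def by blast
  have "- (\<integral>x. g x \<bullet> \<phi> x \<partial>lborel) = (\<integral>x. - (g x \<bullet> \<phi> x) \<partial>lborel)" by simp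
  also have "\<dots> \<le> (\<integral>x. norm (g x) \<partial>lborel)"
  proof (rule integral_mono[OF _ g])
    show "integrable lborel (\<lambda>x. - (g x \<bullet> \<phi> x))"
      by (rule continuous_bounded_support(1)[where R = R])
        (use R in \<open>auto intro!: continuous_intros test_field_continuous[OF \<phi>] cg\<close>)
    fix x
    have "- (g x \<bullet> \<phi> x) \<le> norm (g x) * norm (\<phi> x)"
      using Cauchy_Schwarz_ineq2[of "g x" "\<phi> x"] by linarith
    also have "\<dots> \<le> norm (g x)" using \<phi> unfolding test_field_def by (simp add: mult_left_le)
    finally show "- (g x \<bullet> \<phi> x) \<le> norm (g x)" .
  qed
  finally show ?thesis using integral_by_parts[OF f \<phi>] by simp
qed

text \<open>For smooth \<open>E\<close> the divergence theorem makes this the outward flux of \<phi>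
  through the boundary of \<open>E\<close>; the perimeter is its supremum over test fields.\<close>

abbreviation flux :: "'a::euclidean_space set \<Rightarrow> ('a \<Rightarrow> 'a) \<Rightarrow> real" where
  "flux E \<phi> \<equiv> \<integral>x. indicator E x * divergence \<phi> x \<partial>lborel"

text \<open>The perimeter integrates against the completed measure. On Borel sets the integral may
  be taken over \<open>lborel\<close>, where translations and Fubini are applied.\<close>

lemma set_integral_divergence_lborel:
  assumes "test_field \<phi>" "E \<in> sets borel"
  shows "(LINT x:E|lebesgue. divergence \<phi> x) = flux E \<phi>"
proof -
  have [measurable]: "divergence \<phi> \<in> borel_measurable borel"
    using continuous_on_divergence[OF assms(1)] by (rule borel_measurable_continuous_onI)
  show ?thesis unfolding set_lebesgue_integral_def
    using assms(2) by (subst integral_completion) auto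
qed

lemma perimeter_le_iff_lborel:
  assumes "0 \<le> c" "E \<in> sets borel"
  shows "perimeter E \<le> ennreal c \<longleftrightarrow>
    (\<forall>\<phi>. test_field \<phi> \<longrightarrow> flux E \<phi> \<le> c)"
  using assms by (auto simp: perimeter_le_iff set_integral_divergence_lborel)

lemma integrable_indicator_divergence:
  assumes "test_field \<phi>" "E \<in> sets borel"
  shows "integrable lborel (\<lambda>x. indicator E x * divergence \<phi> x)"
  using integrable_mult_indicator[OF _ test_field_divergence_bounds(1)[OF assms(1)], of E] assms(2) by simp

abbreviation vol :: "'a::euclidean_space set \<Rightarrow> real" where
  "vol \<equiv> measure lborel"

section \<open>Mollification\<close>

text \<open>The derivative \<open>2 * max 0 s\<close> is Lipschitz with constant 2, so the Taylor
  error is quadratic even across the kink at 0. This function is the profile of the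
  mollifier.\<close>

lemma max_zero_square_taylor:
  fixes s h :: real
  shows "\<bar>(max 0 (s + h))\<^sup>2 - (max 0 s)\<^sup>2 - 2 * max 0 s * h\<bar> \<le> h\<^sup>2"
proof (cases "0 \<le> s")
  case True
  show ?thesis
  proof (cases "0 \<le> s + h")
    case False
    have "s * s \<le> s * (- 2 * h)" using True False by (intro mult_left_mono) auto
    then have "0 \<le> -2 * s * h - s\<^sup>2" by (simp add: power2_eq_square mult_ac)
    moreover have "0 \<le> (s + h)\<^sup>2" by simp
    then have "-2 * s * h - s\<^sup>2 \<le> h\<^sup>2" by (simp add: power2_sum)
    ultimately show ?thesis using True False by (simp add: max_def)
  qed (use True in \<open>simp add: max_def power2_sum\<close>)
next
  case s: False
  show ?thesis
  proof (cases "0 \<le> s + h")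
    case True
    then have "(s + h)\<^sup>2 \<le> h\<^sup>2" using s by (intro power_mono) auto
    then show ?thesis using True s by (simp add: max_def)
  qed (use s in \<open>simp add: max_def\<close>)
qed

lemma has_derivative_of_quadratic_bound:
  fixes f :: "'a::real_normed_vector \<Rightarrow> 'b::real_normed_vector"
  assumes D: "bounded_linear D" and C: "\<And>v. norm v \<le> 1 \<Longrightarrow> norm (f (x + v) - f x - D v) \<le> C * (norm v)\<^sup>2"
  shows "(f has_derivative D) (at x)"
  unfolding has_derivative_within_alt
proof (intro conjI allI impI D)
  fix e :: real assume "0 < e"
  define d where "d = min 1 (e / (\<bar>C\<bar> + 1))"
  have "norm (f y - f x - D (y - x)) \<le> e * norm (y - x)" if "norm (y - x) < d" for y
  proof -
    have 1: "norm (y - x) \<le> 1" "norm (y - x) * (\<bar>C\<bar> + 1) \<le> e"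
      using that by (auto simp: d_def pos_le_divide_eq[symmetric] simp del: pos_le_divide_eq)
    have "norm (f y - f x - D (y - x)) \<le> C * (norm (y - x))\<^sup>2" using C[OF 1(1)] by simp
    also have "\<dots> \<le> (norm (y - x) * (\<bar>C\<bar> + 1)) * norm (y - x)"
    proof -
      have "C * (norm (y - x))\<^sup>2 \<le> (\<bar>C\<bar> + 1) * (norm (y - x))\<^sup>2" by (intro mult_right_mono) auto
      then show ?thesis by (simp only: power2_eq_square mult_ac)
    qed
    also have "\<dots> \<le> e * norm (y - x)" by (intro mult_right_mono 1) auto
    finally show ?thesis .
  qed
  moreover have "d > 0" using \<open>0 < e\<close> by (simp add: d_def add_nonneg_pos)
  ultimately show "\<exists>d>0. \<forall>y\<in>UNIV. norm (y - x) < d \<longrightarrow> norm (f y - f x - D (y - x)) \<le> e * norm (y - x)"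
    by blast
qed

text \<open>Test fields are only required to be C1, so a kernel with a uniform quadratic Taylor
  bound suffices; that bound also says that \<open>D\<close> is the gradient of \<rho>, and it
  passes to convolutions by integration. Evenness makes convolution with \<rho>
  self-adjoint.\<close>

definition mollifier :: "real \<Rightarrow> ('a::euclidean_space \<Rightarrow> real) \<Rightarrow> ('a \<Rightarrow> 'a) \<Rightarrow> bool" where
  "mollifier e \<rho> D \<longleftrightarrow> (\<forall>x. 0 \<le> \<rho> x) \<and> (\<forall>x. norm x > e \<longrightarrow> \<rho> x = 0 \<and> D x = 0) \<and>
     continuous_on UNIV \<rho> \<and> continuous_on UNIV D \<and> (\<integral>x. \<rho> x \<partial>lborel) = 1 \<and>
     (\<forall>x. \<rho> (- x) = \<rho> x \<and> D (- x) = - D x) \<and>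
     (\<exists>C. \<forall>x v. norm v \<le> 1 \<longrightarrow> \<bar>\<rho> (x + v) - \<rho> x - D x \<bullet> v\<bar> \<le> C * (norm v)\<^sup>2)"

lemma mollifier_exists:
  assumes "e > 0"
  obtains \<rho> :: "'a::euclidean_space \<Rightarrow> real" and D where "mollifier e \<rho> D"
proof -
  \<comment> \<open>The square of the positive part of \<open>e\<^sup>2 - x \<bullet> x\<close>,
    which vanishes outside the ball of radius \<open>e\<close>. Its gradient \<open>D\<close>
    collects a factor \<open>2 * max 0 s\<close> from the square and \<open>- 2 *\<^sub>R x\<close>
    from the inner function.\<close>
  define r :: "'a \<Rightarrow> real" where "r = (\<lambda>x. (max 0 (e\<^sup>2 - x \<bullet> x))\<^sup>2)"
  define D :: "'a \<Rightarrow> 'a" where "D = (\<lambda>x. (- 4 * max 0 (e\<^sup>2 - x \<bullet> x)) *\<^sub>R x)"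
  have cr: "continuous_on UNIV r" and cD: "continuous_on UNIV D"
    unfolding r_def D_def by (intro continuous_intros)+
  have out: "max 0 (e\<^sup>2 - x \<bullet> x) = 0" if "norm x > e" for x :: 'a
    using that power_mono[of e "norm x" 2] assms by (simp add: power2_norm_eq_inner[symmetric])
  then have outr: "r x = 0" "D x = 0" if "norm x > e" for x using that by (auto simp: r_def D_def)
  have ir: "integrable lborel r" using continuous_bounded_support(1)[OF cr outr(1)] .
  define Z where "Z = (\<integral>x. r x \<partial>lborel)"
  have "Z > 0"
  proof -
    have "0 < (e\<^sup>2 * (3/4))\<^sup>2 * vol (ball (0::'a) (e/2))"
      using assms content_ball_pos[of "e/2" "0::'a"] by simp
    also have "\<dots> = (\<integral>x. (e\<^sup>2 * (3/4))\<^sup>2 * indicator (ball (0::'a) (e/2)) x \<partial>lborel)" by simp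
    also have "\<dots> \<le> Z" unfolding Z_def
    proof (rule integral_mono[OF _ ir])
      show "integrable lborel (\<lambda>x. (e\<^sup>2 * (3/4))\<^sup>2 * indicator (ball (0::'a) (e/2)) x :: real)"
        by (intro integrable_mult_right integrable_real_indicator)
          (auto simp: emeasure_lborel_ball_finite[unfolded infinity_ennreal_def])
      fix x :: 'a
      have "(e\<^sup>2 * (3/4))\<^sup>2 \<le> r x" if "norm x < e / 2"
      proof -
        have "(norm x)\<^sup>2 \<le> (e/2)\<^sup>2" using that by (intro power_mono) auto
        then have "e\<^sup>2 * (3/4) \<le> e\<^sup>2 - x \<bullet> x"
          by (simp add: power2_norm_eq_inner[symmetric] power_divide)
        then have "e\<^sup>2 * (3/4) \<le> max 0 (e\<^sup>2 - x \<bullet> x)" by linarith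
        then show ?thesis unfolding r_def by (intro power_mono) auto
      qed
      then show "(e\<^sup>2 * (3/4))\<^sup>2 * indicator (ball (0::'a) (e/2)) x \<le> r x"
        by (auto simp: indicator_def r_def)
    qed
    finally show ?thesis .
  qed
  \<comment> \<open>For \<open>norm x \<le> e + 1\<close> the argument of the positive part changes
    by \<open>h\<close> with \<open>\<bar>h\<bar> \<le> (2 * (e + 1) + 1) * norm v\<close>; its
    square gives the first term. The second comes from the part \<open>v \<bullet> v\<close> of
    \<open>h\<close>, which is not linear in \<open>v\<close>. For larger \<open>norm x\<close> both
    points lie off the support.\<close>
  define C where "C = (2 * (e + 1) + 1)\<^sup>2 + 2 * e\<^sup>2"
  have taylor: "\<bar>r (x + v) - r x - D x \<bullet> v\<bar> \<le> C * (norm v)\<^sup>2" if v: "norm v \<le> 1" for x v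
  proof (cases "norm x \<le> e + 1")
    case True
    define s where "s = e\<^sup>2 - x \<bullet> x"
    define h where "h = - 2 * (x \<bullet> v) - v \<bullet> v"
    have sh: "e\<^sup>2 - (x + v) \<bullet> (x + v) = s + h"
      by (simp add: s_def h_def inner_add_left inner_add_right inner_commute[of v x])
    have "\<bar>h\<bar> \<le> 2 * (norm x * norm v) + norm v * norm v"
    proof -
      have "v \<bullet> v = norm v * norm v" by (simp add: power2_norm_eq_inner[symmetric] power2_eq_square)
      moreover have "v \<bullet> v \<ge> 0" by simp
      ultimately show ?thesis using Cauchy_Schwarz_ineq2[of x v] unfolding h_def by linarith
    qed
    also have "\<dots> \<le> 2 * ((e + 1) * norm v) + 1 * norm v"
      using True v by (intro add_mono mult_left_mono mult_right_mono) auto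
    finally have "\<bar>h\<bar> \<le> (2 * (e + 1) + 1) * norm v" by (simp add: algebra_simps)
    then have "\<bar>h\<bar>\<^sup>2 \<le> ((2 * (e + 1) + 1) * norm v)\<^sup>2" by (intro power_mono) auto
    then have h2: "h\<^sup>2 \<le> (2 * (e + 1) + 1)\<^sup>2 * (norm v)\<^sup>2" by (simp add: power_mult_distrib)
    have ms: "0 \<le> max 0 s" "max 0 s \<le> e\<^sup>2" by (auto simp: s_def)
    have "r (x + v) - r x - D x \<bullet> v = ((max 0 (s + h))\<^sup>2 - (max 0 s)\<^sup>2 - 2 * max 0 s * h) - 2 * max 0 s * (v \<bullet> v)"
      unfolding r_def D_def sh by (simp add: s_def[symmetric]) (simp add: h_def algebra_simps)
    moreover have "0 \<le> 2 * max 0 s * (v \<bullet> v)" using ms(1) by (intro mult_nonneg_nonneg) auto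
    ultimately have "\<bar>r (x + v) - r x - D x \<bullet> v\<bar> \<le> h\<^sup>2 + 2 * max 0 s * (v \<bullet> v)"
      using max_zero_square_taylor[of s h] by linarith
    also have "\<dots> \<le> (2 * (e + 1) + 1)\<^sup>2 * (norm v)\<^sup>2 + 2 * e\<^sup>2 * (v \<bullet> v)"
      using h2 ms by (intro add_mono mult_right_mono) auto
    finally show ?thesis by (simp add: C_def power2_norm_eq_inner distrib_right)
  next
    case False
    then have "norm (x + v) > e" "norm x > e" using v norm_triangle_ineq4[of "x + v" v] by auto
    then show ?thesis using outr by (simp add: C_def)
  qed
  have "mollifier e (\<lambda>x. r x / Z) (\<lambda>x. (1 / Z) *\<^sub>R D x)"
    unfolding mollifier_def
  proof (intro conjI)
    show "\<exists>C. \<forall>x v. norm v \<le> 1 \<longrightarrow> \<bar>r (x + v) / Z - r x / Z - (1 / Z) *\<^sub>R D x \<bullet> v\<bar> \<le> C * (norm v)\<^sup>2"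
    proof (intro exI[of _ "C / Z"] allI impI)
      fix x v :: 'a assume v: "norm v \<le> 1"
      have "r (x + v) / Z - r x / Z - (1 / Z) *\<^sub>R D x \<bullet> v = (r (x + v) - r x - D x \<bullet> v) / Z"
        by (simp add: diff_divide_distrib)
      then show "\<bar>r (x + v) / Z - r x / Z - (1 / Z) *\<^sub>R D x \<bullet> v\<bar> \<le> C / Z * (norm v)\<^sup>2"
        using taylor[OF v, of x] \<open>Z > 0\<close> by (simp add: divide_right_mono)
    qed
    show "continuous_on UNIV (\<lambda>x. r x / Z)" "continuous_on UNIV (\<lambda>x. (1 / Z) *\<^sub>R D x)"
      using \<open>Z > 0\<close> by (auto intro!: continuous_intros cr cD)
    show "(\<integral>x. r x / Z \<partial>lborel) = 1" using \<open>Z > 0\<close> by (simp add: Z_def[symmetric])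
  qed (use \<open>Z > 0\<close> outr in \<open>auto simp: r_def D_def\<close>)
  then show thesis by (rule that)
qed

section \<open>Convolution with a mollifier\<close>

context
  fixes e :: real and \<rho> :: "'a::euclidean_space \<Rightarrow> real" and D :: "'a \<Rightarrow> 'a"
  assumes m: "mollifier e \<rho> D"
begin

lemma mollifier_measurable: "\<rho> \<in> borel_measurable borel" "D \<in> borel_measurable borel"
  using m unfolding mollifier_def by (auto intro: borel_measurable_continuous_onI)

lemma mollifier_bounded: "\<exists>M\<ge>0. \<forall>x. \<bar>\<rho> x\<bar> \<le> M \<and> norm (D x) \<le> M"
proof -
  obtain M1 where "M1 \<ge> 0" "\<forall>x. norm (\<rho> x) \<le> M1"
    using continuous_bounded_support(2)[of \<rho> e] m unfolding mollifier_def by blast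
  moreover obtain M2 where "M2 \<ge> 0" "\<forall>x. norm (D x) \<le> M2"
    using continuous_bounded_support(2)[of D e] m unfolding mollifier_def by blast
  ultimately show ?thesis by (intro exI[of _ "max M1 M2"]) (auto simp: le_max_iff_disj)
qed

lemma integrable_mollified:
  fixes f :: "'a \<Rightarrow> 'b::euclidean_space"
  assumes f: "integrable lborel f"
  shows "integrable lborel (\<lambda>y. \<rho> (x - y) *\<^sub>R f y)" "integrable lborel (\<lambda>y. (D (x - y) \<bullet> v) *\<^sub>R f y)"
proof -
  have [measurable]: "f \<in> borel_measurable borel" using borel_measurable_integrable[OF f] by simp
  note [measurable] = mollifier_measurable
  obtain M where M: "M \<ge> 0" "\<And>x. \<bar>\<rho> x\<bar> \<le> M" "\<And>x. norm (D x) \<le> M" using mollifier_bounded by blast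
  have i: "integrable lborel (\<lambda>y. M * norm (f y))" for M :: real using f by simp
  show "integrable lborel (\<lambda>y. \<rho> (x - y) *\<^sub>R f y)"
    by (rule Bochner_Integration.integrable_bound[OF i[of M]]) (use M in \<open>auto intro!: mult_right_mono simp: abs_mult\<close>)
  show "integrable lborel (\<lambda>y. (D (x - y) \<bullet> v) *\<^sub>R f y)"
  proof (rule Bochner_Integration.integrable_bound[OF i[of "M * norm v"]])
    have "\<bar>D z \<bullet> v\<bar> \<le> M * norm v" for z
      using Cauchy_Schwarz_ineq2[of "D z" v] mult_right_mono[OF M(3)[of z] norm_ge_zero[of v]] by linarith
    then show "AE y in lborel. norm ((D (x - y) \<bullet> v) *\<^sub>R f y) \<le> norm (M * norm v * norm (f y))"
      using M(1) by (auto intro!: mult_right_mono simp: abs_mult)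
  qed auto
qed

text \<open>Integrating the quadratic Taylor bound of \<rho> against \<open>norm (f y)\<close>
  yields one for the convolution, with the L1 norm of \<open>f\<close> as an additional
  factor.\<close>

lemma mollified_has_derivative:
  fixes f :: "'a \<Rightarrow> 'b::euclidean_space"
  assumes f: "integrable lborel f"
  shows "((\<lambda>x. \<integral>y. \<rho> (x - y) *\<^sub>R f y \<partial>lborel) has_derivative
           (\<lambda>v. \<integral>y. (D (x - y) \<bullet> v) *\<^sub>R f y \<partial>lborel)) (at x)"
proof -
  note i = integrable_mollified[OF f]
  obtain C where C: "\<And>x v. norm v \<le> 1 \<Longrightarrow> \<bar>\<rho> (x + v) - \<rho> x - D x \<bullet> v\<bar> \<le> C * (norm v)\<^sup>2"
    using m unfolding mollifier_def by blast
  have "linear (\<lambda>v. \<integral>y. (D (x - y) \<bullet> v) *\<^sub>R f y \<partial>lborel)"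
  proof (rule linearI)
    show "(\<integral>y. (D (x - y) \<bullet> (a + b)) *\<^sub>R f y \<partial>lborel)
        = (\<integral>y. (D (x - y) \<bullet> a) *\<^sub>R f y \<partial>lborel) + (\<integral>y. (D (x - y) \<bullet> b) *\<^sub>R f y \<partial>lborel)" for a b
      by (simp only: inner_add_right scaleR_add_left Bochner_Integration.integral_add[OF i(2) i(2)])
    show "(\<integral>y. (D (x - y) \<bullet> (r *\<^sub>R a)) *\<^sub>R f y \<partial>lborel)
        = r *\<^sub>R (\<integral>y. (D (x - y) \<bullet> a) *\<^sub>R f y \<partial>lborel)" for r a
      by (simp only: inner_scaleR_right scaleR_scaleR[symmetric] integral_scaleR_right)
  qed
  then have bl: "bounded_linear (\<lambda>v. \<integral>y. (D (x - y) \<bullet> v) *\<^sub>R f y \<partial>lborel)"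
    by (simp add: linear_conv_bounded_linear)
  show ?thesis
  proof (rule has_derivative_of_quadratic_bound[OF bl])
    fix v :: 'a assume v: "norm v \<le> 1"
    have "(\<integral>y. \<rho> (x + v - y) *\<^sub>R f y \<partial>lborel) - (\<integral>y. \<rho> (x - y) *\<^sub>R f y \<partial>lborel) - (\<integral>y. (D (x - y) \<bullet> v) *\<^sub>R f y \<partial>lborel)
        = (\<integral>y. \<rho> (x + v - y) *\<^sub>R f y - \<rho> (x - y) *\<^sub>R f y - (D (x - y) \<bullet> v) *\<^sub>R f y \<partial>lborel)"
      by (simp add: i)
    also have "norm \<dots> \<le> (\<integral>y. (C * (norm v)\<^sup>2) * norm (f y) \<partial>lborel)"
    proof (rule order_trans[OF integral_norm_bound], rule integral_mono)
      fix y
      have "norm (\<rho> (x + v - y) *\<^sub>R f y - \<rho> (x - y) *\<^sub>R f y - (D (x - y) \<bullet> v) *\<^sub>R f y)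
          = \<bar>\<rho> ((x - y) + v) - \<rho> (x - y) - D (x - y) \<bullet> v\<bar> * norm (f y)"
      proof -
        have "x + v - y = (x - y) + v" by simp
        then show ?thesis by (simp only: scaleR_diff_left[symmetric] norm_scaleR real_norm_def)
      qed
      then show "norm (\<rho> (x + v - y) *\<^sub>R f y - \<rho> (x - y) *\<^sub>R f y - (D (x - y) \<bullet> v) *\<^sub>R f y)
          \<le> (C * (norm v)\<^sup>2) * norm (f y)"
        using C[OF v] by (simp add: mult_right_mono)
    qed (auto intro!: i integrable_norm integrable_mult_right Bochner_Integration.integrable_diff f)
    also have "\<dots> = (C * (\<integral>y. norm (f y) \<partial>lborel)) * (norm v)\<^sup>2" by simp
    finally show "norm ((\<integral>y. \<rho> (x + v - y) *\<^sub>R f y \<partial>lborel) - (\<integral>y. \<rho> (x - y) *\<^sub>R f y \<partial>lborel) - (\<integral>y. (D (x - y) \<bullet> v) *\<^sub>R f y \<partial>lborel))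
       \<le> (C * (\<integral>y. norm (f y) \<partial>lborel)) * (norm v)\<^sup>2" .
  qed
qed

lemma mollified_continuous_derivative:
  fixes f :: "'a \<Rightarrow> 'b::euclidean_space"
  assumes f: "integrable lborel f"
  shows "continuous_on UNIV (\<lambda>x. \<integral>y. (D (x - y) \<bullet> v) *\<^sub>R f y \<partial>lborel)"
proof (rule continuous_at_imp_continuous_on, rule ballI)
  fix x
  note [measurable] = mollifier_measurable
  have [measurable]: "f \<in> borel_measurable borel" using borel_measurable_integrable[OF f] by simp
  obtain M where M: "M \<ge> 0" "\<And>x. norm (D x) \<le> M" using mollifier_bounded by blast
  have b: "\<bar>D z \<bullet> v\<bar> \<le> M * norm v" for z
    using Cauchy_Schwarz_ineq2[of "D z" v] mult_right_mono[OF M(2)[of z] norm_ge_zero[of v]] by linarith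
  have cD: "isCont D z" for z
    using m unfolding mollifier_def by (auto simp: continuous_on_eq_continuous_at)
  show "isCont (\<lambda>x. \<integral>y. (D (x - y) \<bullet> v) *\<^sub>R f y \<partial>lborel) x"
    unfolding continuous_at_sequentially comp_def
  proof (intro allI impI)
    fix X assume X: "X \<longlonglongrightarrow> x"
    show "(\<lambda>n. \<integral>y. (D (X n - y) \<bullet> v) *\<^sub>R f y \<partial>lborel) \<longlonglongrightarrow> (\<integral>y. (D (x - y) \<bullet> v) *\<^sub>R f y \<partial>lborel)"
    proof (rule integral_dominated_convergence[where w = "\<lambda>y. (M * norm v) * norm (f y)"])
      show "AE y in lborel. (\<lambda>n. (D (X n - y) \<bullet> v) *\<^sub>R f y) \<longlonglongrightarrow> (D (x - y) \<bullet> v) *\<^sub>R f y"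
        by (intro AE_I2 tendsto_intros isCont_tendsto_compose[OF cD] X)
      show "AE y in lborel. norm ((D (X n - y) \<bullet> v) *\<^sub>R f y) \<le> (M * norm v) * norm (f y)" for n
        by (intro AE_I2) (use b in \<open>auto intro!: mult_right_mono\<close>)
    qed (use f in auto)
  qed
qed

lemma integral_mollifier_reflect: "(\<integral>x. \<rho> (y - x) \<partial>lborel) = 1"
proof -
  have "\<rho> (y - x) = \<rho> (x + (- y))" for x
    using m unfolding mollifier_def by (metis minus_diff_eq uminus_add_conv_diff add.commute)
  then have "(\<integral>x. \<rho> (y - x) \<partial>lborel) = (\<integral>x. \<rho> (x + (- y)) \<partial>lborel)" by simp
  then show ?thesis using m unfolding mollifier_def by (simp only: integral_translate[OF mollifier_measurable(1)])
qed

text \<open>The integral of a nonintegrable function is 0 by convention, so the value 1 already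
  forces integrability.\<close>

lemma integrable_mollifier_reflect: "integrable lborel (\<lambda>x. \<rho> (y - x))"
  using integral_mollifier_reflect[of y] not_integrable_integral_eq[of lborel "\<lambda>x. \<rho> (y - x)"] by linarith

text \<open>Produces an admissible field from one that is merely measurable: the kernel is a
  probability density, so averaging preserves the bound 1, and the support grows by \<open>e\<close>
  only.\<close>

lemma test_field_mollified:
  fixes \<eta> :: "'a \<Rightarrow> 'a"
  assumes i: "integrable lborel \<eta>" and n: "\<And>x. norm (\<eta> x) \<le> 1" and R: "\<And>x. norm x > R \<Longrightarrow> \<eta> x = 0"
  shows "test_field (\<lambda>x. \<integral>y. \<rho> (x - y) *\<^sub>R \<eta> y \<partial>lborel)" (is "test_field ?F")
    and "divergence (\<lambda>x. \<integral>y. \<rho> (x - y) *\<^sub>R \<eta> y \<partial>lborel) x = (\<integral>y. D (x - y) \<bullet> \<eta> y \<partial>lborel)"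
proof -
  note d = mollified_has_derivative[OF i]
  have fd: "frechet_derivative ?F (at x) = (\<lambda>v. \<integral>y. (D (x - y) \<bullet> v) *\<^sub>R \<eta> y \<partial>lborel)" for x
    using d by (rule frechet_derivative_at[symmetric])
  show "divergence ?F x = (\<integral>y. D (x - y) \<bullet> \<eta> y \<partial>lborel)"
  proof -
    have "divergence ?F x = (\<Sum>b\<in>Basis. \<integral>y. (D (x - y) \<bullet> b) *\<^sub>R \<eta> y \<bullet> b \<partial>lborel)"
      unfolding divergence_def fd
      by (intro sum.cong refl integral_inner_left[symmetric] integrable_mollified(2)[OF i])
    also have "\<dots> = (\<integral>y. (\<Sum>b\<in>Basis. (D (x - y) \<bullet> b) *\<^sub>R \<eta> y \<bullet> b) \<partial>lborel)"
      by (intro Bochner_Integration.integral_sum[symmetric] integrable_inner_left integrable_mollified(2)[OF i])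
    also have "\<dots> = (\<integral>y. D (x - y) \<bullet> \<eta> y \<partial>lborel)"
      by (intro Bochner_Integration.integral_cong refl) (subst (3) euclidean_inner, simp)
    finally show ?thesis .
  qed
  have norm1: "norm (?F x) \<le> 1" for x
  proof -
    have "norm (?F x) \<le> (\<integral>y. norm (\<rho> (x - y) *\<^sub>R \<eta> y) \<partial>lborel)" by (rule integral_norm_bound)
    also have "\<dots> \<le> (\<integral>y. \<rho> (x - y) \<partial>lborel)"
      using n m unfolding mollifier_def
      by (intro integral_mono integrable_norm integrable_mollified(1)[OF i] integrable_mollifier_reflect)
        (auto simp: mult_left_le)
    finally show ?thesis by (simp add: integral_mollifier_reflect)
  qed
  have "?F x = 0" if "norm x > R + e" for x
  proof -
    have "\<rho> (x - y) *\<^sub>R \<eta> y = 0" for y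
    proof (cases "norm y > R")
      case False
      then have "norm (x - y) > e" using that norm_triangle_ineq2[of x y] by linarith
      then show ?thesis using m unfolding mollifier_def by simp
    qed (simp add: R)
    then show ?thesis by (simp only: integral_zero)
  qed
  then have "{x. ?F x \<noteq> 0} \<subseteq> cball 0 (R + e)"
    by (intro subsetI) (metis (mono_tags, lifting) mem_Collect_eq mem_cball_0 not_le)
  then have "compact (closure {x. ?F x \<noteq> 0})"
    unfolding compact_closure by (rule bounded_subset[OF bounded_cball])
  moreover have "Ck 1 ?F"
    unfolding One_nat_def Ck.simps fd
    using d by (auto simp: differentiable_on_def differentiable_def intro: mollified_continuous_derivative[OF i])
  ultimately show "test_field ?F" unfolding test_field_def using norm1 by blast
qed

end

lemma integrable_pair_bounded:
  fixes f :: "'a::euclidean_space \<times> 'b::euclidean_space \<Rightarrow> real"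
  assumes [measurable]: "f \<in> borel_measurable (lborel \<Otimes>\<^sub>M lborel)"
    and M: "\<And>z. \<bar>f z\<bar> \<le> M" and R: "\<And>x y. f (x, y) \<noteq> 0 \<Longrightarrow> norm x \<le> R \<and> norm y \<le> R"
  shows "integrable (lborel \<Otimes>\<^sub>M lborel) f"
proof (rule integrableI_bounded_set[where A = "cball 0 R \<times> cball 0 R" and B = M])
  have "bounded (cball (0::'a) R \<times> cball (0::'b) R)" by (intro bounded_Times bounded_cball)
  from emeasure_bounded_finite[OF this]
  show "emeasure (lborel \<Otimes>\<^sub>M lborel) (cball (0::'a) R \<times> cball (0::'b) R) < \<infinity>"
    by (simp add: lborel_prod)
  show "AE z in lborel \<Otimes>\<^sub>M lborel. z \<in> cball 0 R \<times> cball 0 R \<longrightarrow> norm (f z) \<le> M"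
    using M by auto
  have "f z = 0" if "z \<notin> cball 0 R \<times> cball 0 R" for z
  proof (rule ccontr)
    assume "f z \<noteq> 0"
    then show False using that R[of "fst z" "snd z"] by (cases z) auto
  qed
  then show "AE z in lborel \<Otimes>\<^sub>M lborel. z \<notin> cball 0 R \<times> cball 0 R \<longrightarrow> f z = 0" by auto
  have "closed (cball (0::'a) R \<times> cball (0::'b) R)" by (intro closed_Times closed_cball)
  then show "cball (0::'a) R \<times> cball (0::'b) R \<in> sets (lborel \<Otimes>\<^sub>M lborel)"
    by (simp add: lborel_prod)
qed (rule assms(1))

text \<open>The bound on the L1 norm of the gradient is a duality argument. Pairing \<open>g\<close>
  with \<open>\<eta> = - sgn g\<close> gives minus this norm; Fubini and oddness of \<open>D\<close>
  move the mollifier from the indicator to \<eta>, so the norm equals the flux through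
  \<open>E\<close> of the mollified \<eta>, a test field.\<close>

lemma mollified_indicator:
  fixes E :: "'a::euclidean_space set"
  assumes m: "mollifier e \<rho> D" and E [measurable]: "E \<in> sets borel" and bE: "bounded E"
    and P: "perimeter E \<le> ennreal c" "0 \<le> c"
  defines "u \<equiv> \<lambda>x. \<integral>y. \<rho> (x - y) * indicator E y \<partial>lborel"
  defines "g \<equiv> \<lambda>x. \<integral>y. indicator E y *\<^sub>R D (x - y) \<partial>lborel"
  shows "C1_grad u g" "\<And>x. 0 \<le> u x" "\<And>x. u x \<le> 1" "\<exists>R. \<forall>x. norm x > R \<longrightarrow> u x = 0"
    "integrable lborel (\<lambda>x. norm (g x))" "(\<integral>x. norm (g x) \<partial>lborel) \<le> c"
proof -
  note [measurable] = mollifier_measurable[OF m]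
  have m': "\<And>x. 0 \<le> \<rho> x" "\<And>x. norm x > e \<Longrightarrow> \<rho> x = 0" "\<And>x. norm x > e \<Longrightarrow> D x = 0" "\<And>x. D (- x) = - D x"
    using m unfolding mollifier_def by auto
  obtain M where M: "M \<ge> 0" "\<And>x. \<bar>\<rho> x\<bar> \<le> M" "\<And>x. norm (D x) \<le> M" using mollifier_bounded[OF m] by blast
  obtain R where R: "R > 0" "\<And>x. x \<in> E \<Longrightarrow> norm x \<le> R" using bE unfolding bounded_pos by blast
  have iE: "integrable lborel (indicator E :: 'a \<Rightarrow> real)"
    using emeasure_bounded_finite[OF bE] by (intro integrable_real_indicator) auto
  have iD: "integrable lborel (\<lambda>y. indicator E y *\<^sub>R D (x - y))" for x
  proof (rule Bochner_Integration.integrable_bound[OF integrable_mult_right[OF iE, of M]])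
    show "AE y in lborel. norm (indicator E y *\<^sub>R D (x - y)) \<le> norm (M * indicator E y)"
      using M by (intro AE_I2) (auto simp: indicator_def)
  qed measurable
  have gv: "(\<integral>y. (D (x - y) \<bullet> v) *\<^sub>R indicator E y \<partial>lborel) = g x \<bullet> v" for x v
    unfolding g_def
    by (subst integral_inner_left[symmetric]) (use iD in \<open>auto simp: mult.commute\<close>)
  show "C1_grad u g"
    unfolding C1_grad_def
  proof (intro conjI allI)
    show "(u has_derivative (\<lambda>v. g x \<bullet> v)) (at x)" for x
      using mollified_has_derivative[OF m iE, of x] unfolding gv u_def by simp
    have "continuous_on UNIV (\<lambda>x. g x \<bullet> b)" for b
      using mollified_continuous_derivative[OF m iE, of b] unfolding gv .
    then show cg: "continuous_on UNIV g" by (subst continuous_on_componentwise) auto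
  qed
  then have "continuous_on UNIV g" unfolding C1_grad_def by blast
  then have [measurable]: "g \<in> borel_measurable borel" by (rule borel_measurable_continuous_onI)
  show "0 \<le> u x" for x unfolding u_def using m'(1) by (intro Bochner_Integration.integral_nonneg) auto
  show "u x \<le> 1" for x
  proof -
    have "u x \<le> (\<integral>y. \<rho> (x - y) \<partial>lborel)"
      unfolding u_def using m'(1) integrable_mollified(1)[OF m iE, of x]
      by (intro integral_mono integrable_mollifier_reflect[OF m]) (auto simp: indicator_def)
    then show ?thesis by (simp add: integral_mollifier_reflect[OF m])
  qed
  have far: "norm (x - y) > e" if "y \<in> E" "norm x > R + e" for x y
    using that R(2)[of y] norm_triangle_ineq2[of x y] by linarith
  have "u x = 0" if "norm x > R + e" for x
  proof -
    have "\<rho> (x - y) * indicator E y = 0" for y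
      using far[of y x] that m'(2) by (cases "y \<in> E") auto
    then show ?thesis unfolding u_def by (simp only: integral_zero)
  qed
  then show "\<exists>R. \<forall>x. norm x > R \<longrightarrow> u x = 0" by blast
  have g0: "g x = 0" if "norm x > R + e" for x
  proof -
    have "indicator E y *\<^sub>R D (x - y) = 0" for y
      using far[of y x] that m'(3) by (cases "y \<in> E") auto
    then show ?thesis unfolding g_def by (simp only: integral_zero)
  qed
  show ing: "integrable lborel (\<lambda>x. norm (g x))"
    by (rule continuous_bounded_support(1)[where R = "R + e"])
      (use \<open>continuous_on UNIV g\<close> g0 in \<open>auto intro: continuous_intros\<close>)
  define \<eta> where "\<eta> = (\<lambda>x. - sgn (g x))"
  have [measurable]: "\<eta> \<in> borel_measurable borel" unfolding \<eta>_def sgn_div_norm by measurable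
  have \<eta>0: "\<eta> x = 0" if "norm x > R + e" for x using g0[OF that] by (simp add: \<eta>_def)
  have \<eta>1: "norm (\<eta> x) \<le> 1" for x by (simp add: \<eta>_def norm_sgn)
  have i\<eta>: "integrable lborel \<eta>"
    by (rule integrableI_bounded_set[where A = "cball 0 (R + e)" and B = 1])
      (use \<eta>0 \<eta>1 in \<open>auto simp: emeasure_lborel_cball_finite[unfolded infinity_ennreal_def]\<close>)
  define F where "F = (\<lambda>x. \<integral>y. \<rho> (x - y) *\<^sub>R \<eta> y \<partial>lborel)"
  have tF: "test_field F" and dF: "\<And>x. divergence F x = (\<integral>y. D (x - y) \<bullet> \<eta> y \<partial>lborel)"
    using test_field_mollified[OF m i\<eta> \<eta>1 \<eta>0] unfolding F_def by blast+
  have pair: "integrable (lborel \<Otimes>\<^sub>M lborel) (\<lambda>(x, y). indicator E y * (D (x - y) \<bullet> \<eta> x))"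
  proof (rule integrable_pair_bounded[where M = M and R = "R + \<bar>e\<bar>"])
    show "\<bar>case z of (x, y) \<Rightarrow> indicator E y * (D (x - y) \<bullet> \<eta> x)\<bar> \<le> M" for z
    proof -
      have "\<bar>D a \<bullet> \<eta> b\<bar> \<le> M" for a b
      proof -
        have "\<bar>D a \<bullet> \<eta> b\<bar> \<le> norm (D a) * norm (\<eta> b)" by (rule Cauchy_Schwarz_ineq2)
        also have "\<dots> \<le> M * 1" using M \<eta>1 by (intro mult_mono) auto
        finally show ?thesis by simp
      qed
      then show ?thesis using M(1) by (auto simp: indicator_def split: prod.split)
    qed
    fix x y assume "(case (x, y) of (x, y) \<Rightarrow> indicator E y * (D (x - y) \<bullet> \<eta> x)) \<noteq> 0"
    then have "y \<in> E" "\<eta> x \<noteq> 0" by (auto simp: indicator_def split: if_splits)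
    then show "norm x \<le> R + \<bar>e\<bar> \<and> norm y \<le> R + \<bar>e\<bar>" using R(2)[of y] \<eta>0[of x] by force
  qed measurable
  have "(\<integral>x. norm (g x) \<partial>lborel) = (\<integral>x. - (g x \<bullet> \<eta> x) \<partial>lborel)"
  proof -
    have "norm (g x) = - (g x \<bullet> \<eta> x)" for x
      by (cases "g x = 0") (auto simp: \<eta>_def sgn_div_norm dot_square_norm power2_eq_square)
    then show ?thesis by (rule Bochner_Integration.integral_cong[OF refl])
  qed
  also have "\<dots> = - (\<integral>x. (\<integral>y. indicator E y * (D (x - y) \<bullet> \<eta> x) \<partial>lborel) \<partial>lborel)"
  proof -
    have "g x \<bullet> \<eta> x = (\<integral>y. indicator E y * (D (x - y) \<bullet> \<eta> x) \<partial>lborel)" for x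
      unfolding g_def by (subst integral_inner_left[symmetric]) (use iD in auto)
    then show ?thesis by simp
  qed
  also have "\<dots> = - (\<integral>y. (\<integral>x. indicator E y * (D (x - y) \<bullet> \<eta> x) \<partial>lborel) \<partial>lborel)"
    using lborel_pair.Fubini_integral[OF pair] by simp
  also have "\<dots> = flux E F"
  proof -
    have "D (y - x) \<bullet> \<eta> x = - (D (x - y) \<bullet> \<eta> x)" for x y
      using m'(4)[of "x - y"] by simp
    then have "divergence F y = - (\<integral>x. D (x - y) \<bullet> \<eta> x \<partial>lborel)" for y
      unfolding dF by simp
    then show ?thesis by simp
  qed
  also have "\<dots> \<le> c"
    using P tF by (simp add: perimeter_le_iff_lborel[OF P(2) E])
  finally show "(\<integral>x. norm (g x) \<partial>lborel) \<le> c" .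
qed

text \<open>Take \<open>K\<close> closed and \<open>U\<close> open with
  \<open>K \<subseteq> E \<subseteq> U\<close> and a difference \<open>W\<close> of volume at most
  \<open>\<delta> / 2\<close>. If the radius is less than the distance of \<open>K\<close> from the
  complement of \<open>U\<close>, an average can mix inside and outside of \<open>E\<close> only
  through points of \<open>W\<close>. The error is thus at most the indicator of \<open>W\<close>
  plus its mollification, and both integrate to the volume of \<open>W\<close>.\<close>

lemma mollified_indicator_L1:
  fixes E :: "'a::euclidean_space set"
  assumes E [measurable]: "E \<in> sets borel" and bE: "bounded E" and "\<delta> > 0"
  shows "\<exists>e>0. \<forall>\<rho> D. mollifier e \<rho> D \<longrightarrow>
    (\<integral>x. \<bar>(\<integral>y. \<rho> (x - y) * indicator E y \<partial>lborel) - indicator E x\<bar> \<partial>lborel) \<le> \<delta>"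
proof -
  have lE: "E \<in> sets lebesgue" and d4: "\<delta> / 4 > 0" using E assms(3) by simp_all
  obtain U where U: "open U" "E \<subseteq> U" "emeasure lebesgue (U - E) < ennreal (\<delta> / 4)"
    by (rule sets_lebesgue_outer_open[OF lE d4])
  obtain K where K: "closed K" "K \<subseteq> E" "emeasure lebesgue (E - K) < ennreal (\<delta> / 4)"
    by (rule sets_lebesgue_inner_closed[OF lE d4])
  have "compact K" using K bE bounded_subset compact_eq_bounded_closed by metis
  then obtain d where d: "d > 0" "\<And>x y. x \<in> K \<Longrightarrow> y \<notin> U \<Longrightarrow> d \<le> dist x y"
    using separate_compact_closed[OF \<open>compact K\<close> closed_Compl[OF U(1)]] U(2) K(2) by blast
  have [measurable]: "K \<in> sets borel" "U \<in> sets borel" using K(1) U(1) by auto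
  define W where "W = U - K"
  have [measurable]: "W \<in> sets borel" unfolding W_def by measurable
  have W: "emeasure lborel W \<le> ennreal (\<delta> / 2)"
  proof -
    have "emeasure lborel W \<le> emeasure lborel ((U - E) \<union> (E - K))"
      unfolding W_def by (rule emeasure_mono) auto
    also have "\<dots> \<le> emeasure lborel (U - E) + emeasure lborel (E - K)"
      by (rule emeasure_subadditive) auto
    also have "\<dots> \<le> ennreal (\<delta> / 4) + ennreal (\<delta> / 4)"
      using U(3) K(3) by (intro add_mono) auto
    also have "\<dots> = ennreal (\<delta> / 2)" using assms(3) by (subst ennreal_plus[symmetric]) auto
    finally show ?thesis .
  qed
  have "(\<integral>x. \<bar>(\<integral>y. \<rho> (x - y) * indicator E y \<partial>lborel) - indicator E x\<bar> \<partial>lborel) \<le> \<delta>"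
    if m: "mollifier (d / 2) \<rho> D" for \<rho> :: "'a \<Rightarrow> real" and D
  proof -
    note [measurable] = mollifier_measurable[OF m]
    have m': "\<And>x. 0 \<le> \<rho> x" "\<And>x. norm x > d / 2 \<Longrightarrow> \<rho> x = 0" "(\<integral>x. \<rho> x \<partial>lborel) = 1"
      using m unfolding mollifier_def by auto
    have iE: "integrable lborel (indicator E :: 'a \<Rightarrow> real)"
      using emeasure_bounded_finite[OF bE] by (intro integrable_real_indicator) auto
    have i1: "integrable lborel (\<lambda>y. \<rho> (x - y) * indicator E y)" for x
      using integrable_mollified(1)[OF m iE] by simp
    have nn: "(\<integral>\<^sup>+y. ennreal (\<rho> (x - y)) \<partial>lborel) = 1" for x
      using nn_integral_eq_integral[OF integrable_mollifier_reflect[OF m], of x] m'(1)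
      by (simp add: integral_mollifier_reflect[OF m])
    have nn': "(\<integral>\<^sup>+x. ennreal (\<rho> (x - y)) \<partial>lborel) = 1" for y
    proof -
      have "\<rho> (x - y) = \<rho> (y - x)" for x
        using m unfolding mollifier_def by (metis minus_diff_eq)
      then show ?thesis using nn[of y] by simp
    qed
    have pt: "ennreal \<bar>(\<integral>y. \<rho> (x - y) * indicator E y \<partial>lborel) - indicator E x\<bar>
        \<le> indicator W x + (\<integral>\<^sup>+y. ennreal (\<rho> (x - y)) * indicator W y \<partial>lborel)" for x
    proof -
      have ii: "integrable lborel (\<lambda>y. \<rho> (x - y) * (indicator E y - indicator E x))"
        using Bochner_Integration.integrable_diff[OF i1[of x] integrable_mult_left[OF integrable_mollifier_reflect[OF m, of x], of "indicator E x"]]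
        by (simp add: right_diff_distrib)
      have "(\<integral>y. \<rho> (x - y) * indicator E y \<partial>lborel) - indicator E x
          = (\<integral>y. \<rho> (x - y) * (indicator E y - indicator E x) \<partial>lborel)"
        using i1 integrable_mollifier_reflect[OF m]
        by (simp add: right_diff_distrib integral_mollifier_reflect[OF m])
      then have "ennreal \<bar>(\<integral>y. \<rho> (x - y) * indicator E y \<partial>lborel) - indicator E x\<bar>
         \<le> (\<integral>\<^sup>+y. ennreal (norm (\<rho> (x - y) * (indicator E y - indicator E x))) \<partial>lborel)"
        using integral_norm_bound_ennreal[OF ii] by (simp only: real_norm_def)
      also have "\<dots> \<le> (\<integral>\<^sup>+y. ennreal (\<rho> (x - y)) * indicator W x + ennreal (\<rho> (x - y)) * indicator W y \<partial>lborel)"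
      proof (rule nn_integral_mono)
        fix y
        show "ennreal (norm (\<rho> (x - y) * (indicator E y - indicator E x)))
            \<le> ennreal (\<rho> (x - y)) * indicator W x + ennreal (\<rho> (x - y)) * indicator W y"
        proof (cases "norm (x - y) > d / 2 \<or> (x \<in> E \<longleftrightarrow> y \<in> E)")
          case True
          then show ?thesis using m'(2) by (auto simp: indicator_def)
        next
          case False
          then have n: "dist x y < d" "dist y x < d" using d(1) by (auto simp: dist_norm norm_minus_commute)
          have "y \<in> U" if "x \<in> K" using d(2)[OF that, of y] n(1) by (meson not_le)
          moreover have "x \<in> U" if "y \<in> K" using d(2)[OF that, of x] n(2) by (meson not_le)
          \<comment> \<open>Say \<open>x\<close> is in \<open>E\<close> and \<open>y\<close> is not.
            If \<open>x\<close> is in \<open>K\<close>, then \<open>y\<close> is in \<open>U\<close>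
            and hence in \<open>W\<close>; otherwise \<open>x\<close> itself is in
            \<open>W\<close>.\<close>
          ultimately have "x \<in> W \<or> y \<in> W"
            using False K(2) U(2) unfolding W_def by blast
          then show ?thesis using m'(1)[of "x - y"] False
            by (auto simp: indicator_def add_increasing add_increasing2)
        qed
      qed
      also have "\<dots> = indicator W x + (\<integral>\<^sup>+y. ennreal (\<rho> (x - y)) * indicator W y \<partial>lborel)"
        by (subst nn_integral_add) (auto simp: nn_integral_multc nn)
      finally show ?thesis .
    qed
    have "(\<integral>\<^sup>+x. ennreal \<bar>(\<integral>y. \<rho> (x - y) * indicator E y \<partial>lborel) - indicator E x\<bar> \<partial>lborel)
        \<le> (\<integral>\<^sup>+x. indicator W x + (\<integral>\<^sup>+y. ennreal (\<rho> (x - y)) * indicator W y \<partial>lborel) \<partial>lborel)"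
      by (rule nn_integral_mono) (rule pt)
    also have "\<dots> = emeasure lborel W + (\<integral>\<^sup>+x. \<integral>\<^sup>+y. ennreal (\<rho> (x - y)) * indicator W y \<partial>lborel \<partial>lborel)"
      by (subst nn_integral_add) auto
    also have "(\<integral>\<^sup>+x. \<integral>\<^sup>+y. ennreal (\<rho> (x - y)) * indicator W y \<partial>lborel \<partial>lborel)
        = (\<integral>\<^sup>+y. \<integral>\<^sup>+x. ennreal (\<rho> (x - y)) * indicator W y \<partial>lborel \<partial>lborel)"
      by (subst lborel_pair.Fubini') auto
    also have "\<dots> = emeasure lborel W" by (simp add: nn_integral_multc nn')
    also have "emeasure lborel W + emeasure lborel W \<le> ennreal (\<delta> / 2) + ennreal (\<delta> / 2)"
      using W by (intro add_mono)
    also have "\<dots> = ennreal \<delta>" using assms(3) by (subst ennreal_plus[symmetric]) auto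
    finally show ?thesis
      using assms(3) by (subst integral_eq_nn_integral) (auto intro!: enn2real_leI borel_measurable_diff)
  qed
  then show ?thesis using d(1) by (intro exI[of _ "d / 2"]) auto
qed

section \<open>Submodularity of the perimeter\<close>

lemma C1_grad_add: "C1_grad f g \<Longrightarrow> C1_grad f' g' \<Longrightarrow> C1_grad (\<lambda>x. f x + f' x) (\<lambda>x. g x + g' x)"
  unfolding C1_grad_def inner_add_left by (auto intro!: has_derivative_add continuous_intros)

lemma C1_grad_diff: "C1_grad f g \<Longrightarrow> C1_grad f' g' \<Longrightarrow> C1_grad (\<lambda>x. f x - f' x) (\<lambda>x. g x - g' x)"
  unfolding C1_grad_def inner_diff_left by (auto intro!: has_derivative_diff continuous_intros)

lemma C1_grad_continuous:
  assumes "C1_grad f g"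
  shows "continuous_on UNIV f" "continuous_on UNIV g"
proof -
  have "isCont f x" for x
    using assms has_derivative_continuous[of f "\<lambda>v. g x \<bullet> v" x UNIV] unfolding C1_grad_def by auto
  then show "continuous_on UNIV f" by (simp add: continuous_at_imp_continuous_on)
qed (use assms in \<open>auto simp: C1_grad_def\<close>)

lemma C1_grad_measurable:
  assumes "C1_grad f g"
  shows "f \<in> borel_measurable borel" "g \<in> borel_measurable borel"
  using C1_grad_continuous[OF assms] by (auto intro: borel_measurable_continuous_onI)

lemma C1_grad_compose:
  assumes f: "C1_grad f g" and \<theta>: "\<And>s. (\<theta> has_real_derivative \<theta>' s) (at s)" and c: "continuous_on UNIV \<theta>'"
  shows "C1_grad (\<lambda>x. \<theta> (f x)) (\<lambda>x. \<theta>' (f x) *\<^sub>R g x)"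
  unfolding C1_grad_def
proof (intro conjI allI)
  show "((\<lambda>x. \<theta> (f x)) has_derivative (\<lambda>v. (\<theta>' (f x) *\<^sub>R g x) \<bullet> v)) (at x)" for x
  proof -
    have "(f has_derivative (\<lambda>v. g x \<bullet> v)) (at x)" using f unfolding C1_grad_def by blast
    from has_derivative_compose[OF this \<theta>[unfolded has_field_derivative_def]]
    show ?thesis by simp
  qed
  show "continuous_on UNIV (\<lambda>x. \<theta>' (f x) *\<^sub>R g x)"
    using C1_grad_continuous[OF f] continuous_on_compose2[OF c, of UNIV f] by (intro continuous_intros) auto
qed

lemma smooth_approximation:
  fixes E :: "'a::euclidean_space set"
  assumes E: "E \<in> sets borel" "bounded E" and P: "perimeter E \<le> ennreal c" "0 \<le> c" and "\<delta> > 0"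
  obtains u g where "C1_grad u g" "\<And>x. 0 \<le> u x" "\<And>x. u x \<le> 1" "\<exists>R. \<forall>x. norm x > R \<longrightarrow> u x = 0"
    "integrable lborel (\<lambda>x. norm (g x))" "(\<integral>x. norm (g x) \<partial>lborel) \<le> c"
    "integrable lborel (\<lambda>x. \<bar>u x - indicator E x\<bar>)" "(\<integral>x. \<bar>u x - indicator E x\<bar> \<partial>lborel) \<le> \<delta>"
proof -
  obtain e where e: "e > 0" "\<And>\<rho> D. mollifier e \<rho> D \<Longrightarrow>
    (\<integral>x. \<bar>(\<integral>y. \<rho> (x - y) * indicator E y \<partial>lborel) - indicator E x\<bar> \<partial>lborel) \<le> \<delta>"
    using mollified_indicator_L1[OF E \<open>\<delta> > 0\<close>] by blast
  obtain \<rho> :: "'a \<Rightarrow> real" and D where m: "mollifier e \<rho> D" using mollifier_exists[OF e(1)] by blast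
  note u = mollified_indicator[OF m E P]
  obtain R where R: "\<And>x. norm x > R \<Longrightarrow> (\<integral>y. \<rho> (x - y) * indicator E y \<partial>lborel) = 0" using u(4) by blast
  from continuous_bounded_support(1)[OF C1_grad_continuous(1)[OF u(1)] R]
  have "integrable lborel (\<lambda>x. \<integral>y. \<rho> (x - y) * indicator E y \<partial>lborel)" .
  moreover have "integrable lborel (indicator E :: 'a \<Rightarrow> real)"
    using emeasure_bounded_finite[OF E(2)] E(1) by (intro integrable_real_indicator) auto
  ultimately have "integrable lborel (\<lambda>x. \<bar>(\<integral>y. \<rho> (x - y) * indicator E y \<partial>lborel) - indicator E x\<bar>)"
    by (intro integrable_abs Bochner_Integration.integrable_diff)
  from that[OF u this e(2)[OF m]] show thesis .
qed

lemma smooth_positive_part: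
  assumes "\<delta> > (0::real)"
  obtains \<theta> \<theta>' where "\<And>s. (\<theta> has_real_derivative \<theta>' s) (at s)" "continuous_on UNIV \<theta>'"
    "\<And>s. 0 \<le> \<theta>' s" "\<And>s. \<theta>' s \<le> 1" "\<And>s. \<bar>\<theta> s - max 0 s\<bar> \<le> \<delta>"
proof -
  \<comment> \<open>From \<open>max 0 s = (s + \<bar>s\<bar>) / 2\<close>, with the modulus replaced
    by this smooth function, which exceeds it by at most \<delta>.\<close>
  define q where "q = (\<lambda>s::real. sqrt (s\<^sup>2 + \<delta>\<^sup>2))"
  have p: "s\<^sup>2 + \<delta>\<^sup>2 > 0" for s using assms by (simp add: add_nonneg_pos)
  have q0: "q s > 0" for s using p by (simp add: q_def)
  have qs: "\<bar>s\<bar> \<le> q s" for s unfolding q_def by (intro real_le_rsqrt) simp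
  have qd: "q s \<le> \<bar>s\<bar> + \<delta>" for s
    unfolding q_def using assms by (intro real_le_lsqrt) (auto simp: power2_sum)
  show ?thesis
  proof (rule that[of "\<lambda>s. (s + q s) / 2" "\<lambda>s. (1 + s / q s) / 2"])
    show "((\<lambda>s. (s + q s) / 2) has_real_derivative (1 + s / q s) / 2) (at s)" for s
      unfolding q_def using p[of s]
      by (auto intro!: derivative_eq_intros simp: field_simps)
    show "continuous_on UNIV (\<lambda>s. (1 + s / q s) / 2)"
      using p q0 unfolding q_def by (intro continuous_intros) (auto simp: less_imp_neq[symmetric])
    have r: "\<bar>s / q s\<bar> \<le> 1" for s using qs[of s] q0[of s] by (simp add: abs_divide)
    have h: "0 \<le> (1 + t) / 2 \<and> (1 + t) / 2 \<le> 1" if "\<bar>t\<bar> \<le> 1" for t :: real using that by auto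
    show "0 \<le> (1 + s / q s) / 2" "(1 + s / q s) / 2 \<le> 1" for s using h[OF r[of s]] by blast+
    show "\<bar>(s + q s) / 2 - max 0 s\<bar> \<le> \<delta>" for s using qs[of s] qd[of s] assms by (auto simp: max_def)
  qed
qed

text \<open>The error has two parts: the integrable \<open>h\<close> is paired with the supremum of
  the divergence, and the constant \<delta>, which is not integrable over the whole space, with the
  L1 norm of the divergence.\<close>

lemma integral_mult_error:
  fixes f :: "'a::euclidean_space \<Rightarrow> real"
  assumes \<phi>: "test_field \<phi>" and M: "\<And>x. \<bar>divergence \<phi> x\<bar> \<le> M"
    and h: "integrable lborel h" "\<And>x. 0 \<le> h x" "\<And>x. \<bar>f x - indicator S x\<bar> \<le> h x + \<delta>"
    and f: "f \<in> borel_measurable borel" "S \<in> sets borel"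
    and "0 \<le> \<delta>"
  shows "flux S \<phi> \<le>
    (\<integral>x. f x * divergence \<phi> x \<partial>lborel) + M * (\<integral>x. h x \<partial>lborel) + \<delta> * (\<integral>x. \<bar>divergence \<phi> x\<bar> \<partial>lborel)"
proof -
  note d = test_field_divergence_bounds(1)[OF \<phi>]
  note [measurable] = f borel_measurable_integrable[OF d]
  note iS = integrable_indicator_divergence[OF \<phi> f(2)]
  have M0: "M \<ge> 0" using M[of undefined] by linarith
  have ih: "integrable lborel (\<lambda>x. M * h x + \<delta> * \<bar>divergence \<phi> x\<bar>)" using h(1) d by auto
  have pt: "\<bar>(f x - indicator S x) * divergence \<phi> x\<bar> \<le> M * h x + \<delta> * \<bar>divergence \<phi> x\<bar>" for x
  proof -
    have "\<bar>(f x - indicator S x) * divergence \<phi> x\<bar> \<le> (h x + \<delta>) * \<bar>divergence \<phi> x\<bar>"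
      unfolding abs_mult using h(3) \<open>0 \<le> \<delta>\<close> by (intro mult_right_mono) auto
    also have "\<dots> = h x * \<bar>divergence \<phi> x\<bar> + \<delta> * \<bar>divergence \<phi> x\<bar>" by (simp add: distrib_right)
    also have "\<dots> \<le> h x * M + \<delta> * \<bar>divergence \<phi> x\<bar>" using M h(2) \<open>0 \<le> \<delta>\<close> by (intro add_mono mult_left_mono) auto
    finally show ?thesis by (simp add: mult.commute)
  qed
  have idf: "integrable lborel (\<lambda>x. (f x - indicator S x) * divergence \<phi> x)"
    by (rule Bochner_Integration.integrable_bound[OF ih]) (use pt in \<open>auto intro!: AE_I2 order_trans[OF _ abs_ge_self]\<close>)
  have "(\<integral>x. - ((f x - indicator S x) * divergence \<phi> x) \<partial>lborel) \<le> (\<integral>x. M * h x + \<delta> * \<bar>divergence \<phi> x\<bar> \<partial>lborel)"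
    by (rule integral_mono[OF _ ih]) (use idf pt in \<open>auto simp: abs_le_iff\<close>)
  moreover have "(\<integral>x. f x * divergence \<phi> x \<partial>lborel)
     = (\<integral>x. (f x - indicator S x) * divergence \<phi> x \<partial>lborel) + flux S \<phi>"
    by (subst Bochner_Integration.integral_add[OF idf iS, symmetric]) (simp add: algebra_simps)
  ultimately show ?thesis using h(1) d by simp
qed

text \<open>The pair \<open>u - \<theta> (u - v)\<close>, \<open>v + \<theta> (u - v)\<close>, with \<open>\<theta>\<close> a smooth positive part, replaces
  minimum and maximum: their gradients are complementary convex combinations of those of
  \<open>u\<close> and \<open>v\<close>.\<close>

lemma perimeter_submodular:
  fixes A B :: "'a::euclidean_space set"
  assumes A: "A \<in> sets borel" "bounded A" "perimeter A \<le> ennreal a" "0 \<le> a"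
    and B: "B \<in> sets borel" "bounded B" "perimeter B \<le> ennreal b" "0 \<le> b"
    and \<phi>: "test_field \<phi>" and \<psi>: "test_field \<psi>"
  shows "flux (A \<inter> B) \<phi>
    + flux (A \<union> B) \<psi> \<le> a + b"
proof -
  obtain M1 where M1: "M1 > 0" "\<And>x. \<bar>divergence \<phi> x\<bar> \<le> M1" using test_field_divergence_bounds(2)[OF \<phi>] by blast
  obtain M2 where M2: "M2 > 0" "\<And>x. \<bar>divergence \<psi> x\<bar> \<le> M2" using test_field_divergence_bounds(2)[OF \<psi>] by blast
  \<comment> \<open>The error function \<open>h\<close> integrates to at most
    \<open>2 * \<delta>\<close> and is weighted by \<open>M1\<close> and \<open>M2\<close>; the L1
    norms weigh the uniform error \<delta> of the smooth positive part.\<close>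
  define C where "C = 2 * M1 + 2 * M2 + (\<integral>x. \<bar>divergence \<phi> x\<bar> \<partial>lborel) + (\<integral>x. \<bar>divergence \<psi> x\<bar> \<partial>lborel)"
  have "C > 0" unfolding C_def using M1(1) M2(1) by (intro add_pos_nonneg) auto
  let ?I = "flux (A \<inter> B) \<phi>
    + flux (A \<union> B) \<psi>"
  have main: "?I \<le> a + b + C * \<delta>" if "\<delta> > 0" for \<delta>
  proof -
    obtain u gu where "C1_grad u gu" "\<And>x. 0 \<le> u x" "\<And>x. u x \<le> 1" "\<exists>R. \<forall>x. norm x > R \<longrightarrow> u x = 0"
      and u: "integrable lborel (\<lambda>x. norm (gu x))" "(\<integral>x. norm (gu x) \<partial>lborel) \<le> a"
      "integrable lborel (\<lambda>x. \<bar>u x - indicator A x\<bar>)" "(\<integral>x. \<bar>u x - indicator A x\<bar> \<partial>lborel) \<le> \<delta>"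
      by (rule smooth_approximation[OF A \<open>\<delta> > 0\<close>]) blast
    note u = \<open>C1_grad u gu\<close> u
    obtain v gv where "C1_grad v gv" "\<And>x. 0 \<le> v x" "\<And>x. v x \<le> 1" "\<exists>R. \<forall>x. norm x > R \<longrightarrow> v x = 0"
      and v: "integrable lborel (\<lambda>x. norm (gv x))" "(\<integral>x. norm (gv x) \<partial>lborel) \<le> b"
      "integrable lborel (\<lambda>x. \<bar>v x - indicator B x\<bar>)" "(\<integral>x. \<bar>v x - indicator B x\<bar> \<partial>lborel) \<le> \<delta>"
      by (rule smooth_approximation[OF B \<open>\<delta> > 0\<close>]) blast
    note v = \<open>C1_grad v gv\<close> v
    obtain \<theta> \<theta>' where \<theta>: "\<And>s. (\<theta> has_real_derivative \<theta>' s) (at s)" "continuous_on UNIV \<theta>'"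
      "\<And>s. 0 \<le> \<theta>' s" "\<And>s. \<theta>' s \<le> 1" "\<And>s. \<bar>\<theta> s - max 0 s\<bar> \<le> \<delta>"
      by (rule smooth_positive_part[OF \<open>\<delta> > 0\<close>]) blast
    define w where "w = (\<lambda>x. \<theta> (u x - v x))"
    define t where "t = (\<lambda>x. \<theta>' (u x - v x))"
    have t: "0 \<le> t x" "t x \<le> 1" for x using \<theta>(3,4) by (auto simp: t_def)
    have w: "C1_grad w (\<lambda>x. t x *\<^sub>R (gu x - gv x))"
      unfolding w_def t_def by (rule C1_grad_compose[OF C1_grad_diff[OF u(1) v(1)] \<theta>(1,2)])
    define g1 where "g1 = (\<lambda>x. gu x - t x *\<^sub>R (gu x - gv x))"
    define g2 where "g2 = (\<lambda>x. gv x + t x *\<^sub>R (gu x - gv x))"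
    have f1: "C1_grad (\<lambda>x. u x - w x) g1" and f2: "C1_grad (\<lambda>x. v x + w x) g2"
      unfolding g1_def g2_def by (intro C1_grad_diff[OF u(1) w] C1_grad_add[OF v(1) w])+
    note [measurable] = C1_grad_measurable[OF f1] C1_grad_measurable[OF f2]
      C1_grad_measurable[OF u(1)] C1_grad_measurable[OF v(1)]
    have n1: "norm (g1 x) \<le> (1 - t x) * norm (gu x) + t x * norm (gv x)" for x
    proof -
      have "g1 x = (1 - t x) *\<^sub>R gu x + t x *\<^sub>R gv x" by (simp add: g1_def algebra_simps)
      then show ?thesis using t[of x] norm_triangle_ineq[of "(1 - t x) *\<^sub>R gu x" "t x *\<^sub>R gv x"] by simp
    qed
    have n2: "norm (g2 x) \<le> (1 - t x) * norm (gv x) + t x * norm (gu x)" for x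
    proof -
      have "g2 x = (1 - t x) *\<^sub>R gv x + t x *\<^sub>R gu x" by (simp add: g2_def algebra_simps)
      then show ?thesis using t[of x] norm_triangle_ineq[of "(1 - t x) *\<^sub>R gv x" "t x *\<^sub>R gu x"] by simp
    qed
    have n12: "norm (g1 x) + norm (g2 x) \<le> norm (gu x) + norm (gv x)" for x
      using n1[of x] n2[of x] by (simp add: algebra_simps)
    have i: "integrable lborel (\<lambda>x. norm (gu x) + norm (gv x))" using u(2) v(2) by auto
    have i1: "integrable lborel (\<lambda>x. norm (g1 x))" and i2: "integrable lborel (\<lambda>x. norm (g2 x))"
      by (rule Bochner_Integration.integrable_bound[OF i];
          use n12 in \<open>auto intro!: AE_I2 order_trans[OF _ n12]\<close>)+
    have "(\<integral>x. (u x - w x) * divergence \<phi> x \<partial>lborel) + (\<integral>x. (v x + w x) * divergence \<psi> x \<partial>lborel)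
       \<le> (\<integral>x. norm (g1 x) \<partial>lborel) + (\<integral>x. norm (g2 x) \<partial>lborel)"
      by (intro add_mono integral_divergence_le_gradient[OF f1 \<phi> i1] integral_divergence_le_gradient[OF f2 \<psi> i2])
    also have "\<dots> = (\<integral>x. norm (g1 x) + norm (g2 x) \<partial>lborel)" using i1 i2 by simp
    also have "\<dots> \<le> (\<integral>x. norm (gu x) + norm (gv x) \<partial>lborel)"
      by (rule integral_mono) (use i1 i2 i n12 in auto)
    also have "\<dots> \<le> a + b" using u(2,3) v(2,3) by simp
    finally have le: "(\<integral>x. (u x - w x) * divergence \<phi> x \<partial>lborel) + (\<integral>x. (v x + w x) * divergence \<psi> x \<partial>lborel) \<le> a + b" .
    define h where "h = (\<lambda>x. \<bar>u x - indicator A x\<bar> + \<bar>v x - indicator B x\<bar>)"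
    have ih: "integrable lborel h" unfolding h_def using u(4) v(4) by auto
    have hint: "(\<integral>x. h x \<partial>lborel) \<le> 2 * \<delta>" unfolding h_def using u(4,5) v(4,5) by simp
    have h0: "\<And>x. 0 \<le> h x" by (simp add: h_def)
    \<comment> \<open>Up to \<delta>, \<open>u - w\<close> is the minimum and \<open>v + w\<close>
      the maximum of \<open>u\<close> and \<open>v\<close>. These deviate from the indicators of
      intersection and union by no more than the sum of the two individual errors.\<close>
    have e1: "\<bar>(u x - w x) - indicator (A \<inter> B) x\<bar> \<le> h x + \<delta>" for x
      using \<theta>(5)[of "u x - v x"] unfolding h_def w_def max_def
      by (cases "x \<in> A"; cases "x \<in> B") (auto split: if_splits)
    have e2: "\<bar>(v x + w x) - indicator (A \<union> B) x\<bar> \<le> h x + \<delta>" for x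
      using \<theta>(5)[of "u x - v x"] unfolding h_def w_def max_def
      by (cases "x \<in> A"; cases "x \<in> B") (auto split: if_splits)
    have "M1 * (\<integral>x. h x \<partial>lborel) \<le> M1 * (2 * \<delta>)" "M2 * (\<integral>x. h x \<partial>lborel) \<le> M2 * (2 * \<delta>)"
      using hint M1(1) M2(1) by (auto intro!: mult_left_mono)
    moreover note integral_mult_error[OF \<phi> M1(2) ih h0 e1 C1_grad_measurable(1)[OF f1] _ less_imp_le[OF \<open>\<delta> > 0\<close>]]
      integral_mult_error[OF \<psi> M2(2) ih h0 e2 C1_grad_measurable(1)[OF f2] _ less_imp_le[OF \<open>\<delta> > 0\<close>]]
    ultimately show ?thesis using le A(1) B(1) unfolding C_def by (simp add: algebra_simps)
  qed
  show ?thesis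
  proof (rule field_le_epsilon)
    fix e :: real assume "e > 0"
    then show "?I \<le> a + b + e" using main[of "e / C"] \<open>C > 0\<close> by simp
  qed
qed

section \<open>The coarea inequality\<close>

lemma test_field_zero: "test_field (\<lambda>x::'a::euclidean_space. 0)"
  unfolding test_field_def by (simp add: differentiable_on_def frechet_derivative_const)

lemma divergence_zero_field: "divergence (\<lambda>x::'a::euclidean_space. 0) = (\<lambda>x. 0)"
  unfolding divergence_def by (simp add: frechet_derivative_const)

text \<open>Submodularity with the zero field on the intersection.\<close>

lemma perimeter_Un_le:
  fixes A B :: "'a::euclidean_space set"
  assumes A: "A \<in> sets borel" "bounded A" "perimeter A \<le> ennreal a" "0 \<le> a"
    and B: "B \<in> sets borel" "bounded B" "perimeter B \<le> ennreal b" "0 \<le> b"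
  shows "perimeter (A \<union> B) \<le> ennreal (a + b)"
  using perimeter_submodular[OF A B test_field_zero] A B
  by (subst perimeter_le_iff_lborel) (auto simp: divergence_zero_field)

text \<open>The argument is shifted by \<open>sqrt n\<close>, so that \<open>\<psi>\<close> tends to one at the origin, too: level sets
  must be closed.\<close>

lemma coarea_kernel:
  obtains \<psi> k :: "nat \<Rightarrow> real \<Rightarrow> real" where
    "\<And>n s. (\<psi> n has_real_derivative k n s) (at s)" "\<And>n. continuous_on UNIV (k n)"
    "\<And>n s. 0 \<le> k n s" "\<And>n s. k n s \<le> real n" "\<And>n s. 0 \<le> \<psi> n s" "\<And>n s. \<psi> n s \<le> 1"
    "\<And>s. 0 \<le> s \<Longrightarrow> (\<lambda>n. \<psi> n s) \<longlonglongrightarrow> 1" "\<And>s. s < 0 \<Longrightarrow> (\<lambda>n. \<psi> n s) \<longlonglongrightarrow> 0"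
proof -
  define w where "w = (\<lambda>n s. real n * s + sqrt (real n))"
  define \<psi> where "\<psi> = (\<lambda>n s. 1 / 2 + arctan (w n s) / pi)"
  define k where "k = (\<lambda>n s. real n / (1 + (w n s)\<^sup>2) / pi)"
  have p: "1 + (w n s)\<^sup>2 > 0" for n s by (simp add: add_pos_nonneg)
  show ?thesis
  proof (rule that[of \<psi> k])
    show "(\<psi> n has_real_derivative k n s) (at s)" for n s
    proof -
      have "(w n has_real_derivative real n) (at s)"
        unfolding w_def by (auto intro!: derivative_eq_intros)
      note d = DERIV_add[OF DERIV_const DERIV_cdivide[OF DERIV_chain2[OF DERIV_arctan this]]]
      have eq: "0 + inverse (1 + (w n s)\<^sup>2) * real n / pi = k n s"
        unfolding k_def by (simp only: add_0_left divide_inverse mult.commute[of "real n"])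
      show ?thesis unfolding \<psi>_def by (rule DERIV_cong[OF d eq])
    qed
    show "continuous_on UNIV (k n)" for n
      unfolding k_def by (intro continuous_intros) (use p in \<open>auto simp: w_def intro!: continuous_intros less_imp_neq[symmetric]\<close>)
    show "0 \<le> k n s" for n s unfolding k_def using p by (intro divide_nonneg_nonneg) (auto simp: less_imp_le)
    show "k n s \<le> real n" for n s
    proof -
      have "1 * 1 \<le> (1 + (w n s)\<^sup>2) * pi" using pi_gt3 by (intro mult_mono) auto
      then have "real n / ((1 + (w n s)\<^sup>2) * pi) \<le> real n / 1" by (intro divide_left_mono) auto
      then show ?thesis by (simp add: k_def)
    qed
    have b: "- (pi / 2) \<le> arctan t" "arctan t \<le> pi / 2" for t
      using arctan_lbound[of t] arctan_ubound[of t] by auto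
    have c: "- (1 / 2) \<le> arctan t / pi" "arctan t / pi \<le> 1 / 2" for t
      using b[of t] pi_gt_zero by (auto simp: field_simps)
    show "0 \<le> \<psi> n s" for n s using c(1)[of "w n s"] unfolding \<psi>_def by linarith
    show "\<psi> n s \<le> 1" for n s using c(2)[of "w n s"] unfolding \<psi>_def by linarith
    show "(\<lambda>n. \<psi> n s) \<longlonglongrightarrow> 1" if "0 \<le> s" for s
    proof -
      have "filterlim (\<lambda>n. w n s) at_top sequentially"
      proof (rule filterlim_at_top_mono)
        show "filterlim (\<lambda>n. sqrt (real n)) at_top sequentially"
          by (intro filterlim_compose[OF sqrt_at_top] filterlim_real_sequentially)
      qed (use that in \<open>auto simp: w_def\<close>)
      from filterlim_compose[OF tendsto_arctan_at_top this]
      have "(\<lambda>n. \<psi> n s) \<longlonglongrightarrow> 1 / 2 + (pi / 2) / pi" unfolding \<psi>_def by (intro tendsto_intros) auto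
      then show ?thesis by simp
    qed
    show "(\<lambda>n. \<psi> n s) \<longlonglongrightarrow> 0" if "s < 0" for s
    proof -
      have 1: "filterlim (\<lambda>n. sqrt (real n)) at_top sequentially"
        by (intro filterlim_compose[OF sqrt_at_top] filterlim_real_sequentially)
      have 2: "filterlim (\<lambda>n. - 1 + (- s) * sqrt (real n)) at_top sequentially"
        using that by (intro filterlim_tendsto_add_at_top[OF tendsto_const]
            filterlim_tendsto_pos_mult_at_top[OF tendsto_const _ 1]) auto
      have "- w n s = sqrt (real n) * (- 1 + (- s) * sqrt (real n))" for n
      proof -
        have "sqrt (real n) * sqrt (real n) = real n" by simp
        then show ?thesis unfolding w_def by (simp only: distrib_left) (simp add: algebra_simps)
      qed
      then have "filterlim (\<lambda>n. - w n s) at_top sequentially"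
        using filterlim_at_top_mult_at_top[OF 1 2] by simp
      then have "filterlim (\<lambda>n. w n s) at_bot sequentially" by (simp add: filterlim_uminus_at_bot)
      from filterlim_compose[OF tendsto_arctan_at_bot this]
      have "(\<lambda>n. \<psi> n s) \<longlonglongrightarrow> 1 / 2 + (- (pi / 2)) / pi" unfolding \<psi>_def by (intro tendsto_intros) auto
      then show ?thesis by simp
    qed
  qed
qed

text \<open>The perimeters of the level sets, averaged over the levels, are controlled by the
  integral of \<open>norm (g x)\<close>, which is at most \<open>c\<close>; hence a level with
  perimeter at most \<open>c'\<close> exists. Levels stay away from 0 and 1 so that level sets are
  compact and close to \<open>E\<close>.\<close>

lemma coarea_level_set:
  fixes E :: "'a::euclidean_space set"
  assumes E: "E \<in> sets borel" "bounded E" and P: "perimeter E \<le> ennreal c" "0 \<le> c"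
    and "c < c'" "0 < \<eta>"
  obtains A where "compact A" "perimeter A \<le> ennreal c'"
    "vol ((A - E) \<union> (E - A)) \<le> \<eta>"
proof -
  \<comment> \<open>Makes \<open>c' * (1 - 2 * a)\<close> the midpoint of \<open>c\<close> and
    \<open>c'\<close>, hence larger than \<open>c\<close>: the shortened interval of levels still
    has enough length.\<close>
  define a where "a = (1 - c / c') / 4"
  have "c' > 0" using assms by linarith
  have "c / c' < 1" "0 \<le> c / c'" using assms \<open>c' > 0\<close> by (auto simp: field_simps)
  moreover have "0 < (1 - r) / 4 \<and> (1 - r) / 4 \<le> 1 / 4" if "r < 1" "0 \<le> r" for r :: real
    using that by auto
  ultimately have a: "0 < a" "a \<le> 1 / 4" unfolding a_def by blast+
  have ca: "c < c' * (1 - 2 * a)"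
  proof -
    have "c' * (1 - 2 * a) = (c' + c) / 2" using \<open>c' > 0\<close> by (simp add: a_def field_simps)
    then show ?thesis using assms by simp
  qed
  obtain u g where u: "C1_grad u g" "\<And>x. 0 \<le> u x" "\<And>x. u x \<le> 1" "\<exists>R. \<forall>x. norm x > R \<longrightarrow> u x = 0"
    "integrable lborel (\<lambda>x. norm (g x))" "(\<integral>x. norm (g x) \<partial>lborel) \<le> c"
    "integrable lborel (\<lambda>x. \<bar>u x - indicator E x\<bar>)" "(\<integral>x. \<bar>u x - indicator E x\<bar> \<partial>lborel) \<le> a * \<eta>"
    by (rule smooth_approximation[OF E P mult_pos_pos[OF a(1) \<open>0 < \<eta>\<close>]]) blast
  note [measurable] = C1_grad_measurable[OF u(1)] E(1)
  define A where "A = (\<lambda>t. {x. t \<le> u x})"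
  have compA: "compact (A t)" if "t > 0" for t
  proof -
    obtain R where "\<And>x. norm x > R \<Longrightarrow> u x = 0" using u(4) by blast
    then have "A t \<subseteq> cball 0 R" using that unfolding A_def by (force simp: not_less[symmetric])
    moreover have "closed (A t)" unfolding A_def
      using C1_grad_continuous(1)[OF u(1)] by (intro closed_Collect_le) auto
    ultimately show ?thesis using bounded_subset[OF bounded_cball] compact_eq_bounded_closed by blast
  qed
  \<comment> \<open>Chebyshev: a level in \<open>{a..1 - a}\<close> forces \<open>u\<close> to
    differ from the indicator of \<open>E\<close> by at least \<open>a\<close> on the symmetric
    difference.\<close>
  have symdiff: "vol ((A t - E) \<union> (E - A t)) \<le> \<eta>" if "t \<in> {a..1 - a}" for t
  proof -
    let ?S = "(A t - E) \<union> (E - A t)"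
    have [measurable]: "A t \<in> sets borel" using compA[of t] that a(1) borel_compact by auto
    have "bounded ?S"
      by (rule bounded_subset[of "A t \<union> E"]) (use compA[of t] that a(1) E(2) compact_imp_bounded in auto)
    then have iS: "integrable lborel (indicator ?S :: 'a \<Rightarrow> real)"
      using emeasure_bounded_finite[of ?S] by (intro integrable_real_indicator) auto
    have "a * vol ?S = (\<integral>x. a * indicator ?S x \<partial>lborel)" by simp
    also have "\<dots> \<le> (\<integral>x. \<bar>u x - indicator E x\<bar> \<partial>lborel)"
    proof (rule integral_mono[OF integrable_mult_right[OF iS] u(7)])
      fix x show "a * indicator ?S x \<le> \<bar>u x - indicator E x\<bar>"
        using that by (auto simp: indicator_def A_def)
    qed
    also have "\<dots> \<le> a * \<eta>" by (rule u(8))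
    finally show ?thesis using a(1) by simp
  qed
  obtain \<psi> k :: "nat \<Rightarrow> real \<Rightarrow> real" where k:
    "\<And>n s. (\<psi> n has_real_derivative k n s) (at s)" "\<And>n. continuous_on UNIV (k n)"
    "\<And>n s. 0 \<le> k n s" "\<And>n s. k n s \<le> real n" and \<psi>: "\<And>n s. 0 \<le> \<psi> n s" "\<And>n s. \<psi> n s \<le> 1"
    "\<And>s. 0 \<le> s \<Longrightarrow> (\<lambda>n. \<psi> n s) \<longlonglongrightarrow> 1" "\<And>s. s < 0 \<Longrightarrow> (\<lambda>n. \<psi> n s) \<longlonglongrightarrow> 0"
    by (rule coarea_kernel) blast
  have [measurable]: "k n \<in> borel_measurable borel" for n
    using k(2) by (rule borel_measurable_continuous_onI)
  \<comment> \<open>The integral of the gradient norm of a smoothed indicator of the superlevel set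
    at \<open>t\<close>. Its liminf \<open>L\<close> bounds the flux of every test field
    simultaneously and is measurable in \<open>t\<close>, so it can be integrated in place of the
    perimeter.\<close>
  define G where "G = (\<lambda>n t. \<integral>\<^sup>+x. ennreal (k n (u x - t)) * ennreal (norm (g x)) \<partial>lborel)"
  define L where "L = (\<lambda>t. liminf (\<lambda>n. G n t))"
  have [measurable]: "G n \<in> borel_measurable borel" for n unfolding G_def by measurable
  have level: "ennreal (flux (A t) \<phi>) \<le> L t" if \<phi>: "test_field \<phi>" for \<phi> t
  proof -
    note d = test_field_divergence_bounds(1)[OF \<phi>]
    note [measurable] = borel_measurable_integrable[OF d]
    let ?J = "\<lambda>n. \<integral>x. \<psi> n (u x - t) * divergence \<phi> x \<partial>lborel"
    have C: "C1_grad (\<lambda>x. \<psi> n (u x - t)) (\<lambda>x. k n (u x - t) *\<^sub>R g x)" for n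
    proof (rule C1_grad_compose[of "\<lambda>x. u x - t" g, OF _ k(1,2)])
      show "C1_grad (\<lambda>x. u x - t) g"
        using C1_grad_diff[OF u(1), of "\<lambda>x. t" "\<lambda>x. 0"] by (simp add: C1_grad_def)
    qed
    note [measurable] = C1_grad_measurable(1)[OF C]
    have le: "ennreal (?J n) \<le> G n t" for n
    proof -
      have i: "integrable lborel (\<lambda>x. norm (k n (u x - t) *\<^sub>R g x))"
        by (rule Bochner_Integration.integrable_bound[OF integrable_mult_right[OF u(5), of "real n"]])
          (use k(3,4) in \<open>auto intro!: AE_I2 mult_right_mono\<close>)
      have "ennreal (?J n) \<le> ennreal (\<integral>x. norm (k n (u x - t) *\<^sub>R g x) \<partial>lborel)"
        by (intro ennreal_leI integral_divergence_le_gradient[OF C \<phi> i])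
      also have "\<dots> = (\<integral>\<^sup>+x. ennreal (norm (k n (u x - t) *\<^sub>R g x)) \<partial>lborel)"
        by (rule nn_integral_eq_integral[OF i, symmetric]) auto
      also have "\<dots> = G n t" unfolding G_def using k(3) by (simp add: ennreal_mult)
      finally show ?thesis .
    qed
    have "?J \<longlonglongrightarrow> flux (A t) \<phi>"
    proof (rule integral_dominated_convergence[where w = "\<lambda>x. \<bar>divergence \<phi> x\<bar>"])
      have "(\<lambda>n. \<psi> n (u x - t)) \<longlonglongrightarrow> indicator (A t) x" for x
        using \<psi>(3,4)[of "u x - t"] by (cases "t \<le> u x") (auto simp: A_def)
      then show "AE x in lborel. (\<lambda>n. \<psi> n (u x - t) * divergence \<phi> x) \<longlonglongrightarrow> indicator (A t) x * divergence \<phi> x"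
        by (intro AE_I2 tendsto_intros)
      show "AE x in lborel. norm (\<psi> n (u x - t) * divergence \<phi> x) \<le> \<bar>divergence \<phi> x\<bar>" for n
        using \<psi>(1,2) by (intro AE_I2) (auto simp: abs_mult mult_left_le_one_le)
      show "(\<lambda>x. indicator (A t) x * divergence \<phi> x) \<in> borel_measurable lborel"
        unfolding A_def by measurable
    qed (use d in auto)
    then have "(\<lambda>n. ennreal (?J n)) \<longlonglongrightarrow> ennreal (flux (A t) \<phi>)"
      by (rule tendsto_ennrealI)
    then have "ennreal (flux (A t) \<phi>) = liminf (\<lambda>n. ennreal (?J n))"
      by (rule lim_imp_Liminf[OF sequentially_bot, symmetric])
    also have "\<dots> \<le> L t" unfolding L_def by (intro Liminf_mono) (use le in auto)
    finally show ?thesis .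
  qed
  \<comment> \<open>After exchanging the integrals, the kernel integrates over \<open>t\<close> to
    an increment of \<psi>, which is at most 1.\<close>
  have slice: "(\<integral>\<^sup>+t. G n t * indicator {a..1 - a} t \<partial>lborel) \<le> ennreal c" for n
  proof -
    have "(\<integral>\<^sup>+t. G n t * indicator {a..1 - a} t \<partial>lborel)
      = (\<integral>\<^sup>+t. \<integral>\<^sup>+x. ennreal (k n (u x - t)) * ennreal (norm (g x)) * indicator {a..1 - a} t \<partial>lborel \<partial>lborel)"
      unfolding G_def by (intro nn_integral_cong nn_integral_multc[symmetric]) measurable
    also have "\<dots> = (\<integral>\<^sup>+x. \<integral>\<^sup>+t. ennreal (k n (u x - t)) * ennreal (norm (g x)) * indicator {a..1 - a} t \<partial>lborel \<partial>lborel)"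
      by (rule lborel_pair.Fubini') measurable
    also have "\<dots> \<le> (\<integral>\<^sup>+x. ennreal (norm (g x)) \<partial>lborel)"
    proof (rule nn_integral_mono)
      fix x
      have "(\<integral>\<^sup>+t. ennreal (k n (u x - t)) * ennreal (norm (g x)) * indicator {a..1 - a} t \<partial>lborel)
         = ennreal (norm (g x)) * (\<integral>\<^sup>+t. ennreal (k n (u x - t)) * indicator {a..1 - a} t \<partial>lborel)"
        by (subst nn_integral_cmult[symmetric]) (auto simp: ac_simps)
      also have "(\<integral>\<^sup>+t. ennreal (k n (u x - t)) * indicator {a..1 - a} t \<partial>lborel)
         = ennreal (- \<psi> n (u x - (1 - a)) - (- \<psi> n (u x - a)))"
      proof (rule nn_integral_FTC_Icc)
        show "((\<lambda>t. - \<psi> n (u x - t)) has_real_derivative k n (u x - t)) (at t)" for t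
        proof -
          have "((\<lambda>t. u x - t) has_real_derivative - 1) (at t)" by (auto intro!: derivative_eq_intros)
          from DERIV_minus[OF DERIV_chain2[OF k(1) this]] show ?thesis by simp
        qed
      qed (use k(3) a in auto)
      also have "\<dots> \<le> ennreal 1" using \<psi>(1)[of n "u x - (1 - a)"] \<psi>(2)[of n "u x - a"] by (intro ennreal_leI) linarith
      finally show "(\<integral>\<^sup>+t. ennreal (k n (u x - t)) * ennreal (norm (g x)) * indicator {a..1 - a} t \<partial>lborel)
        \<le> ennreal (norm (g x))" by (simp add: mult_left_mono)
    qed
    also have "\<dots> = ennreal (\<integral>x. norm (g x) \<partial>lborel)" by (rule nn_integral_eq_integral[OF u(5)]) auto
    also have "\<dots> \<le> ennreal c" by (intro ennreal_leI u(6))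
    finally show ?thesis .
  qed
  \<comment> \<open>If \<open>L\<close> exceeded \<open>c'\<close> on all levels, Fatou's lemma
    would give \<open>c' * (1 - 2 * a) \<le> c\<close>.\<close>
  have "\<exists>t\<in>{a..1 - a}. L t \<le> ennreal c'"
  proof (rule ccontr)
    assume "\<not> ?thesis"
    then have big: "ennreal c' \<le> L t" if "t \<in> {a..1 - a}" for t using that by (auto simp: not_le less_imp_le)
    have "ennreal (c' * (1 - 2 * a)) = ennreal c' * emeasure lborel {a..1 - a}"
      using a \<open>c' > 0\<close> by (simp add: ennreal_mult[symmetric] algebra_simps)
    also have "\<dots> = (\<integral>\<^sup>+t. ennreal c' * indicator {a..1 - a} t \<partial>lborel)"
      by (rule nn_integral_cmult_indicator[symmetric]) simp
    also have "\<dots> \<le> (\<integral>\<^sup>+t. liminf (\<lambda>n. G n t * indicator {a..1 - a} t) \<partial>lborel)"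
    proof (rule nn_integral_mono)
      fix t show "ennreal c' * indicator {a..1 - a} t \<le> liminf (\<lambda>n. G n t * indicator {a..1 - a} t)"
        using big[of t] by (cases "t \<in> {a..1 - a}") (auto simp: L_def)
    qed
    also have "\<dots> \<le> liminf (\<lambda>n. \<integral>\<^sup>+t. G n t * indicator {a..1 - a} t \<partial>lborel)"
      by (rule nn_integral_liminf) measurable
    also have "\<dots> \<le> liminf (\<lambda>n. ennreal c)" by (intro Liminf_mono) (use slice in auto)
    also have "\<dots> = ennreal c" by (simp add: Liminf_const)
    finally show False using ca P(2) by (simp add: ennreal_le_iff)
  qed
  then obtain t where t: "t \<in> {a..1 - a}" "L t \<le> ennreal c'" by blast
  have [measurable]: "A t \<in> sets borel" using compA[of t] t a(1) borel_compact by auto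
  have "perimeter (A t) \<le> ennreal c'"
    using level[of _ t] t(2) \<open>c' > 0\<close>
    by (subst perimeter_le_iff_lborel) (auto simp: ennreal_le_iff[symmetric] simp del: ennreal_le_iff intro: order_trans)
  with that[of "A t"] compA[of t] symdiff[OF t(1)] t(1) a(1) show thesis by auto
qed

section \<open>Lower semicontinuity and difference quotients\<close>

text \<open>A field that is optimal for \<open>B\<close> up to \<open>\<epsilon> / 2\<close> serves
  all nearby sets, because its divergence is bounded by some \<open>M\<close> and a change of volume
  \<delta> costs at most \<open>M * \<delta>\<close>. The field is part of the conclusion because
  submodularity has to be tested with it. For \<open>p < \<epsilon>\<close> the zero field is
  enough; otherwise \<open>p - \<epsilon> / 2\<close> is nonnegative and survives the passage to
  \<open>ennreal\<close>.\<close>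

lemma perimeter_lower_semicontinuous:
  fixes B :: "'a::euclidean_space set"
  assumes B: "B \<in> sets borel" "bounded B" and p: "perimeter B = ennreal p" "0 \<le> p" and "\<epsilon> > 0"
  obtains \<psi> \<delta> where "test_field \<psi>" "\<delta> > 0"
    "\<And>G. G \<in> sets borel \<Longrightarrow> bounded G \<Longrightarrow> vol ((G - B) \<union> (B - G)) \<le> \<delta> \<Longrightarrow>
      p - \<epsilon> \<le> flux G \<psi>"
proof (cases "p < \<epsilon>")
  case True
  with test_field_zero show ?thesis
    by (intro that[of "\<lambda>x. 0" 1]) (auto simp: divergence_zero_field)
next
  case False
  have "\<not> perimeter B \<le> ennreal (p - \<epsilon> / 2)" using p False \<open>\<epsilon> > 0\<close> by (simp add: ennreal_le_iff)
  moreover have "0 \<le> p - \<epsilon> / 2" using False \<open>\<epsilon> > 0\<close> by simp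
  ultimately obtain \<psi> where \<psi>: "test_field \<psi>" "p - \<epsilon> / 2 < flux B \<psi>"
    by (auto simp: perimeter_le_iff_lborel[OF _ B(1)] not_le)
  obtain M where M: "M > 0" "\<And>x. \<bar>divergence \<psi> x\<bar> \<le> M" using test_field_divergence_bounds(2)[OF \<psi>(1)] by blast
  have "p - \<epsilon> \<le> flux G \<psi>"
    if G: "G \<in> sets borel" "bounded G" "vol ((G - B) \<union> (B - G)) \<le> \<epsilon> / 2 / M" for G
  proof -
    let ?S = "(G - B) \<union> (B - G)"
    have "bounded ?S" by (rule bounded_subset[of "G \<union> B"]) (use G(2) B(2) in auto)
    then have iS: "integrable lborel (indicator ?S :: 'a \<Rightarrow> real)"
      using emeasure_bounded_finite[of ?S] G(1) B(1) by (intro integrable_real_indicator) auto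
    note i = integrable_indicator_divergence[OF \<psi>(1) B(1)] integrable_indicator_divergence[OF \<psi>(1) G(1)]
    have "flux B \<psi> - flux G \<psi>
       = (\<integral>x. indicator B x * divergence \<psi> x - indicator G x * divergence \<psi> x \<partial>lborel)"
      using i by simp
    also have "\<dots> \<le> (\<integral>x. M * indicator ?S x \<partial>lborel)"
    proof (rule integral_mono)
      show "indicator B x * divergence \<psi> x - indicator G x * divergence \<psi> x \<le> M * indicator ?S x" for x
        using M(2)[of x] by (auto simp: indicator_def abs_le_iff)
    qed (use i iS in auto)
    also have "\<dots> = M * vol ?S" by simp
    also have "\<dots> \<le> \<epsilon> / 2" using mult_left_mono[OF G(3), of M] M(1) by simp
    finally show ?thesis using \<psi>(2) by linarith
  qed
  with that[OF \<psi>(1), of "\<epsilon> / 2 / M"] M(1) \<open>\<epsilon> > 0\<close> show ?thesis by auto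
qed

text \<open>If \<open>A \<union> C\<close> is close to \<open>B\<close>, submodularity and lower semicontinuity at \<open>B\<close> make
  cutting \<open>A\<close> with \<open>C\<close> almost free.\<close>

lemma perimeter_Int_le:
  fixes B :: "'a::euclidean_space set"
  assumes B: "B \<in> sets borel" "bounded B" and p: "perimeter B = ennreal p" "0 \<le> p" and "\<epsilon> > 0"
  obtains \<delta> where "\<delta> > 0"
    "\<And>A C a. A \<in> sets borel \<Longrightarrow> bounded A \<Longrightarrow> perimeter A \<le> ennreal a \<Longrightarrow> 0 \<le> a \<Longrightarrow>
      C \<in> sets borel \<Longrightarrow> bounded C \<Longrightarrow> perimeter C \<le> ennreal (p + \<epsilon>) \<Longrightarrow>
      vol (((A \<union> C) - B) \<union> (B - (A \<union> C))) \<le> \<delta> \<Longrightarrow> perimeter (A \<inter> C) \<le> ennreal (a + 2 * \<epsilon>)"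
proof -
  obtain \<psi> \<delta> where \<psi>: "test_field \<psi>" "\<delta> > 0"
    "\<And>G. G \<in> sets borel \<Longrightarrow> bounded G \<Longrightarrow> vol ((G - B) \<union> (B - G)) \<le> \<delta> \<Longrightarrow>
      p - \<epsilon> \<le> flux G \<psi>"
    using perimeter_lower_semicontinuous[OF assms] by blast
  show thesis
  proof (rule that[OF \<psi>(2)])
    fix A C :: "'a set" and a
    assume A: "A \<in> sets borel" "bounded A" "perimeter A \<le> ennreal a" "0 \<le> a"
      and C: "C \<in> sets borel" "bounded C" "perimeter C \<le> ennreal (p + \<epsilon>)"
      and d: "vol (((A \<union> C) - B) \<union> (B - (A \<union> C))) \<le> \<delta>"
    have pe: "0 \<le> p + \<epsilon>" using p(2) \<open>\<epsilon> > 0\<close> by simp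
    have "flux (A \<inter> C) \<phi> \<le> a + 2 * \<epsilon>" if "test_field \<phi>" for \<phi>
      using perimeter_submodular[OF A C pe that \<psi>(1)] \<psi>(3)[OF _ _ d] A(1,2) C(1,2) by auto
    then show "perimeter (A \<inter> C) \<le> ennreal (a + 2 * \<epsilon>)"
      using A(1,4) C(1) \<open>\<epsilon> > 0\<close> by (subst perimeter_le_iff_lborel) auto
  qed
qed

text \<open>Replace each partial derivative of \<phi> by a difference quotient and move the shift
  from \<phi> to \<open>E\<close>. What remains is an integral of
  \<open>\<phi> x \<bullet> b\<close> over the symmetric difference of \<open>E\<close> and its
  translate, divided by \<open>h\<close>, and this is at most \<open>C\<close> because components of
  \<phi> are bounded by 1. The dimension counts the directions.\<close>

lemma perimeter_le_of_translates:
  fixes E :: "'a::euclidean_space set"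
  assumes E: "E \<in> sets borel" "bounded E" and "h\<^sub>0 > 0" "C \<ge> 0"
    and tr: "\<And>h b. 0 < h \<Longrightarrow> h < h\<^sub>0 \<Longrightarrow> b \<in> Basis \<Longrightarrow>
      vol (({x. x - h *\<^sub>R b \<in> E} - E) \<union> (E - {x. x - h *\<^sub>R b \<in> E})) \<le> C * h"
  shows "perimeter E \<le> ennreal (real DIM('a) * C)"
proof -
  have "flux E \<phi> \<le> real DIM('a) * C" if \<phi>: "test_field \<phi>" for \<phi>
  proof -
    note cd = test_field_continuous_derivative[OF \<phi>]
    obtain R where R: "\<And>x v. norm x > R \<Longrightarrow> frechet_derivative \<phi> (at x) v = 0"
      using test_field_support[OF \<phi>] by metis
    have [measurable]: "E \<in> sets borel" "\<phi> \<in> borel_measurable borel"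
      "(\<lambda>x. frechet_derivative \<phi> (at x) b) \<in> borel_measurable borel" for b
      using E(1) cd test_field_continuous[OF \<phi>] by (auto intro: borel_measurable_continuous_onI)
    have iE: "integrable lborel (indicator E :: 'a \<Rightarrow> real)"
      using emeasure_bounded_finite[OF E(2)] by (intro integrable_real_indicator) auto
    let ?D = "\<lambda>b x. frechet_derivative \<phi> (at x) b \<bullet> b"
    have cD: "continuous_on UNIV (?D b)" for b by (intro continuous_intros cd)
    have n1: "norm (\<phi> x) \<le> 1" for x using \<phi> unfolding test_field_def by blast
    have comp: "(\<integral>x. indicator E x * ?D b x \<partial>lborel) \<le> C" if b: "b \<in> Basis" for b
    proof -
      obtain M where M: "M \<ge> 0" "\<And>x. \<bar>?D b x\<bar> \<le> M"
        using continuous_bounded_support(2)[OF cD[of b], of R] R by auto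
      define t where "t = (\<lambda>n. min 1 (h\<^sub>0 / 2) * (1 / real (Suc n)))"
      have "t \<longlonglongrightarrow> min 1 (h\<^sub>0 / 2) * 0"
        unfolding t_def using LIMSEQ_Suc[OF lim_1_over_n] by (intro tendsto_intros)
      then have t0: "t \<longlonglongrightarrow> 0" by simp
      have tp: "t n > 0" for n unfolding t_def using \<open>h\<^sub>0 > 0\<close> by simp
      have tl: "t n < h\<^sub>0" for n
      proof -
        have "t n \<le> min 1 (h\<^sub>0 / 2) * 1" unfolding t_def using \<open>h\<^sub>0 > 0\<close> by (intro mult_left_mono) auto
        then show ?thesis using \<open>h\<^sub>0 > 0\<close> by linarith
      qed
      let ?h = "\<lambda>x. \<phi> x \<bullet> b"
      have der: "(?h has_derivative (\<lambda>v. frechet_derivative \<phi> (at x) v \<bullet> b)) (at x)" for x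
        by (rule has_derivative_inner_left[OF test_field_has_derivative[OF \<phi>]])
      let ?q = "\<lambda>n x. (?h (x + t n *\<^sub>R b) - ?h x) / t n"
      have h1: "\<bar>?h x\<bar> \<le> 1" for x
        using Cauchy_Schwarz_ineq2[of "\<phi> x" b] n1[of x] b by simp
      have le: "(\<integral>x. indicator E x * ?q n x \<partial>lborel) \<le> C" for n
      proof -
        let ?T = "{x. x - t n *\<^sub>R b \<in> E}"
        let ?S = "(?T - E) \<union> (E - ?T)"
        have [measurable]: "?T \<in> sets borel" by measurable
        have "?T = (+) (t n *\<^sub>R b) ` E" by (force simp: image_iff)
        then have "bounded ?T" by (simp only: bounded_translation[OF E(2)])
        have "bounded (?T \<union> E)" using \<open>bounded ?T\<close> E(2) by (rule bounded_Un[THEN iffD2, OF conjI])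
        then have bS: "bounded ?S" by (rule bounded_subset) blast
        have iS: "integrable lborel (indicator ?S :: 'a \<Rightarrow> real)"
          using emeasure_bounded_finite[OF bS] by (intro integrable_real_indicator) auto
        have iT: "integrable lborel (indicator ?T :: 'a \<Rightarrow> real)"
          using emeasure_bounded_finite[OF \<open>bounded ?T\<close>] by (intro integrable_real_indicator) auto
        have ih: "integrable lborel (\<lambda>x. indicator A x * ?h x)"
          if "integrable lborel (indicator A :: 'a \<Rightarrow> real)" for A
        proof (rule Bochner_Integration.integrable_bound[OF that])
          note [measurable] = borel_measurable_integrable[OF that]
          show "(\<lambda>x. indicator A x * ?h x) \<in> borel_measurable lborel" by measurable
          show "AE x in lborel. norm (indicator A x * ?h x) \<le> norm (indicator A x :: real)"
            using h1 by (intro AE_I2) (auto simp: indicator_def)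
        qed
        have tr': "indicator E x * ?h (x + t n *\<^sub>R b) = indicator ?T (x + t n *\<^sub>R b) * ?h (x + t n *\<^sub>R b)" for x
          by (simp add: indicator_def)
        have i1: "integrable lborel (\<lambda>x. indicator E x * ?h (x + t n *\<^sub>R b))"
          unfolding tr' by (rule integrable_translate[OF ih[OF iT]])
        have "(\<integral>x. indicator E x * ?q n x \<partial>lborel)
          = ((\<integral>x. indicator E x * ?h (x + t n *\<^sub>R b) \<partial>lborel) - (\<integral>x. indicator E x * ?h x \<partial>lborel)) / t n"
          using i1 ih[OF iE] by (simp add: right_diff_distrib flip: Bochner_Integration.integral_diff)
        also have "(\<integral>x. indicator E x * ?h (x + t n *\<^sub>R b) \<partial>lborel) = (\<integral>x. indicator ?T x * ?h x \<partial>lborel)"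
          unfolding tr' by (rule integral_translate[of "\<lambda>x. indicator ?T x * ?h x"]) measurable
        also have "(\<integral>x. indicator ?T x * ?h x \<partial>lborel) - (\<integral>x. indicator E x * ?h x \<partial>lborel)
            = (\<integral>x. indicator ?T x * ?h x - indicator E x * ?h x \<partial>lborel)"
          using ih[OF iT] ih[OF iE] by simp
        also have "\<dots> \<le> (\<integral>x. indicator ?S x \<partial>lborel)"
        proof (rule integral_mono)
          show "indicator ?T x * ?h x - indicator E x * ?h x \<le> indicator ?S x" for x
            using h1[of x] by (auto simp: indicator_def abs_le_iff)
        qed (use ih[OF iT] ih[OF iE] iS in auto)
        also have "\<dots> \<le> C * t n" using tr[OF tp tl b] by simp
        finally show ?thesis using tp[of n] by (simp add: divide_right_mono pos_divide_le_eq)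
      qed
      have "(\<lambda>n. \<integral>x. indicator E x * ?q n x \<partial>lborel) \<longlonglongrightarrow> (\<integral>x. indicator E x * ?D b x \<partial>lborel)"
      proof (rule integral_dominated_convergence[where w = "\<lambda>x. M * indicator E x"])
        show "AE x in lborel. (\<lambda>n. indicator E x * ?q n x) \<longlonglongrightarrow> indicator E x * ?D b x"
          by (intro AE_I2 tendsto_intros difference_quotient_tendsto[OF der t0 tp])
        show "AE x in lborel. norm (indicator E x * ?q n x) \<le> M * indicator E x" for n
          using difference_quotient_bound[OF der M(2) tp] by (intro AE_I2) (auto simp: indicator_def)
      qed (use iE in auto)
      then show ?thesis by (rule LIMSEQ_le_const2) (use le in auto)
    qed
    have i: "integrable lborel (\<lambda>x. indicator E x * ?D b x)" for b
    proof -
      have "integrable lborel (?D b)"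
        by (rule continuous_bounded_support(1)[OF cD[of b], of R]) (use R in auto)
      from integrable_mult_indicator[OF _ this, of E] show ?thesis by simp
    qed
    have "flux E \<phi> = (\<Sum>b\<in>Basis. \<integral>x. indicator E x * ?D b x \<partial>lborel)"
      unfolding divergence_def sum_distrib_left using i by (intro Bochner_Integration.integral_sum) auto
    also have "\<dots> \<le> (\<Sum>b\<in>(Basis::'a set). C)" by (intro sum_mono comp)
    finally show ?thesis by simp
  qed
  then show ?thesis using E(1) \<open>C \<ge> 0\<close> by (subst perimeter_le_iff_lborel) auto
qed

section \<open>Volume and perimeter of cubes\<close>

lemma measure_cbox_slab:
  fixes l u :: "'a::euclidean_space"
  assumes b: "b \<in> Basis" and d: "\<And>i. i \<in> Basis \<Longrightarrow> i \<noteq> b \<Longrightarrow> (u - l) \<bullet> i = s" and h: "(u - l) \<bullet> b = h"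
    and "0 \<le> s" "0 \<le> h"
  shows "vol (cbox l u) = h * s ^ (DIM('a) - 1)"
proof -
  have "\<forall>i\<in>Basis. l \<bullet> i \<le> u \<bullet> i"
    using d h assms(4,5) by (metis diff_ge_0_iff_ge inner_diff_left)
  then have "vol (cbox l u) = (\<Prod>i\<in>Basis. (u - l) \<bullet> i)"
    by (auto simp: content_cbox inner_diff_left)
  also have "\<dots> = h * (\<Prod>i\<in>Basis - {b}. (u - l) \<bullet> i)" using b h by (subst prod.remove[of _ b]) auto
  also have "(\<Prod>i\<in>Basis - {b}. (u - l) \<bullet> i) = (\<Prod>i\<in>Basis - {b}. s)" by (intro prod.cong) (auto intro: d)
  also have "\<dots> = s ^ (DIM('a) - 1)" using b by (simp add: card_Diff_singleton)
  finally show ?thesis .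
qed

text \<open>\<open>s\<close> is half the side. Cubes are convenient because volumes and the effect
  of a translation along a coordinate are explicit.\<close>

definition cube :: "'a::euclidean_space \<Rightarrow> real \<Rightarrow> 'a set" where
  "cube x s = cbox (x - s *\<^sub>R One) (x + s *\<^sub>R One)"

lemma mem_cube: "y \<in> cube x s \<longleftrightarrow> (\<forall>i\<in>Basis. \<bar>(y - x) \<bullet> i\<bar> \<le> s)"
  unfolding cube_def mem_box by (auto simp: inner_diff_left inner_add_left abs_le_iff algebra_simps)

lemma measure_cube: "0 \<le> s \<Longrightarrow> vol (cube (x::'a::euclidean_space) s) = (2 * s) ^ DIM('a)"
  unfolding cube_def by (subst content_cbox) (auto simp: inner_diff_left inner_add_left)

lemma cube_borel [simp]: "cube x s \<in> sets borel" and bounded_cube: "bounded (cube x s)"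
  and compact_cube: "compact (cube x s)"
  unfolding cube_def by (auto simp: bounded_cbox)

text \<open>A translation by \<open>h\<close> along \<open>b\<close> changes the cube within two
  slabs of thickness \<open>h\<close> whose cross-section is a face. The resulting bound is the
  actual surface area. Since the slabs have the full thickness \<open>h\<close>, steps beyond the
  side length are covered as well.\<close>

lemma perimeter_cube_le:
  fixes x :: "'a::euclidean_space"
  assumes "0 \<le> s"
  shows "perimeter (cube x s) \<le> ennreal (real DIM('a) * (2 * (2 * s) ^ (DIM('a) - 1)))"
proof (rule perimeter_le_of_translates[where h\<^sub>0 = 1])
  fix h :: real and b :: 'a assume h: "0 < h" and b: "b \<in> Basis"
  let ?T = "{y. y - h *\<^sub>R b \<in> cube x s}"
  let ?l = "x - s *\<^sub>R One" and ?u = "x + s *\<^sub>R One"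
  let ?b1 = "cbox ?l (?u + (h - 2 * s) *\<^sub>R b)" and ?b2 = "cbox (?l + (2 * s) *\<^sub>R b) (?u + h *\<^sub>R b)"
  have m1: "vol ?b1 = h * (2 * s) ^ (DIM('a) - 1)"
    by (rule measure_cbox_slab[OF b])
      (use h b assms in \<open>auto simp: inner_diff_left inner_add_left inner_Basis\<close>)
  have m2: "vol ?b2 = h * (2 * s) ^ (DIM('a) - 1)"
    by (rule measure_cbox_slab[OF b])
      (use h b assms in \<open>auto simp: inner_diff_left inner_add_left inner_Basis\<close>)
  have s1: "cube x s - ?T \<subseteq> ?b1"
  proof
    fix y assume y: "y \<in> cube x s - ?T"
    then obtain i where i: "i \<in> Basis" "\<not> \<bar>(y - h *\<^sub>R b - x) \<bullet> i\<bar> \<le> s" and c: "\<And>i. i \<in> Basis \<Longrightarrow> \<bar>(y - x) \<bullet> i\<bar> \<le> s"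
      by (auto simp: mem_cube)
    have "i = b" using i c[OF i(1)] b by (cases "i = b") (auto simp: inner_diff_left inner_Basis)
    then have "y \<bullet> b < x \<bullet> b - s + h" using i c[OF b] b h by (auto simp: inner_diff_left inner_Basis)
    then show "y \<in> ?b1" using c b unfolding mem_box
      by (auto simp: inner_diff_left inner_add_left inner_Basis abs_le_iff algebra_simps)
  qed
  have s2: "?T - cube x s \<subseteq> ?b2"
  proof
    fix y assume y: "y \<in> ?T - cube x s"
    then obtain i where i: "i \<in> Basis" "\<not> \<bar>(y - x) \<bullet> i\<bar> \<le> s" and c: "\<And>i. i \<in> Basis \<Longrightarrow> \<bar>(y - h *\<^sub>R b - x) \<bullet> i\<bar> \<le> s"
      by (auto simp: mem_cube)
    have "i = b" using i c[OF i(1)] b by (cases "i = b") (auto simp: inner_diff_left inner_Basis)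
    then have "y \<bullet> b > x \<bullet> b + s" using i c[OF b] b h by (auto simp: inner_diff_left inner_Basis)
    moreover have "\<bar>(y - x) \<bullet> i\<bar> \<le> s" if "i \<in> Basis" "i \<noteq> b" for i
      using c[OF that(1)] that b by (auto simp: inner_diff_left inner_Basis)
    moreover note c[OF b]
    ultimately show "y \<in> ?b2" using b unfolding mem_box
      by (auto simp: inner_diff_left inner_add_left inner_Basis abs_le_iff algebra_simps)
  qed
  have "vol ((?T - cube x s) \<union> (cube x s - ?T)) \<le> vol (?b2 \<union> ?b1)"
  proof (rule measure_mono_fmeasurable)
    have [measurable]: "cube x s \<in> sets borel" by simp
    have "?T \<in> sets borel" by measurable
    then show "(?T - cube x s) \<union> (cube x s - ?T) \<in> sets lborel" by simp
  qed (use s1 s2 in \<open>auto intro!: fmeasurable.Un\<close>)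
  also have "\<dots> \<le> vol ?b2 + vol ?b1"
    by (rule measure_Un_le) auto
  finally show "vol ((?T - cube x s) \<union> (cube x s - ?T)) \<le> 2 * (2 * s) ^ (DIM('a) - 1) * h"
    unfolding m1 m2 by (simp add: mult_ac)
qed (use assms bounded_cube in auto)

section \<open>Smooth boundaries\<close>

lemma C1_lipschitz_on_cball:
  fixes \<gamma> :: "'a::euclidean_space \<Rightarrow> real"
  assumes "Ck 1 \<gamma>"
  obtains L where "L \<ge> 0" "\<And>x y. x \<in> cball 0 R \<Longrightarrow> y \<in> cball 0 R \<Longrightarrow> \<bar>\<gamma> x - \<gamma> y\<bar> \<le> L * norm (x - y)"
proof -
  let ?D = "\<lambda>x. frechet_derivative \<gamma> (at x)"
  have der: "(\<gamma> has_derivative ?D x) (at x)" for x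
    using assms by (auto simp: differentiable_on_def frechet_derivative_works)
  have "\<exists>M. \<forall>x\<in>cball 0 R. \<bar>?D x b\<bar> \<le> M" for b
  proof -
    have "continuous_on (cball 0 R) (\<lambda>x. ?D x b)"
      using assms by (auto intro: continuous_on_subset)
    then have "compact ((\<lambda>x. ?D x b) ` cball 0 R)" by (rule compact_continuous_image) simp
    then have "bounded ((\<lambda>x. ?D x b) ` cball 0 R)" by (rule compact_imp_bounded)
    then show ?thesis unfolding bounded_iff by auto
  qed
  then obtain M where M: "\<And>b x. x \<in> cball 0 R \<Longrightarrow> \<bar>?D x b\<bar> \<le> M b" by metis
  define L where "L = (\<Sum>b\<in>Basis. \<bar>M b\<bar>)"
  have "onorm (?D x) \<le> L" if "x \<in> cball 0 R" for x
  proof (rule onorm_le)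
    fix v
    have lin: "linear (?D x)" using der has_derivative_linear by blast
    have "?D x v = ?D x (\<Sum>b\<in>Basis. (v \<bullet> b) *\<^sub>R b)" by (simp add: euclidean_representation)
    also have "\<dots> = (\<Sum>b\<in>Basis. (v \<bullet> b) * ?D x b)"
      by (simp add: linear_sum[OF lin] linear_scale[OF lin])
    also have "norm \<dots> \<le> (\<Sum>b\<in>Basis. norm v * \<bar>M b\<bar>)"
    proof (rule sum_norm_le)
      fix b :: 'a assume b: "b \<in> Basis"
      have "\<bar>v \<bullet> b\<bar> \<le> norm v" using b by (rule Basis_le_norm)
      moreover have "\<bar>?D x b\<bar> \<le> \<bar>M b\<bar>" using M[OF that, of b] by linarith
      ultimately show "norm ((v \<bullet> b) * ?D x b) \<le> norm v * \<bar>M b\<bar>"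
        by (simp add: abs_mult mult_mono)
    qed
    also have "\<dots> = L * norm v" by (simp add: L_def sum_distrib_left mult.commute)
    finally show "norm (?D x v) \<le> L * norm v" .
  qed
  then have "norm (\<gamma> x - \<gamma> y) \<le> L * norm (x - y)" if "x \<in> cball 0 R" "y \<in> cball 0 R" for x y
    using that der by (intro differentiable_bound[of "cball 0 R" \<gamma> ?D]) (auto intro: has_derivative_at_withinI)
  moreover have "L \<ge> 0" unfolding L_def by (intro sum_nonneg) auto
  ultimately show thesis using that by auto
qed

text \<open>\<open>G\<close> is the signed height above the graph in the direction \<open>\<nu>\<close>.\<close>

definition boundary_chart :: "'a::euclidean_space set \<Rightarrow> 'a \<Rightarrow> real \<Rightarrow> 'a \<Rightarrow> ('a \<Rightarrow> real) \<Rightarrow> real \<Rightarrow> bool" where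
  "boundary_chart U z r \<nu> G L \<longleftrightarrow> r > 0 \<and> norm \<nu> = 1 \<and> L \<ge> 1 \<and> continuous_on UNIV G \<and>
     (\<forall>x t. G (x + t *\<^sub>R \<nu>) = G x + t) \<and>
     (\<forall>x\<in>ball z r. \<forall>y\<in>ball z r. \<bar>G x - G y\<bar> \<le> L * norm (x - y)) \<and>
     U \<inter> ball z r = {y \<in> ball z r. G y > 0}"

lemma boundary_chart_exists:
  assumes "smooth_boundary U" "z \<in> frontier U"
  obtains r \<nu> G L where "boundary_chart U z r \<nu> G L"
proof -
  obtain r \<nu> and \<gamma> :: "'a \<Rightarrow> real" where r: "r > 0" and \<nu>: "norm \<nu> = 1" and \<gamma>: "smooth \<gamma>"
    and U: "U \<inter> ball z r = {y \<in> ball z r. y \<bullet> \<nu> > \<gamma> (y - (y \<bullet> \<nu>) *\<^sub>R \<nu>)}"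
    using assms unfolding smooth_boundary_def by blast
  have \<nu>\<nu>: "\<nu> \<bullet> \<nu> = 1" using \<nu> by (simp add: dot_square_norm)
  define p where "p = (\<lambda>y. y - (y \<bullet> \<nu>) *\<^sub>R \<nu>)"
  have C: "Ck 1 \<gamma>" using \<gamma> unfolding smooth_def by blast
  have np: "norm (p y) \<le> 2 * norm y" for y
  proof -
    have "norm (p y) \<le> norm y + \<bar>y \<bullet> \<nu>\<bar> * norm \<nu>"
      unfolding p_def using norm_triangle_ineq4[of y "(y \<bullet> \<nu>) *\<^sub>R \<nu>"] by simp
    moreover have "\<bar>y \<bullet> \<nu>\<bar> \<le> norm y" using Cauchy_Schwarz_ineq2[of y \<nu>] \<nu> by simp
    ultimately show ?thesis using \<nu> by simp
  qed
  \<comment> \<open>The map \<open>p\<close> at most doubles norms, which gives the radius here. The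
    chart constant \<open>1 + 2 * L\<close> then consists of 1 for the height
    \<open>y \<bullet> \<nu>\<close> and \<open>2 * L\<close> for \<gamma> after
    \<open>p\<close>.\<close>
  obtain L where L: "L \<ge> 0" "\<And>x y. x \<in> cball 0 (2 * (norm z + r)) \<Longrightarrow> y \<in> cball 0 (2 * (norm z + r)) \<Longrightarrow>
      \<bar>\<gamma> x - \<gamma> y\<bar> \<le> L * norm (x - y)"
    using C1_lipschitz_on_cball[OF C] by blast
  define G where "G = (\<lambda>y. y \<bullet> \<nu> - \<gamma> (p y))"
  have "continuous_on UNIV \<gamma>" using C by (auto intro: differentiable_imp_continuous_on)
  then have "continuous_on UNIV (\<lambda>y. \<gamma> (p y))"
    by (rule continuous_on_compose2) (auto simp: p_def intro!: continuous_intros)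
  then have c: "continuous_on UNIV G" unfolding G_def by (intro continuous_intros)
  have "G (x + t *\<^sub>R \<nu>) = G x + t" for x t
  proof -
    have "p (x + t *\<^sub>R \<nu>) = p x" by (simp add: p_def inner_add_left \<nu>\<nu> algebra_simps)
    then show ?thesis by (simp add: G_def inner_add_left \<nu>\<nu>)
  qed
  moreover have "\<bar>G x - G y\<bar> \<le> (1 + 2 * L) * norm (x - y)" if "x \<in> ball z r" "y \<in> ball z r" for x y
  proof -
    have in_ball: "p w \<in> cball 0 (2 * (norm z + r))" if "w \<in> ball z r" for w
    proof -
      have "norm w \<le> norm z + r" using that norm_triangle_ineq2[of w z] by (simp add: dist_norm norm_minus_commute)
      then show ?thesis using np[of w] by simp
    qed
    have "p x - p y = p (x - y)" by (simp add: p_def inner_diff_left algebra_simps)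
    then have "\<bar>\<gamma> (p x) - \<gamma> (p y)\<bar> \<le> L * (2 * norm (x - y))"
      using L(2)[OF in_ball[OF that(1)] in_ball[OF that(2)]] mult_left_mono[OF np[of "x - y"] L(1)] by simp
    moreover have "\<bar>x \<bullet> \<nu> - y \<bullet> \<nu>\<bar> \<le> norm (x - y)"
      using Cauchy_Schwarz_ineq2[of "x - y" \<nu>] \<nu> by (simp add: inner_diff_left)
    ultimately show ?thesis unfolding G_def by (simp add: algebra_simps)
  qed
  moreover have "U \<inter> ball z r = {y \<in> ball z r. G y > 0}" using U by (simp add: G_def p_def)
  ultimately have "boundary_chart U z r \<nu> G (1 + 2 * L)"
    unfolding boundary_chart_def using r \<nu> c L(1) by auto
  then show thesis by (rule that)
qed

lemma boundary_chart_closure: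
  assumes ch: "boundary_chart U z r \<nu> G L" and x: "x \<in> closure U" "x \<in> ball z r"
  shows "G x \<ge> 0"
proof -
  have c: "continuous_on UNIV G" using ch unfolding boundary_chart_def by blast
  have "x \<in> closure (U \<inter> ball z r)"
    using x open_Int_closure_subset[of "ball z r" U] by (auto simp: Int_commute)
  moreover have "U \<inter> ball z r \<subseteq> {y. 0 \<le> G y}" using ch unfolding boundary_chart_def by auto
  moreover have "closed {y. 0 \<le> G y}" by (intro closed_Collect_le c continuous_intros)
  ultimately show ?thesis using closure_minimal by blast
qed

lemma boundary_chart_frontier:
  assumes ch: "boundary_chart U z r \<nu> G L" and "open U" and x: "x \<in> frontier U" "x \<in> ball z r"
  shows "G x = 0"
proof -
  have "x \<notin> U" using x(1) \<open>open U\<close> by (simp add: frontier_def interior_open)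
  then have "\<not> G x > 0" using x(2) ch unfolding boundary_chart_def by blast
  moreover have "G x \<ge> 0" using boundary_chart_closure[OF ch _ x(2)] x(1) by (simp add: frontier_def)
  ultimately show ?thesis by simp
qed

text \<open>About \<open>1 / k\<close> translates of the strip in the direction \<open>\<nu>\<close> are disjoint and stay in a
  bounded set.\<close>

lemma boundary_chart_strip:
  fixes U :: "'a::euclidean_space set"
  assumes ch: "boundary_chart U z r \<nu> G L"
  defines "S \<equiv> \<lambda>k. {x \<in> ball z r. \<bar>G x\<bar> \<le> k}"
  obtains C where "C \<ge> 0" "\<And>k. 0 < k \<Longrightarrow> k \<le> 1 \<Longrightarrow> vol (S k) \<le> C * k" "\<And>k. S k \<in> sets borel"
proof -
  have c: "continuous_on UNIV G" and nu: "norm \<nu> = 1" and shift: "\<And>x t. G (x + t *\<^sub>R \<nu>) = G x + t"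
    using ch unfolding boundary_chart_def by blast+
  have Sb: "S k \<in> sets borel" for k
  proof -
    have [measurable]: "G \<in> borel_measurable borel" using c by (rule borel_measurable_continuous_onI)
    have "S k = ball z r \<inter> {x. \<bar>G x\<bar> \<le> k}" by (auto simp: S_def)
    also have "\<dots> \<in> sets borel" by measurable
    finally show ?thesis .
  qed
  define V where "V = vol (ball z (r + 3))"
  have "vol (S k) \<le> (2 * V) * k" if k: "0 < k" "k \<le> 1" for k
  proof -
    define n where "n = nat \<lfloor>1 / k\<rfloor>"
    have 1: "1 \<le> 1 / k" using k by simp
    then have fl: "1 \<le> \<lfloor>1 / k\<rfloor>" by (simp add: le_floor_iff)
    have rn: "real n = of_int \<lfloor>1 / k\<rfloor>" unfolding n_def by (rule of_nat_nat) (use fl in linarith)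
    have n1: "real n \<le> 1 / k" unfolding rn by (rule of_int_floor_le)
    have n2: "1 / k \<le> 2 * real n" unfolding rn using fl floor_correct[of "1 / k"] by linarith
    have n0: "real n > 0" using n2 1 by linarith
    \<comment> \<open>The spacing \<open>3 * k\<close> exceeds the oscillation \<open>2 * k\<close>
      of \<open>G\<close> on the strip, which makes the translates disjoint. As
      \<open>k * n \<le> 1\<close>, no translate moves further than 3. Comparing with the ball of
      radius \<open>r + 3\<close> and using \<open>1 / k \<le> 2 * n\<close> gives the linear
      bound.\<close>
    let ?T = "\<lambda>j::nat. (+) ((3 * k * real j) *\<^sub>R \<nu>) ` S k"
    have disj: "pairwise (\<lambda>i j. disjnt (?T i) (?T j)) {..<n}"
    proof (intro pairwiseI, rule ccontr)
      fix i j :: nat assume ij: "i \<noteq> j" "\<not> disjnt (?T i) (?T j)"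
      then obtain x y where xy: "x \<in> S k" "y \<in> S k" "(3 * k * real i) *\<^sub>R \<nu> + x = (3 * k * real j) *\<^sub>R \<nu> + y"
        unfolding disjnt_def by blast
      have "G x + 3 * k * real i = G y + 3 * k * real j"
        using shift[of x "3 * k * real i"] shift[of y "3 * k * real j"] xy(3) by (simp add: add.commute)
      then have "3 * k * (real i - real j) = G y - G x" by (simp add: algebra_simps)
      then have "3 * k * \<bar>real i - real j\<bar> = \<bar>G y - G x\<bar>" using k(1) by (metis abs_mult abs_of_pos mult_pos_pos zero_less_numeral)
      also have "\<dots> \<le> 2 * k" using xy(1,2) unfolding S_def by auto
      finally have "3 * \<bar>real i - real j\<bar> \<le> 2" using k(1) by (simp add: mult.commute)
      moreover have "1 \<le> \<bar>real i - real j\<bar>" using ij(1) by linarith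
      moreover have False if "3 * t \<le> 2" "1 \<le> t" for t :: real using that by simp
      ultimately show False by blast
    qed
    have sub: "(\<Union>j\<in>{..<n}. ?T j) \<subseteq> ball z (r + 3)"
    proof
      fix y assume "y \<in> (\<Union>j\<in>{..<n}. ?T j)"
      then obtain j x where j: "j < n" "x \<in> S k" "y = (3 * k * real j) *\<^sub>R \<nu> + x" by blast
      have "k * real j \<le> k * real n" using j(1) k(1) by simp
      also have "\<dots> \<le> 1" using n1 k(1) by (simp add: field_simps)
      finally have "norm ((3 * k * real j) *\<^sub>R \<nu>) \<le> 3" using nu k(1) by simp
      moreover have "norm (x - z) < r" using j(2) by (simp add: S_def dist_norm norm_minus_commute)
      moreover have "y - z = (3 * k * real j) *\<^sub>R \<nu> + (x - z)" using j(3) by simp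
      then have "norm (y - z) \<le> norm ((3 * k * real j) *\<^sub>R \<nu>) + norm (x - z)"
        by (simp only: norm_triangle_ineq)
      ultimately have "norm (y - z) < r + 3" by linarith
      then show "y \<in> ball z (r + 3)" by (simp add: dist_norm norm_minus_commute)
    qed
    have Tl: "?T j \<in> lmeasurable" and mT: "measure lebesgue (?T j) = vol (S k)" for j
    proof -
      have "bounded (S k)" by (rule bounded_subset[of "ball z r"]) (auto simp: S_def)
      then have "S k \<in> lmeasurable" using Sb[of k] by (intro bounded_set_imp_lmeasurable) auto
      then show "?T j \<in> lmeasurable" by (rule measurable_translation)
      show "measure lebesgue (?T j) = vol (S k)"
        using Sb[of k] by (simp add: measure_translation)
    qed
    have "real n * vol (S k) = (\<Sum>j<n. measure lebesgue (?T j))" by (simp add: mT)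
    also have "\<dots> = measure lebesgue (\<Union>j\<in>{..<n}. ?T j)"
      using Tl disj by (intro measure_UNION'[symmetric]) auto
    also have "\<dots> \<le> measure lebesgue (ball z (r + 3))"
      by (rule measure_mono_fmeasurable[OF sub]) (use Tl in \<open>auto intro!: sets.finite_UN fmeasurableD\<close>)
    also have "\<dots> = V" by (simp add: V_def)
    finally have "vol (S k) \<le> V / real n" using n0 by (simp add: field_simps)
    also have "\<dots> \<le> V * (2 * k)"
    proof -
      have "1 / real n \<le> 2 * k" using n2 n0 k(1) by (simp add: field_simps)
      from mult_left_mono[OF this, of V] show ?thesis by (simp add: V_def)
    qed
    finally show ?thesis by simp
  qed
  then show thesis using that[of "2 * V"] Sb by (auto simp: V_def)
qed

section \<open>Tubes around the boundary and the corkscrew condition\<close>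

lemma finite_positive_lower_bound:
  fixes f :: "'b \<Rightarrow> real"
  assumes "finite Z" "\<And>z. z \<in> Z \<Longrightarrow> 0 < f z"
  shows "\<exists>h>0. \<forall>z\<in>Z. h \<le> f z"
  using assms
proof (induction Z rule: finite_induct)
  case empty
  show ?case by (intro exI[of _ 1]) simp
next
  case (insert z Z)
  then obtain h where "h > 0" "\<forall>z\<in>Z. h \<le> f z" by auto
  with insert.prems[of z] show ?case by (intro exI[of _ "min h (f z)"]) (auto simp: min_le_iff_disj)
qed

text \<open>\<open>G\<close> vanishes on the frontier and has Lipschitz constant \<open>L\<close>,
  so points within \<open>h\<close> of the frontier lie in the strip where
  \<open>\<bar>G x\<bar> \<le> L * h\<close>, whose volume is linear in \<open>h\<close>.\<close>

lemma boundary_tube_local: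
  fixes U :: "'a::euclidean_space set"
  assumes U: "open U" "smooth_boundary U" and z: "z \<in> frontier U"
  shows "\<exists>r>0. \<exists>H>0. \<exists>C\<ge>0. \<forall>h. 0 < h \<longrightarrow> h < H \<longrightarrow>
    (\<exists>S. S \<in> fmeasurable lborel \<and> vol S \<le> C * h \<and> (\<forall>x. \<forall>w\<in>frontier U \<inter> ball z r. dist x w \<le> h \<longrightarrow> x \<in> S))"
proof -
  obtain r \<nu> G L where ch: "boundary_chart U z r \<nu> G L" using boundary_chart_exists[OF U(2) z] by blast
  have r0: "r > 0" and L1: "L \<ge> 1" using ch unfolding boundary_chart_def by auto
  obtain C where C: "C \<ge> 0" "\<And>k. 0 < k \<Longrightarrow> k \<le> 1 \<Longrightarrow> vol {x \<in> ball z r. \<bar>G x\<bar> \<le> k} \<le> C * k"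
    "\<And>k. {x \<in> ball z r. \<bar>G x\<bar> \<le> k} \<in> sets borel" using boundary_chart_strip[OF ch] by blast
  \<comment> \<open>The bound \<open>r / 2\<close> on \<open>h\<close> keeps \<open>x\<close> in the
    chart ball, and \<open>1 / L\<close> makes the strip bound applicable with
    \<open>k = L * h \<le> 1\<close>.\<close>
  have main: "\<exists>S. S \<in> fmeasurable lborel \<and> vol S \<le> (C * L) * h \<and> (\<forall>x. \<forall>w\<in>frontier U \<inter> ball z (r / 2). dist x w \<le> h \<longrightarrow> x \<in> S)"
    if h: "0 < h" "h < min (r / 2) (1 / L)" for h
  proof (intro exI conjI allI ballI impI)
    let ?S = "{x \<in> ball z r. \<bar>G x\<bar> \<le> L * h}"
    have "bounded ?S" by (rule bounded_subset[of "ball z r"]) auto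
    then show "?S \<in> fmeasurable lborel"
      using emeasure_bounded_finite[of ?S] C(3)[of "L * h"] by (intro fmeasurableI) auto
    have "L * h \<le> L * (1 / L)" using h(2) L1 by (intro mult_left_mono) auto
    then have "L * h \<le> 1" using L1 by simp
    moreover have "0 < L * h" using L1 h(1) by simp
    ultimately have "vol ?S \<le> C * (L * h)" using C(2) by blast
    then show "vol ?S \<le> (C * L) * h" by (simp only: mult.assoc)
    fix x w assume w: "w \<in> frontier U \<inter> ball z (r / 2)" "dist x w \<le> h"
    have wb: "w \<in> ball z r" using w(1) r0 by simp
    have xb: "x \<in> ball z r"
      using dist_triangle[of z x w] w h(2) by (simp add: dist_commute)
    have "G w = 0" using boundary_chart_frontier[OF ch U(1) _ wb] w(1) by blast
    moreover have "\<bar>G x - G w\<bar> \<le> L * norm (x - w)"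
      using ch xb wb unfolding boundary_chart_def by blast
    moreover have "L * norm (x - w) \<le> L * h"
      using w(2) L1 by (intro mult_left_mono) (auto simp: dist_norm)
    ultimately show "x \<in> ?S" using xb by auto
  qed
  have "0 < min (r / 2) (1 / L)" using r0 L1 by simp
  moreover have "C * L \<ge> 0" using C(1) L1 by simp
  moreover have "0 < r / 2" using r0 by simp
  ultimately show ?thesis using main by blast
qed

text \<open>If exactly one of \<open>x\<close> and \<open>x - h *\<^sub>R b\<close> lies in the
  closure, the segment between them meets the frontier, so \<open>x\<close> is within
  \<open>h\<close> of it. Finitely many local tubes bound the volume of such points linearly in
  \<open>h\<close>, and the criterion with translates applies.\<close>

lemma perimeter_smooth_domain_finite:
  fixes U :: "'a::euclidean_space set"
  assumes U: "open U" "bounded U" "smooth_boundary U"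
  shows "perimeter (closure U) < \<infinity>"
proof -
  obtain r H C where r0: "\<And>z. z \<in> frontier U \<Longrightarrow> r z > 0" and H0: "\<And>z. z \<in> frontier U \<Longrightarrow> H z > 0"
    and C0: "\<And>z. z \<in> frontier U \<Longrightarrow> C z \<ge> 0"
    and S: "\<And>z h. z \<in> frontier U \<Longrightarrow> 0 < h \<Longrightarrow> h < H z \<Longrightarrow> (\<exists>S. S \<in> fmeasurable lborel \<and>
      vol S \<le> C z * h \<and> (\<forall>x. \<forall>w\<in>frontier U \<inter> ball z (r z). dist x w \<le> h \<longrightarrow> x \<in> S))"
    using boundary_tube_local[OF U(1,3)] by metis
  have cpt: "compact (frontier U)" using U(2) by (rule compact_frontier_bounded)
  have cov: "frontier U \<subseteq> (\<Union>z\<in>frontier U. ball z (r z))"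
  proof
    fix x assume x: "x \<in> frontier U"
    then have "x \<in> ball x (r x)" using r0 by simp
    with x show "x \<in> (\<Union>z\<in>frontier U. ball z (r z))" by blast
  qed
  obtain Z where Z: "Z \<subseteq> frontier U" "finite Z" "frontier U \<subseteq> (\<Union>z\<in>Z. ball z (r z))"
    by (rule compactE_image[OF cpt open_ball cov])
  have "0 < H z" if "z \<in> Z" for z using H0 that Z(1) by blast
  then obtain h\<^sub>0 where h\<^sub>0: "h\<^sub>0 > 0" and hz: "\<forall>z\<in>Z. h\<^sub>0 \<le> H z"
    using finite_positive_lower_bound[OF Z(2), of H] by blast
  define B where "B = (\<Sum>z\<in>Z. C z)"
  have B0: "B \<ge> 0" unfolding B_def using C0 Z(1) by (intro sum_nonneg) blast
  have "perimeter (closure U) \<le> ennreal (real DIM('a) * B)"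
  proof (rule perimeter_le_of_translates[OF _ _ h\<^sub>0 B0])
    show "closure U \<in> sets borel" by simp
    show "bounded (closure U)" using U(2) by (rule bounded_closure)
    fix h :: real and b :: 'a assume h: "0 < h" "h < h\<^sub>0" and b: "b \<in> Basis"
    let ?E = "closure U" and ?T = "{x. x - h *\<^sub>R b \<in> closure U}"
    have "\<exists>S. S \<in> fmeasurable lborel \<and> vol S \<le> C z * h \<and>
        (\<forall>x. \<forall>w\<in>frontier U \<inter> ball z (r z). dist x w \<le> h \<longrightarrow> x \<in> S)" if "z \<in> Z" for z
    proof -
      have "h < H z" using hz that h(2) by force
      then show ?thesis using S h(1) that Z(1) by blast
    qed
    then obtain S where S: "\<And>z. z \<in> Z \<Longrightarrow> S z \<in> fmeasurable lborel" "\<And>z. z \<in> Z \<Longrightarrow> vol (S z) \<le> C z * h"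
      "\<And>z x w. z \<in> Z \<Longrightarrow> w \<in> frontier U \<inter> ball z (r z) \<Longrightarrow> dist x w \<le> h \<Longrightarrow> x \<in> S z"
      by metis
    have cover: "(?T - ?E) \<union> (?E - ?T) \<subseteq> (\<Union>z\<in>Z. S z)"
    proof
      fix x assume x: "x \<in> (?T - ?E) \<union> (?E - ?T)"
      let ?I = "closed_segment x (x - h *\<^sub>R b)"
      have e: "x \<in> ?I" "x - h *\<^sub>R b \<in> ?I" by simp_all
      have "?I \<inter> ?E \<noteq> {}" "?I - ?E \<noteq> {}" using x e by blast+
      then have "?I \<inter> frontier ?E \<noteq> {}" by (intro connected_Int_frontier) auto
      moreover have "frontier ?E \<subseteq> frontier U"
        using interior_mono[OF closure_subset, of U] by (auto simp: frontier_def)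
      ultimately obtain w where w: "w \<in> ?I" "w \<in> frontier U" by blast
      have "dist x w \<le> dist x (x - h *\<^sub>R b)" using dist_in_closed_segment[OF w(1)] by (simp add: dist_commute)
      also have "\<dots> = h" using b h(1) by (simp add: dist_norm)
      finally have d: "dist x w \<le> h" .
      obtain z where z: "z \<in> Z" "w \<in> ball z (r z)" using w(2) Z(3) by blast
      show "x \<in> (\<Union>z\<in>Z. S z)" using S(3)[OF z(1) _ d] w(2) z by blast
    qed
    have [measurable]: "closure U \<in> sets borel" by simp
    have "?T \<in> sets borel" by measurable
    then have "vol ((?T - ?E) \<union> (?E - ?T)) \<le> vol (\<Union>z\<in>Z. S z)"
      using S(1) Z(2) by (intro measure_mono_fmeasurable[OF cover]) auto
    also have "\<dots> \<le> (\<Sum>z\<in>Z. vol (S z))"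
      by (rule measure_UNION_le[OF Z(2)]) (use S(1) in \<open>blast dest: fmeasurableD\<close>)
    also have "\<dots> \<le> (\<Sum>z\<in>Z. C z * h)" by (rule sum_mono) (rule S(2))
    also have "\<dots> = B * h" by (simp add: B_def sum_distrib_right)
    finally show "vol ((?T - ?E) \<union> (?E - ?T)) \<le> B * h" .
  qed
  then show ?thesis by (rule le_less_trans) simp
qed

text \<open>In a chart, moving by \<delta> along \<nu> raises \<open>G\<close> from a nonnegative
  value to at least \<delta>. The Lipschitz bound then keeps \<open>G\<close> positive on the ball
  of radius \<open>\<delta> / (2 * L)\<close>. Compactness of the closure makes the constants
  uniform.\<close>

lemma interior_corkscrew:
  fixes U :: "'a::euclidean_space set"
  assumes U: "open U" "bounded U" "smooth_boundary U"
  obtains c \<delta>\<^sub>0 where "0 < c" "c \<le> 1" "0 < \<delta>\<^sub>0"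
    "\<And>x \<delta>. x \<in> closure U \<Longrightarrow> 0 < \<delta> \<Longrightarrow> \<delta> < \<delta>\<^sub>0 \<Longrightarrow> \<exists>p. dist p x \<le> \<delta> \<and> cball p (c * \<delta>) \<subseteq> U"
proof -
  have "\<exists>r c. 0 < r \<and> 0 < c \<and> c \<le> 1 \<and> (\<forall>x\<in>closure U \<inter> ball z r. \<forall>\<delta>. 0 < \<delta> \<longrightarrow> \<delta> < r \<longrightarrow>
      (\<exists>p. dist p x \<le> \<delta> \<and> cball p (c * \<delta>) \<subseteq> U))" if z: "z \<in> closure U" for z
  proof (cases "z \<in> U")
    case True
    then obtain e where e: "e > 0" "ball z e \<subseteq> U" using U(1) openE by blast
    have "dist x x \<le> \<delta> \<and> cball x (1 * \<delta>) \<subseteq> U" if "x \<in> ball z (e / 2)" "0 < \<delta>" "\<delta> < e / 2" for x \<delta>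
    proof -
      have "cball x \<delta> \<subseteq> ball z e"
      proof
        fix y assume "y \<in> cball x \<delta>"
        then show "y \<in> ball z e" using that dist_triangle[of z y x] by simp
      qed
      then show ?thesis using e(2) that(2) by auto
    qed
    then have "\<forall>x\<in>closure U \<inter> ball z (e / 2). \<forall>\<delta>. 0 < \<delta> \<longrightarrow> \<delta> < e / 2 \<longrightarrow>
        (\<exists>p. dist p x \<le> \<delta> \<and> cball p (1 * \<delta>) \<subseteq> U)" by blast
    then show ?thesis by (intro exI[of _ "e / 2"] exI[of _ 1] conjI) (use e(1) in simp_all)
  next
    case False
    then have zf: "z \<in> frontier U" using z U(1) by (simp add: frontier_def interior_open)
    obtain r \<nu> G L where ch: "boundary_chart U z r \<nu> G L" using boundary_chart_exists[OF U(3) zf] by blast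
    then have r: "r > 0" "norm \<nu> = 1" "L \<ge> 1" and shift: "\<And>x t. G (x + t *\<^sub>R \<nu>) = G x + t"
      and lip: "\<And>x y. x \<in> ball z r \<Longrightarrow> y \<in> ball z r \<Longrightarrow> \<bar>G x - G y\<bar> \<le> L * norm (x - y)"
      and Ueq: "U \<inter> ball z r = {y \<in> ball z r. G y > 0}"
      unfolding boundary_chart_def by blast+
    \<comment> \<open>From \<open>z\<close> to \<open>x\<close>, on to the shifted centre and from
      there to \<open>q\<close> are three moves of length at most \<open>r / 4\<close>, so
      everything stays in the chart ball.\<close>
    have main: "dist (x + \<delta> *\<^sub>R \<nu>) x \<le> \<delta> \<and> cball (x + \<delta> *\<^sub>R \<nu>) (1 / (2 * L) * \<delta>) \<subseteq> U"
      if x: "x \<in> closure U" "x \<in> ball z (r / 4)" and \<delta>: "0 < \<delta>" "\<delta> < r / 4" for x \<delta>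
    proof
      show "dist (x + \<delta> *\<^sub>R \<nu>) x \<le> \<delta>" using r(2) \<delta>(1) by (simp add: dist_norm)
      show "cball (x + \<delta> *\<^sub>R \<nu>) (1 / (2 * L) * \<delta>) \<subseteq> U"
      proof
        fix q assume q: "q \<in> cball (x + \<delta> *\<^sub>R \<nu>) (1 / (2 * L) * \<delta>)"
        have "1 / (2 * L) * \<delta> \<le> 1 * \<delta>" using r(3) \<delta>(1) by (intro mult_right_mono) auto
        then have qd: "dist (x + \<delta> *\<^sub>R \<nu>) q \<le> \<delta>" using q by simp
        have dz: "dist z x < r / 4" using x(2) by simp
        have dx: "dist x (x + \<delta> *\<^sub>R \<nu>) = \<delta>" using r(2) \<delta>(1) by (simp add: dist_norm)
        have pb: "x + \<delta> *\<^sub>R \<nu> \<in> ball z r"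
          using dist_triangle[of z "x + \<delta> *\<^sub>R \<nu>" x] dz dx \<delta> r(1) by simp
        have "dist z q \<le> dist z x + dist x (x + \<delta> *\<^sub>R \<nu>) + dist (x + \<delta> *\<^sub>R \<nu>) q"
          using dist_triangle[of z q "x + \<delta> *\<^sub>R \<nu>"] dist_triangle[of z "x + \<delta> *\<^sub>R \<nu>" x] by linarith
        then have qb: "q \<in> ball z r" using dz dx qd \<delta> r(1) by simp
        have "G x \<ge> 0" using boundary_chart_closure[OF ch x(1)] dz r(1) by simp
        moreover have "\<bar>G (x + \<delta> *\<^sub>R \<nu>) - G q\<bar> \<le> L * norm ((x + \<delta> *\<^sub>R \<nu>) - q)" by (rule lip[OF pb qb])
        moreover have "L * norm ((x + \<delta> *\<^sub>R \<nu>) - q) \<le> L * (1 / (2 * L) * \<delta>)"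
          using q r(3) by (intro mult_left_mono) (auto simp: dist_norm)
        moreover have "L * (1 / (2 * L) * \<delta>) = \<delta> / 2" using r(3) by simp
        ultimately have "G q > 0" using shift[of x \<delta>] \<delta>(1) by linarith
        then show "q \<in> U" using Ueq qb by blast
      qed
    qed
    have "0 < 1 / (2 * L)" "1 / (2 * L) \<le> 1" using r(3) by auto
    moreover have "\<forall>x\<in>closure U \<inter> ball z (r / 4). \<forall>\<delta>. 0 < \<delta> \<longrightarrow> \<delta> < r / 4 \<longrightarrow>
        (\<exists>p. dist p x \<le> \<delta> \<and> cball p (1 / (2 * L) * \<delta>) \<subseteq> U)" using main by blast
    ultimately show ?thesis using r(1) by (intro exI[of _ "r / 4"] exI[of _ "1 / (2 * L)"] conjI) simp_all
  qed
  then obtain r c where rc: "\<And>z. z \<in> closure U \<Longrightarrow> 0 < r z" "\<And>z. z \<in> closure U \<Longrightarrow> 0 < c z"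
     "\<And>z. z \<in> closure U \<Longrightarrow> c z \<le> 1"
     "\<And>z x \<delta>. z \<in> closure U \<Longrightarrow> x \<in> closure U \<inter> ball z (r z) \<Longrightarrow> 0 < \<delta> \<Longrightarrow> \<delta> < r z \<Longrightarrow>
        \<exists>p. dist p x \<le> \<delta> \<and> cball p (c z * \<delta>) \<subseteq> U"
    by metis
  have cpt: "compact (closure U)" using U(2) by simp
  have cov: "closure U \<subseteq> (\<Union>z\<in>closure U. ball z (r z))"
  proof
    fix x assume x: "x \<in> closure U"
    then have "x \<in> ball x (r x)" using rc(1) by simp
    with x show "x \<in> (\<Union>z\<in>closure U. ball z (r z))" by blast
  qed
  obtain Z where Z: "Z \<subseteq> closure U" "finite Z" "closure U \<subseteq> (\<Union>z\<in>Z. ball z (r z))"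
    by (rule compactE_image[OF cpt open_ball cov])
  note Z = Z(2,1,3)
  define d where "d = Min (insert 1 (r ` Z))"
  define e where "e = Min (insert 1 (c ` Z))"
  show thesis
  proof (rule that[of e d])
    show "0 < e" "0 < d" unfolding d_def e_def using Z rc(1,2) by auto
    show "e \<le> 1" unfolding e_def using Z(1) by simp
    fix x \<delta> assume x: "x \<in> closure U" and \<delta>: "0 < \<delta>" "\<delta> < d"
    obtain z where z: "z \<in> Z" "x \<in> ball z (r z)" using x Z(3) by blast
    have "d \<le> r z" "e \<le> c z" unfolding d_def e_def using Z(1) z(1) by auto
    then obtain p where p: "dist p x \<le> \<delta>" "cball p (c z * \<delta>) \<subseteq> U"
      using rc(4)[of z x \<delta>] x z Z(2) \<delta> by force
    have "cball p (e * \<delta>) \<subseteq> cball p (c z * \<delta>)" using \<open>e \<le> c z\<close> \<delta>(1) by (intro subset_cball mult_right_mono) auto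
    with p show "\<exists>p. dist p x \<le> \<delta> \<and> cball p (e * \<delta>) \<subseteq> U" by blast
  qed
qed

section \<open>Compact sets of prescribed volume\<close>

lemma bounded_borel_fmeasurable:
  fixes A :: "'a::euclidean_space set"
  shows "A \<in> sets borel \<Longrightarrow> bounded A \<Longrightarrow> A \<in> fmeasurable lborel"
  using emeasure_bounded_finite[of A] by (intro fmeasurableI) auto

lemma bounded_Diff_left: "bounded A \<Longrightarrow> bounded (A - B)"
  by (rule bounded_subset) auto

lemma bounded_Int_left: "bounded A \<Longrightarrow> bounded (A \<inter> B)"
  by (rule bounded_subset) auto

lemma test_field_uminus:
  assumes "test_field \<phi>"
  shows "test_field (\<lambda>x. - \<phi> x)" "divergence (\<lambda>x. - \<phi> x) = (\<lambda>x. - divergence \<phi> x)"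
proof -
  have fd: "frechet_derivative (\<lambda>x. - \<phi> x) (at x) = (\<lambda>v. - frechet_derivative \<phi> (at x) v)" for x
    using has_derivative_minus[OF test_field_has_derivative[OF assms, of x]]
    by (rule frechet_derivative_at[symmetric])
  show "divergence (\<lambda>x. - \<phi> x) = (\<lambda>x. - divergence \<phi> x)"
    unfolding divergence_def fd by (simp add: sum_negf)
  show "test_field (\<lambda>x. - \<phi> x)"
    using assms test_field_continuous_derivative[OF assms] unfolding test_field_def
    by (auto simp: fd differentiable_on_def differentiable_minus intro!: continuous_intros)
qed

text \<open>For nested sets the indicator of the difference is the difference of indicators, and the
  negative of a test field is a test field.\<close>

lemma perimeter_Diff_subset_le:
  fixes B Q :: "'a::euclidean_space set"
  assumes "B \<in> sets borel" "perimeter B \<le> ennreal b" "0 \<le> b"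
    and "Q \<in> sets borel" "perimeter Q \<le> ennreal q" "0 \<le> q" and "Q \<subseteq> B"
  shows "perimeter (B - Q) \<le> ennreal (b + q)"
proof -
  have "flux (B - Q) \<phi> \<le> b + q" if \<phi>: "test_field \<phi>" for \<phi>
  proof -
    have eq: "indicator (B - Q) x * divergence \<phi> x = indicator B x * divergence \<phi> x - indicator Q x * divergence \<phi> x" for x
      using assms(7) by (auto simp: indicator_def)
    have "flux (B - Q) \<phi>
      = flux B \<phi> - flux Q \<phi>"
      unfolding eq by (intro Bochner_Integration.integral_diff integrable_indicator_divergence[OF \<phi>] assms)
    moreover have "flux B \<phi> \<le> b"
      using assms \<phi> by (simp add: perimeter_le_iff_lborel)
    moreover have "flux Q (\<lambda>x. - \<phi> x) \<le> q"
      using assms test_field_uminus(1)[OF \<phi>] by (simp add: perimeter_le_iff_lborel)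
    ultimately show ?thesis by (simp add: test_field_uminus(2)[OF \<phi>])
  qed
  then show ?thesis using assms by (subst perimeter_le_iff_lborel) auto
qed

text \<open>Dimension at least 2 matters here: the perimeter scales like
  \<open>s ^ (DIM('a) - 1)\<close> and vanishes in the limit. With \<open>2 * s \<le> 1\<close> all
  positive powers of \<open>2 * s\<close> are at most \<open>2 * s\<close>, so perimeter and volume
  are both at most \<open>4 * d * s\<close>.\<close>

lemma small_cubes:
  assumes "DIM('a::euclidean_space) \<ge> 2" "\<eta> > 0"
  obtains s\<^sub>0 where "0 < s\<^sub>0" "s\<^sub>0 \<le> 1"
    "\<And>(x::'a) s. 0 \<le> s \<Longrightarrow> s \<le> s\<^sub>0 \<Longrightarrow> perimeter (cube x s) \<le> ennreal \<eta>"
    "\<And>(x::'a) s. 0 \<le> s \<Longrightarrow> s \<le> s\<^sub>0 \<Longrightarrow> vol (cube x s) \<le> \<eta>"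
proof -
  define d where "d = real DIM('a)"
  have d: "d \<ge> 2" using assms(1) by (simp add: d_def)
  define s\<^sub>0 where "s\<^sub>0 = min (1 / 2) (\<eta> / (4 * d))"
  have s0: "0 < s\<^sub>0" "s\<^sub>0 \<le> 1" "s\<^sub>0 \<le> 1 / 2" using assms(2) d by (auto simp: s\<^sub>0_def)
  have "s\<^sub>0 * (4 * d) \<le> \<eta> / (4 * d) * (4 * d)" using d by (intro mult_right_mono) (auto simp: s\<^sub>0_def)
  then have s1: "s\<^sub>0 * (4 * d) \<le> \<eta>" using d by simp
  have pw: "(2 * s) ^ Suc n \<le> 2 * s" if "0 \<le> s" "s \<le> s\<^sub>0" for s n
    using that s0(3) power_le_one[of "2 * s" n] by (simp add: mult_left_le)
  define n where "n = DIM('a) - 2"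
  have n: "DIM('a) = Suc (Suc n)" using assms(1) unfolding n_def by linarith
  show thesis
  proof (rule that[OF s0(1,2)])
    fix x :: 'a and s assume s: "0 \<le> s" "s \<le> s\<^sub>0"
    have "0 \<le> 4 * d" using d by simp
    from order_trans[OF mult_right_mono[OF s(2) this] s1] have sd: "s * (4 * d) \<le> \<eta>" .
    have n': "DIM('a) - 1 = Suc n" using n by simp
    have "2 * (2 * s) ^ Suc n \<le> 2 * (2 * s)" by (rule mult_left_mono[OF pw[OF s]]) simp
    then have "d * (2 * (2 * s) ^ Suc n) \<le> d * (2 * (2 * s))" by (rule mult_left_mono) (use d in simp)
    also have "d * (2 * (2 * s)) = s * (4 * d)" by simp
    finally have "real DIM('a) * (2 * (2 * s) ^ (DIM('a) - 1)) \<le> \<eta>" using sd unfolding n' d_def by linarith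
    from order_trans[OF perimeter_cube_le[OF s(1), of x] ennreal_leI[OF this]]
    show "perimeter (cube x s) \<le> ennreal \<eta>" .
    have "vol (cube x s) \<le> 2 * s" unfolding measure_cube[OF s(1)] n by (rule pw[OF s])
    also have "2 * s \<le> s * (4 * d)"
    proof -
      have "s * 2 \<le> s * (4 * d)" by (rule mult_left_mono) (use d s(1) in auto)
      then show ?thesis by (simp only: mult.commute)
    qed
    finally show "vol (cube x s) \<le> \<eta>" using sd by simp
  qed
qed

text \<open>Finitely many cubes of the given size cover the set, and not all of the pieces can be
  null.\<close>

lemma positive_measure_meets_cube:
  fixes S :: "'a::euclidean_space set"
  assumes S: "S \<in> sets borel" "bounded S" "0 < vol S" and "0 < s"
  obtains x where "x \<in> closure S" "0 < vol (S \<inter> cube x s)"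
proof -
  have "compact (closure S)" using S(2) by simp
  moreover have "closure S \<subseteq> (\<Union>x\<in>closure S. ball x s)"
  proof
    fix x assume x: "x \<in> closure S"
    have "x \<in> ball x s" using \<open>0 < s\<close> by simp
    with x show "x \<in> (\<Union>x\<in>closure S. ball x s)" by blast
  qed
  ultimately obtain Z where Z: "Z \<subseteq> closure S" "finite Z" "closure S \<subseteq> (\<Union>x\<in>Z. ball x s)"
    by (rule compactE_image[OF _ open_ball])
  have bc: "ball x s \<subseteq> cube x s" for x :: 'a
  proof
    fix y assume "y \<in> ball x s"
    then have "norm (y - x) \<le> s" by (simp add: dist_norm norm_minus_commute)
    then show "y \<in> cube x s" unfolding mem_cube using Basis_le_norm order_trans by blast
  qed
  have f: "S \<inter> cube x s \<in> fmeasurable lborel" for x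
    using S(1,2) by (intro bounded_borel_fmeasurable) auto
  have "S \<subseteq> (\<Union>x\<in>Z. S \<inter> cube x s)"
  proof
    fix y assume y: "y \<in> S"
    then have "y \<in> closure S" by (rule closure_subset[THEN subsetD])
    then obtain x where "x \<in> Z" "y \<in> ball x s" using Z(3) by blast
    with y bc[of x] show "y \<in> (\<Union>x\<in>Z. S \<inter> cube x s)" by blast
  qed
  then have "vol S \<le> vol (\<Union>x\<in>Z. S \<inter> cube x s)"
  proof (rule measure_mono_fmeasurable)
    show "S \<in> sets lborel" using S(1) by simp
    show "(\<Union>x\<in>Z. S \<inter> cube x s) \<in> fmeasurable lborel"
      by (rule fmeasurable.finite_UN[OF Z(2)]) (rule f)
  qed
  also have "\<dots> \<le> (\<Sum>x\<in>Z. vol (S \<inter> cube x s))"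
    by (rule measure_UNION_le[OF Z(2)]) (use f in \<open>blast dest: fmeasurableD\<close>)
  finally have "0 < (\<Sum>x\<in>Z. vol (S \<inter> cube x s))" using S(3) by linarith
  then have "\<not> (\<forall>x\<in>Z. vol (S \<inter> cube x s) \<le> 0)" using sum_nonpos[of Z] by (meson not_le)
  then show thesis using that Z(1) by (auto simp: not_le)
qed

lemma continuous_on_dominated_increments:
  fixes V w :: "real \<Rightarrow> real"
  assumes "continuous_on S w" "\<And>x y. x \<in> S \<Longrightarrow> y \<in> S \<Longrightarrow> x \<le> y \<Longrightarrow> V x \<le> V y \<and> V y - V x \<le> w y - w x"
  shows "continuous_on S V"
proof -
  have "\<bar>V x - V y\<bar> \<le> \<bar>w x - w y\<bar>" if xy: "x \<in> S" "y \<in> S" for x y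
  proof (cases "x \<le> y")
    case True
    from assms(2)[OF xy True] show ?thesis by linarith
  next
    case False
    with assms(2)[OF xy(2,1)] show ?thesis by linarith
  qed
  then have "dist (V x) (V y) \<le> dist (w x) (w y)" if "x \<in> S" "y \<in> S" for x y
    using that by (simp add: dist_real_def)
  then show ?thesis using assms(1) unfolding continuous_on_iff by (meson le_less_trans)
qed

text \<open>The volume increases by no more than the volume of the growing cube itself, so it
  depends continuously on \<sigma>. The cube degenerates to a point at \<sigma> = 0, and the
  intermediate value theorem gives the volume \<open>m\<close>.\<close>

lemma compact_volume_adjustment:
  fixes A \<Omega> :: "'a::euclidean_space set"
  assumes A: "compact A" and \<Omega>: "compact \<Omega>" and s: "0 \<le> s"
    and lo: "vol (A \<inter> \<Omega>) \<le> m" and hi: "m \<le> vol ((A \<union> cube x s) \<inter> \<Omega>)"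
  obtains \<sigma> where "0 \<le> \<sigma>" "\<sigma> \<le> s" "vol ((A \<union> cube x \<sigma>) \<inter> \<Omega>) = m"
proof -
  note [simp] = sets.Int sets.Un sets.Diff bounded_Diff_left bounded_Int_left bounded_cube
  define V where "V = (\<lambda>\<sigma>. vol ((A \<union> cube x \<sigma>) \<inter> \<Omega>))"
  have [simp, measurable]: "A \<in> sets borel" "\<Omega> \<in> sets borel" and b [simp]: "bounded A" "bounded \<Omega>"
    using A \<Omega> by (auto simp: borel_compact compact_imp_bounded)
  have f: "(A \<union> cube x \<sigma>) \<inter> \<Omega> \<in> fmeasurable lborel" for \<sigma>
  proof (rule bounded_borel_fmeasurable)
    have [measurable]: "cube x \<sigma> \<in> sets borel" by simp
    show "(A \<union> cube x \<sigma>) \<inter> \<Omega> \<in> sets borel" by measurable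
    show "bounded ((A \<union> cube x \<sigma>) \<inter> \<Omega>)" using b by (simp add: bounded_Int)
  qed
  have fc: "cube x \<sigma> \<in> fmeasurable lborel" for \<sigma> by (rule bounded_borel_fmeasurable) (auto simp: bounded_cube)
  have sub: "cube x \<sigma> \<subseteq> cube x \<tau>" if "\<sigma> \<le> \<tau>" for \<sigma> \<tau> using that by (force simp: mem_cube)
  have "continuous_on {0..s} V"
  proof (rule continuous_on_dominated_increments)
    show "continuous_on {0..s} (\<lambda>\<sigma>. (2 * \<sigma>) ^ DIM('a))" by (intro continuous_intros)
    fix \<sigma> \<tau> assume st: "\<sigma> \<in> {0..s}" "\<tau> \<in> {0..s}" "\<sigma> \<le> \<tau>"
    have "V \<sigma> \<le> V \<tau>" unfolding V_def using sub[OF st(3)] f by (intro measure_mono_fmeasurable) auto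
    moreover have "V \<tau> \<le> V \<sigma> + vol (cube x \<tau> - cube x \<sigma>)"
    proof -
      have "V \<tau> \<le> vol (((A \<union> cube x \<sigma>) \<inter> \<Omega>) \<union> (cube x \<tau> - cube x \<sigma>))"
        unfolding V_def using f fc by (intro measure_mono_fmeasurable) auto
      also have "\<dots> \<le> V \<sigma> + vol (cube x \<tau> - cube x \<sigma>)"
        unfolding V_def by (rule measure_Un_le) auto
      finally show ?thesis .
    qed
    moreover have "vol (cube x \<tau> - cube x \<sigma>) = (2 * \<tau>) ^ DIM('a) - (2 * \<sigma>) ^ DIM('a)"
      using measurable_measure_Diff[OF fc _ sub[OF st(3)]] st by (simp add: measure_cube)
    ultimately show "V \<sigma> \<le> V \<tau> \<and> V \<tau> - V \<sigma> \<le> (2 * \<tau>) ^ DIM('a) - (2 * \<sigma>) ^ DIM('a)" by linarith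
  qed
  moreover have "V 0 \<le> m"
  proof -
    have "V 0 \<le> vol ((A \<inter> \<Omega>) \<union> cube x 0)"
      unfolding V_def using fc by (intro measure_mono_fmeasurable) (auto intro!: fmeasurable.Un bounded_borel_fmeasurable)
    also have "\<dots> \<le> vol (A \<inter> \<Omega>) + vol (cube x 0)" by (rule measure_Un_le) auto
    also have "vol (cube x 0) = 0" by (simp add: measure_cube)
    finally show ?thesis using lo by simp
  qed
  moreover have "m \<le> V s" using hi by (simp add: V_def)
  ultimately obtain \<sigma> where "0 \<le> \<sigma>" "\<sigma> \<le> s" "V \<sigma> = m" using IVT'[of V 0 m s] s by blast
  then show thesis using that by (simp add: V_def)
qed

text \<open>Removing the cube \<open>Q\<close> from \<open>E\<close> costs volume \<open>v2\<close>,
  which outweighs the volume error of the level set. The cube around \<open>x1\<close> adds back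
  more than was removed, since it meets the complement of \<open>E\<close> in \<Omega> in volume
  \<open>v1 \<ge> 2 * v2\<close>. Only then is the set cut with \<Omega>.\<close>

lemma compact_isoperimetric_approximation:
  fixes U E :: "'a::euclidean_space set"
  assumes d2: "DIM('a) \<ge> 2" and U: "open U" "bounded U" "smooth_boundary U"
    and E: "E \<in> sets borel" "E \<subseteq> closure U" and m: "vol E = m" "0 < m" "m < vol (closure U)"
    and P: "perimeter E \<le> ennreal p" "0 \<le> p" and "\<epsilon> > 0"
  shows "\<exists>A. compact A \<and> A \<subseteq> closure U \<and> vol A = m \<and> perimeter A \<le> ennreal (p + \<epsilon>)"
proof -
  note [simp] = sets.Int sets.Un sets.Diff bounded_Diff_left bounded_Int_left bounded_cube
  define \<Omega> where "\<Omega> = closure U"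
  \<comment> \<open>Six shares: two for removing \<open>Q\<close>, one for the level set, one for
    the added cube, two for the cut with \<Omega>.\<close>
  define e where "e = \<epsilon> / 6"
  have e: "e > 0" using \<open>\<epsilon> > 0\<close> by (simp add: e_def)
  have c\<Omega>: "compact \<Omega>" using U(2) by (simp add: \<Omega>_def)
  then have [simp]: "\<Omega> \<in> sets borel" "bounded \<Omega>" by (auto simp: borel_compact compact_imp_bounded)
  have [simp]: "E \<in> sets borel" "bounded E" using E bounded_subset[OF \<open>bounded \<Omega>\<close>] by (auto simp: \<Omega>_def)
  note f = bounded_borel_fmeasurable
  have "perimeter \<Omega> < \<infinity>" unfolding \<Omega>_def by (rule perimeter_smooth_domain_finite[OF U])
  then obtain q where q: "perimeter \<Omega> = ennreal q" "0 \<le> q" by (cases "perimeter \<Omega>") auto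
  obtain \<delta> where \<delta>: "\<delta> > 0" and cut: "\<And>A C a. A \<in> sets borel \<Longrightarrow> bounded A \<Longrightarrow> perimeter A \<le> ennreal a \<Longrightarrow> 0 \<le> a \<Longrightarrow>
      C \<in> sets borel \<Longrightarrow> bounded C \<Longrightarrow> perimeter C \<le> ennreal (q + e) \<Longrightarrow>
      vol (((A \<union> C) - \<Omega>) \<union> (\<Omega> - (A \<union> C))) \<le> \<delta> \<Longrightarrow> perimeter (A \<inter> C) \<le> ennreal (a + 2 * e)"
    by (rule perimeter_Int_le[OF _ _ q e]) auto
  obtain R where R: "\<And>x. x \<in> \<Omega> \<Longrightarrow> norm x \<le> R" using \<open>bounded \<Omega>\<close> unfolding bounded_iff by blast
  \<comment> \<open>A bounded substitute for the whole space, so that the complement of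
    \<open>Q\<close> can enter submodularity as \<open>B - Q\<close>. The margin 1 leaves room for
    cubes centred in \<Omega>.\<close>
  define B where "B = (cube 0 (\<bar>R\<bar> + 1) :: 'a set)"
  have [simp]: "B \<in> sets borel" "bounded B" by (auto simp: B_def bounded_cube)
  have near: "cube x s \<subseteq> B" if "x \<in> \<Omega>" "s \<le> 1" for x s
  proof
    fix y assume y: "y \<in> cube x s"
    show "y \<in> B" unfolding B_def mem_cube
    proof
      fix i :: 'a assume i: "i \<in> Basis"
      have "\<bar>x \<bullet> i\<bar> \<le> R" using Basis_le_norm[OF i, of x] R[OF that(1)] by linarith
      moreover have "\<bar>(y - x) \<bullet> i\<bar> \<le> s" using y i by (simp add: mem_cube)
      ultimately show "\<bar>(y - 0) \<bullet> i\<bar> \<le> \<bar>R\<bar> + 1" using that(2) by (simp add: inner_diff_left)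
    qed
  qed
  have "perimeter B \<le> ennreal (real DIM('a) * (2 * (2 * (\<bar>R\<bar> + 1)) ^ (DIM('a) - 1)))"
    unfolding B_def by (rule perimeter_cube_le) simp
  then have "perimeter B < \<infinity>" by (rule le_less_trans) simp
  then obtain b where b: "perimeter B = ennreal b" "0 \<le> b" by (cases "perimeter B") auto
  obtain \<delta>B where \<delta>B: "\<delta>B > 0" and cutB: "\<And>A C a. A \<in> sets borel \<Longrightarrow> bounded A \<Longrightarrow> perimeter A \<le> ennreal a \<Longrightarrow> 0 \<le> a \<Longrightarrow>
      C \<in> sets borel \<Longrightarrow> bounded C \<Longrightarrow> perimeter C \<le> ennreal (b + e) \<Longrightarrow>
      vol (((A \<union> C) - B) \<union> (B - (A \<union> C))) \<le> \<delta>B \<Longrightarrow> perimeter (A \<inter> C) \<le> ennreal (a + 2 * e)"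
    by (rule perimeter_Int_le[OF _ _ b e]) auto
  \<comment> \<open>The cube added around \<open>x1\<close> may stick out of \<Omega>. Half of
    \<delta> is reserved for this, the other half for the level set.\<close>
  obtain s1 where s1: "0 < s1" "s1 \<le> 1" and Q1: "\<And>(x::'a) s. 0 \<le> s \<Longrightarrow> s \<le> s1 \<Longrightarrow> perimeter (cube x s) \<le> ennreal (min e (\<delta> / 2))"
    "\<And>(x::'a) s. 0 \<le> s \<Longrightarrow> s \<le> s1 \<Longrightarrow> vol (cube x s) \<le> min e (\<delta> / 2)"
    by (rule small_cubes[OF d2, of "min e (\<delta> / 2)"]) (use e \<delta> in auto)
  have E\<Omega>: "E \<subseteq> \<Omega>" using E(2) by (simp add: \<Omega>_def)
  have "vol (\<Omega> - E) = vol \<Omega> - m"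
    using measurable_measure_Diff[of \<Omega> lborel E] E\<Omega> f[of \<Omega>] m(1) by simp
  then have "0 < vol (\<Omega> - E)" using m(3) by (simp add: \<Omega>_def)
  moreover have "\<Omega> - E \<in> sets borel" "bounded (\<Omega> - E)" by (auto intro: bounded_subset[OF \<open>bounded \<Omega>\<close>])
  ultimately obtain x1 where v1: "0 < vol ((\<Omega> - E) \<inter> cube x1 s1)"
    using positive_measure_meets_cube[OF _ _ _ s1(1), of "\<Omega> - E"] by blast
  define v1 where "v1 = vol ((\<Omega> - E) \<inter> cube x1 s1)"
  \<comment> \<open>Chosen after \<open>v1\<close>: the removed volume must not exceed half of what
    the added cube can supply.\<close>
  obtain s2 where s2: "0 < s2" "s2 \<le> 1" and Q2: "\<And>(x::'a) s. 0 \<le> s \<Longrightarrow> s \<le> s2 \<Longrightarrow> perimeter (cube x s) \<le> ennreal (min e (min \<delta>B (v1 / 2)))"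
    "\<And>(x::'a) s. 0 \<le> s \<Longrightarrow> s \<le> s2 \<Longrightarrow> vol (cube x s) \<le> min e (min \<delta>B (v1 / 2))"
    by (rule small_cubes[OF d2, of "min e (min \<delta>B (v1 / 2))"]) (use e \<delta>B v1 in \<open>auto simp: v1_def\<close>)
  obtain x2 where x2: "x2 \<in> closure E" and v2: "0 < vol (E \<inter> cube x2 s2)"
    using positive_measure_meets_cube[OF \<open>E \<in> sets borel\<close> \<open>bounded E\<close> _ s2(1)] m(1,2) by blast
  have x2\<Omega>: "x2 \<in> \<Omega>" using x2 closure_minimal[OF E(2) closed_closure] by (auto simp: \<Omega>_def)
  define Q where "Q = cube x2 s2"
  define v2 where "v2 = vol (E \<inter> Q)"
  have [simp]: "Q \<in> sets borel" "bounded Q" by (auto simp: Q_def bounded_cube)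
  have mQ: "vol Q \<le> \<delta>B" "vol Q \<le> v1 / 2"
    using Q2(2)[of s2 x2] s2(1) by (auto simp: Q_def)
  have pQ: "perimeter Q \<le> ennreal e"
    using Q2(1)[of s2 x2] s2(1) unfolding Q_def by (meson ennreal_leI less_imp_le min.cobounded1 order_refl order_trans)
  have v2v1: "v2 \<le> v1 / 2"
  proof -
    have "v2 \<le> vol Q" unfolding v2_def by (intro measure_mono_fmeasurable f) auto
    then show ?thesis using mQ by linarith
  qed
  define E1 where "E1 = E - Q"
  have [simp]: "E1 \<in> sets borel" "bounded E1" using bounded_subset[OF \<open>bounded E\<close>] by (auto simp: E1_def)
  have mE1: "vol E1 = m - v2"
  proof -
    have "E1 = E - (E \<inter> Q)" by (auto simp: E1_def)
    then show ?thesis using measurable_measure_Diff[of E lborel "E \<inter> Q"] f[of E] m(1) by (simp add: v2_def)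
  qed
  have QB: "Q \<subseteq> B" unfolding Q_def by (rule near[OF x2\<Omega> s2(2)])
  have EB: "E \<subseteq> B"
  proof
    fix x assume "x \<in> E"
    then have "x \<in> \<Omega>" using E\<Omega> by blast
    moreover have "x \<in> cube x 0" by (simp add: mem_cube)
    ultimately show "x \<in> B" using near[of x 0] by auto
  qed
  \<comment> \<open>The set \<open>E\<close> united with \<open>B - Q\<close> misses at most
    \<open>Q\<close> of \<open>B\<close>, so cutting \<open>E\<close> with \<open>B - Q\<close> is
    almost free by lower semicontinuity at \<open>B\<close>.\<close>
  have pE1: "perimeter E1 \<le> ennreal (p + 2 * e)"
  proof -
    have "perimeter (E \<inter> (B - Q)) \<le> ennreal (p + 2 * e)"
    proof (rule cutB)
      show "perimeter (B - Q) \<le> ennreal (b + e)"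
        using b e QB pQ by (intro perimeter_Diff_subset_le) auto
      have "(E \<union> (B - Q)) - B \<union> (B - (E \<union> (B - Q))) \<subseteq> Q" using EB by auto
      then have "vol ((E \<union> (B - Q)) - B \<union> (B - (E \<union> (B - Q)))) \<le> vol Q"
        by (rule measure_mono_fmeasurable) (auto intro: f)
      then show "vol ((E \<union> (B - Q)) - B \<union> (B - (E \<union> (B - Q)))) \<le> \<delta>B" using mQ by linarith
    qed (use P bounded_subset[OF \<open>bounded B\<close>] in auto)
    moreover have "E \<inter> (B - Q) = E1" using EB by (auto simp: E1_def)
    ultimately show ?thesis by simp
  qed
  \<comment> \<open>The first bound keeps the level set below volume \<open>m\<close>. The second
    keeps the set with the full cube above it: \<open>m - v2 + v1 - \<eta> \<ge> m + v1 / 4\<close>.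
    The third is the half of \<delta> left for the cut with \<Omega>.\<close>
  define \<eta> where "\<eta> = min (v2 / 2) (min (v1 / 4) (\<delta> / 2))"
  have \<eta>: "\<eta> > 0" "\<eta> \<le> v2 / 2" "\<eta> \<le> v1 / 4" "\<eta> \<le> \<delta> / 2"
    using v1 v2 \<delta> by (auto simp: \<eta>_def v1_def v2_def Q_def)
  obtain A where A: "compact A" "perimeter A \<le> ennreal (p + 3 * e)" "vol ((A - E1) \<union> (E1 - A)) \<le> \<eta>"
    by (rule coarea_level_set[OF \<open>E1 \<in> sets borel\<close> \<open>bounded E1\<close> pE1 _ _ \<eta>(1), of "p + 3 * e"]) (use P(2) e in auto)
  have [simp]: "A \<in> sets borel" "bounded A" using A(1) by (auto simp: borel_compact compact_imp_bounded)
  let ?D = "(A - E1) \<union> (E1 - A)"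
  have [simp]: "?D \<in> fmeasurable lborel"
    by (rule f) (auto intro: bounded_subset[OF bounded_Un[THEN iffD2, OF conjI[OF \<open>bounded A\<close> \<open>bounded E1\<close>]]])
  have bc [simp]: "bounded (cube x s)" for x :: 'a and s by (rule bounded_cube)
  have lo: "vol (A \<inter> \<Omega>) \<le> m"
  proof -
    have "vol (A \<inter> \<Omega>) \<le> vol (E1 \<union> ?D)"
      by (rule measure_mono_fmeasurable) (auto intro!: fmeasurable.Un f)
    also have "\<dots> \<le> vol E1 + vol ?D" by (rule measure_Un_le) auto
    finally show ?thesis using mE1 A(3) \<eta> by linarith
  qed
  have hi: "m \<le> vol ((A \<union> cube x1 s1) \<inter> \<Omega>)"
  proof -
    let ?W = "(\<Omega> - E) \<inter> cube x1 s1"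
    have "vol E1 + v1 = vol (E1 \<union> ?W)"
    proof -
      have "E1 \<in> fmeasurable lborel" "?W \<in> fmeasurable lborel" by (auto intro!: f)
      moreover have "E1 \<inter> ?W = {}" by (auto simp: E1_def)
      ultimately show ?thesis by (simp add: measure_Un3 v1_def)
    qed
    also have "\<dots> \<le> vol (((A \<union> cube x1 s1) \<inter> \<Omega>) \<union> ?D)"
      by (rule measure_mono_fmeasurable) (use E\<Omega> in \<open>auto simp: E1_def intro!: fmeasurable.Un f\<close>)
    also have "\<dots> \<le> vol ((A \<union> cube x1 s1) \<inter> \<Omega>) + vol ?D" by (rule measure_Un_le) auto
    finally show ?thesis using mE1 A(3) \<eta> v2v1 by linarith
  qed
  obtain \<sigma> where \<sigma>: "0 \<le> \<sigma>" "\<sigma> \<le> s1" "vol ((A \<union> cube x1 \<sigma>) \<inter> \<Omega>) = m"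
    by (rule compact_volume_adjustment[OF A(1) c\<Omega> less_imp_le[OF s1(1)] lo hi])
  let ?X = "A \<union> cube x1 \<sigma>"
  have pc: "perimeter (cube x1 \<sigma>) \<le> ennreal e"
    using Q1(1)[OF \<sigma>(1,2), of x1] by (meson ennreal_leI min.cobounded1 order_trans)
  have "perimeter (?X \<inter> \<Omega>) \<le> ennreal ((p + 3 * e + e) + 2 * e)"
  proof (rule cut)
    show "perimeter ?X \<le> ennreal (p + 3 * e + e)"
      by (rule perimeter_Un_le) (use A(2) pc P(2) e in auto)
    show "perimeter \<Omega> \<le> ennreal (q + e)" using q e by (simp add: ennreal_leI)
    have "(?X \<union> \<Omega>) - \<Omega> \<union> (\<Omega> - (?X \<union> \<Omega>)) \<subseteq> ?D \<union> cube x1 \<sigma>" using E\<Omega> by (auto simp: E1_def)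
    then have "vol ((?X \<union> \<Omega>) - \<Omega> \<union> (\<Omega> - (?X \<union> \<Omega>))) \<le> vol (?D \<union> cube x1 \<sigma>)"
      by (rule measure_mono_fmeasurable) (auto intro!: fmeasurable.Un f)
    also have "\<dots> \<le> vol ?D + vol (cube x1 \<sigma>)" by (rule measure_Un_le) auto
    also have "\<dots> \<le> \<delta>" using A(3) \<eta>(4) Q1(2)[OF \<sigma>(1,2), of x1] by linarith
    finally show "vol ((?X \<union> \<Omega>) - \<Omega> \<union> (\<Omega> - (?X \<union> \<Omega>))) \<le> \<delta>" .
  qed (use P(2) e in auto)
  moreover have "(p + 3 * e + e) + 2 * e = p + \<epsilon>" by (simp add: e_def)
  ultimately have "perimeter (?X \<inter> \<Omega>) \<le> ennreal (p + \<epsilon>)" by (simp only:)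
  moreover have "compact (?X \<inter> \<Omega>)" using A(1) c\<Omega> compact_cube by (intro compact_Int compact_Un)
  ultimately show ?thesis using \<sigma>(3) unfolding \<Omega>_def by (intro exI[of _ "?X \<inter> closure U"] conjI) simp_all
qed

section \<open>Riesz energies\<close>

lemma measurable_riesz_kernel [measurable (raw)]:
  assumes [measurable]: "f \<in> borel_measurable M" "g \<in> borel_measurable M"
  shows "(\<lambda>z. riesz_kernel \<alpha> (f z) (g z :: 'a::euclidean_space)) \<in> borel_measurable M"
  unfolding riesz_kernel_def by measurable

lemma riesz_kernel_diagonal: "0 < \<alpha> \<Longrightarrow> riesz_kernel \<alpha> x x = top"
  unfolding riesz_kernel_def by simp

lemma riesz_kernel_eq: "x \<noteq> y \<Longrightarrow> riesz_kernel \<alpha> x y = ennreal (norm (x - y) powr - \<alpha>)"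
  unfolding riesz_kernel_def
  by (simp add: powr_minus divide_ennreal[of 1, simplified] inverse_eq_divide)

lemma riesz_kernel_le:
  assumes "0 \<le> \<alpha>" "0 < r" "r \<le> norm (x - y)"
  shows "riesz_kernel \<alpha> x y \<le> ennreal (r powr - \<alpha>)"
proof -
  have "x \<noteq> y" using assms by auto
  then show ?thesis using assms by (simp add: riesz_kernel_eq ennreal_leI powr_mono2')
qed

lemma riesz_kernel_ge:
  assumes "0 < \<alpha>" "0 < r" "norm (x - y) \<le> r"
  shows "ennreal (r powr - \<alpha>) \<le> riesz_kernel \<alpha> x y"
proof (cases "x = y")
  case False
  then show ?thesis using assms by (simp add: riesz_kernel_eq ennreal_leI powr_mono2')
qed (simp add: riesz_kernel_diagonal assms(1))

text \<open>Homogeneity of degree \<open>- \<alpha>\<close>; on the diagonal both sides are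
  infinite.\<close>

lemma riesz_kernel_scale:
  assumes "0 < \<alpha>" "0 < s"
  shows "riesz_kernel \<alpha> w (p + s *\<^sub>R v) = ennreal (s powr - \<alpha>) * riesz_kernel \<alpha> ((1 / s) *\<^sub>R (w - p)) v"
proof -
  have eq: "w - (p + s *\<^sub>R v) = s *\<^sub>R ((1 / s) *\<^sub>R (w - p) - v)"
    using assms(2) by (simp add: scaleR_diff_right)
  show ?thesis
  proof (cases "(1 / s) *\<^sub>R (w - p) = v")
    case True
    then have "w = p + s *\<^sub>R v" using eq by simp
    then show ?thesis using True assms by (simp add: riesz_kernel_diagonal ennreal_mult_top)
  next
    case False
    then have "w \<noteq> p + s *\<^sub>R v" using eq assms(2) by auto
    moreover have "norm (w - (p + s *\<^sub>R v)) = s * norm ((1 / s) *\<^sub>R (w - p) - v)"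
      unfolding eq using assms(2) by simp
    ultimately show ?thesis using False assms by (simp add: riesz_kernel_eq powr_mult ennreal_mult)
  qed
qed

abbreviation self_energy :: "real \<Rightarrow> 'a::euclidean_space measure \<Rightarrow> ennreal" where
  "self_energy \<alpha> \<mu> \<equiv> \<integral>\<^sup>+ x. (\<integral>\<^sup>+ y. riesz_kernel \<alpha> x y \<partial>\<mu>) \<partial>\<mu>"

text \<open>An admissible \<mu> is prescribed on \<open>E\<close> only and may have infinite mass
  elsewhere. Restriction makes it a probability measure, for which Fubini is available, without
  raising the energy.\<close>

lemma riesz_restrict:
  fixes \<mu> :: "'a::euclidean_space measure"
  assumes s: "sets \<mu> = sets borel" and E: "E \<in> sets borel" "emeasure \<mu> E = 1"
  obtains \<mu>' where "sets \<mu>' = sets borel" "emeasure \<mu>' UNIV = 1" "\<And>A. A \<in> sets borel \<Longrightarrow> emeasure \<mu>' A = emeasure \<mu> (E \<inter> A)"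
    "self_energy \<alpha> \<mu>' \<le> self_energy \<alpha> \<mu>"
proof -
  define \<mu>' where "\<mu>' = density \<mu> (indicator E)"
  have [measurable_cong]: "sets \<mu> = sets borel" by (rule s)
  have [measurable]: "E \<in> sets borel" by (rule E)
  have s': "sets \<mu>' = sets borel" by (simp add: \<mu>'_def s)
  have e: "emeasure \<mu>' A = emeasure \<mu> (E \<inter> A)" if [measurable]: "A \<in> sets borel" for A
  proof -
    have "emeasure \<mu>' A = (\<integral>\<^sup>+x. indicator E x * indicator A x \<partial>\<mu>)"
      unfolding \<mu>'_def by (rule emeasure_density) (auto simp: s that)
    also have "\<dots> = (\<integral>\<^sup>+x. indicator (E \<inter> A) x \<partial>\<mu>)"
      by (intro nn_integral_cong) (auto simp: indicator_def)
    also have "\<dots> = emeasure \<mu> (E \<inter> A)" by (rule nn_integral_indicator) (simp add: s)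
    finally show ?thesis .
  qed
  have u: "emeasure \<mu>' UNIV = 1" using e[of UNIV] E by simp
  have sp: "space \<mu>' = UNIV" using sets_eq_imp_space_eq[OF s'] by simp
  interpret finite_measure \<mu>' by (rule finite_measureI) (simp add: sp u)
  have [measurable_cong]: "sets \<mu>' = sets borel" by (rule s')
  \<comment> \<open>The potential is formed with the finite measure \<open>\<mu>'\<close>, which
    makes it measurable; only then is the outer integral rewritten over \<mu>.\<close>
  define g where "g = (\<lambda>x. \<integral>\<^sup>+ y. riesz_kernel \<alpha> x y \<partial>\<mu>')"
  have [measurable]: "g \<in> borel_measurable borel" unfolding g_def by measurable
  have inner: "g x \<le> (\<integral>\<^sup>+ y. riesz_kernel \<alpha> x y \<partial>\<mu>)" for x
  proof -
    have "g x = (\<integral>\<^sup>+ y. indicator E y * riesz_kernel \<alpha> x y \<partial>\<mu>)"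
      unfolding g_def \<mu>'_def by (rule nn_integral_density) measurable
    also have "\<dots> \<le> (\<integral>\<^sup>+ y. riesz_kernel \<alpha> x y \<partial>\<mu>)"
      by (intro nn_integral_mono) (auto simp: indicator_def)
    finally show ?thesis .
  qed
  have "(\<integral>\<^sup>+ x. g x \<partial>\<mu>') = (\<integral>\<^sup>+ x. indicator E x * g x \<partial>\<mu>)"
    unfolding \<mu>'_def by (rule nn_integral_density) measurable
  also have "\<dots> \<le> self_energy \<alpha> \<mu>"
    by (intro nn_integral_mono) (auto simp: indicator_def inner)
  finally show thesis using that[OF s' u e] unfolding g_def by blast
qed

text \<open>A measure with mass 1 on \<open>F\<close> may charge the rest of \<open>E\<close> too
  and then is no competitor for \<open>E\<close>; its restriction to \<open>F\<close> is
  one.\<close>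

lemma riesz_energy_antimono:
  assumes "F \<subseteq> E" "F \<in> sets borel" "E \<in> sets borel"
  shows "riesz_energy \<alpha> E \<le> riesz_energy \<alpha> F"
  unfolding riesz_energy_def
proof (rule INF_greatest)
  fix \<mu> :: "'a measure"
  assume "\<mu> \<in> {\<mu>. sets \<mu> = sets borel \<and> emeasure \<mu> F = 1}"
  then have s: "sets \<mu> = sets borel" and F: "emeasure \<mu> F = 1" by auto
  from riesz_restrict[OF s assms(2) F, of \<alpha>] obtain \<mu>' where \<mu>': "sets \<mu>' = sets borel"
    "\<And>A. A \<in> sets borel \<Longrightarrow> emeasure \<mu>' A = emeasure \<mu> (F \<inter> A)"
    "self_energy \<alpha> \<mu>' \<le> self_energy \<alpha> \<mu>"
    by metis
  have "emeasure \<mu>' E = 1" using \<mu>'(2)[OF assms(3)] assms(1) F by (simp add: Int_absorb2)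
  then show "(INF \<mu>\<in>{\<mu>. sets \<mu> = sets borel \<and> emeasure \<mu> E = 1}.
        \<integral>\<^sup>+ x. (\<integral>\<^sup>+ y. riesz_kernel \<alpha> x y \<partial>\<mu>) \<partial>\<mu>) \<le> self_energy \<alpha> \<mu>"
    using \<mu>'(1,3) by (intro INF_lower2[of \<mu>']) auto
qed

text \<open>At a distance between \<open>(1 / 2) ^ Suc k\<close> and \<open>(1 / 2) ^ k\<close> the
  term with index \<open>k\<close> alone dominates the kernel. Beyond distance 1 the summand 1 does,
  and on the diagonal the series diverges. Potentials are thereby reduced to masses of
  balls.\<close>

lemma riesz_kernel_dyadic:
  assumes "0 < \<alpha>"
  shows "riesz_kernel \<alpha> w v \<le> 1 + (\<Sum>k. ennreal ((2 powr \<alpha>) ^ Suc k) * indicator {x. norm (w - x) \<le> (1 / 2) ^ k} v)"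
    (is "_ \<le> 1 + (\<Sum>k. ?f k)")
proof -
  let ?t = "norm (w - v)"
  consider "?t = 0" | "0 < ?t" "?t \<le> 1" | "1 < ?t" by (cases "w = v") force+
  then show ?thesis
  proof cases
    case 1
    have ge1: "1 \<le> ?f k" for k
    proof -
      have "1 \<le> (2 powr \<alpha>) ^ Suc k" using assms by (intro one_le_power) (simp add: ge_one_powr_ge_zero)
      then have "ennreal 1 \<le> ennreal ((2 powr \<alpha>) ^ Suc k)" by (rule ennreal_leI)
      then show ?thesis using 1 by simp
    qed
    have "of_nat n \<le> (\<Sum>k. ?f k)" for n
    proof -
      have "of_nat n = (\<Sum>k<n. (1::ennreal))" by simp
      also have "\<dots> \<le> (\<Sum>k<n. ?f k)" by (intro sum_mono ge1)
      also have "\<dots> \<le> (\<Sum>k. ?f k)" by (intro sum_le_suminf) auto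
      finally show ?thesis .
    qed
    then have "(\<Sum>k. ?f k) = top"
      using ennreal_Ex_less_of_nat[of "\<Sum>k. ?f k"] by (meson not_le top.not_eq_extremum)
    then show ?thesis by simp
  next
    case 2
    define n where "n = (LEAST n. (1 / 2) ^ n < ?t)"
    have ex: "\<exists>n. (1 / 2) ^ n < ?t" using real_arch_pow_inv[OF 2(1), of "1 / 2"] by simp
    have n: "(1 / 2) ^ n < ?t" unfolding n_def using ex by (rule LeastI_ex)
    then have "n \<noteq> 0" using 2(2) by (cases "n = 0") auto
    then obtain k where k: "n = Suc k" using not0_implies_Suc by blast
    have k2: "?t \<le> (1 / 2) ^ k"
      using not_less_Least[of k "\<lambda>n. (1 / 2) ^ n < ?t"] k unfolding n_def by (simp add: not_less)
    have "riesz_kernel \<alpha> w v \<le> ennreal (((1 / 2) ^ n) powr - \<alpha>)"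
      using n assms by (intro riesz_kernel_le) auto
    also have "((1 / 2) ^ n) powr - \<alpha> = (2 powr \<alpha>) ^ n" for n :: nat
    proof -
      have "((1 / 2) ^ n) powr - \<alpha> = (2 ^ n) powr \<alpha>"
        by (simp add: powr_minus power_one_over inverse_eq_divide powr_divide)
      also have "\<dots> = (2 powr real n) powr \<alpha>" by (simp add: powr_realpow)
      also have "\<dots> = (2 powr \<alpha>) powr real n" by (simp add: powr_powr mult.commute)
      also have "\<dots> = (2 powr \<alpha>) ^ n" by (simp add: powr_realpow)
      finally show ?thesis .
    qed
    also have "ennreal ((2 powr \<alpha>) ^ n) \<le> ?f k" using k k2 by simp
    also have "?f k \<le> (\<Sum>k. ?f k)"
    proof -
      have "g k \<le> (\<Sum>k. g k)" for g :: "nat \<Rightarrow> ennreal" using sum_le_suminf[of g "{k}"] by simp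
      then show ?thesis .
    qed
    finally show ?thesis by (simp add: add_increasing)
  next
    case 3
    have "riesz_kernel \<alpha> w v \<le> ennreal (1 powr - \<alpha>)" using 3 assms by (intro riesz_kernel_le) auto
    then show ?thesis by (simp add: add_increasing2)
  qed
qed

section \<open>Charging hyperplane pieces\<close>

text \<open>The image of the uniform measure on a cube is the uniform measure on a piece of a
  hyperplane, so integrals over the piece are computed on the cube.\<close>

definition flatten :: "'a \<Rightarrow> 'a::euclidean_space \<Rightarrow> 'a" where
  "flatten b y = y - (y \<bullet> b) *\<^sub>R b"

lemma continuous_flatten: "continuous_on S (flatten b)"
  unfolding flatten_def by (intro continuous_intros)

lemma measurable_flatten [measurable]: "flatten b \<in> borel_measurable borel"
  by (intro borel_measurable_continuous_onI continuous_flatten)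

lemma flatten_inner: "b \<in> Basis \<Longrightarrow> i \<in> Basis \<Longrightarrow> flatten b y \<bullet> i = (if i = b then 0 else y \<bullet> i)"
  by (simp add: flatten_def inner_diff_left inner_Basis)

lemma norm_flatten_cube:
  fixes y :: "'a::euclidean_space"
  assumes "b \<in> Basis" "y \<in> cube 0 (1 / real DIM('a))"
  shows "norm (flatten b y) \<le> 1"
proof -
  have "norm (flatten b y) \<le> (\<Sum>i\<in>Basis. \<bar>flatten b y \<bullet> i\<bar>)" by (rule norm_le_l1)
  also have "\<dots> \<le> (\<Sum>i\<in>(Basis::'a set). 1 / real DIM('a))"
    using assms by (intro sum_mono) (auto simp: flatten_inner mem_cube)
  finally show ?thesis by simp
qed

definition cube_measure :: "real \<Rightarrow> 'a::euclidean_space measure" where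
  "cube_measure a = uniform_measure lborel (cube 0 a)"

lemma cube_measure_basic:
  assumes "0 < a"
  shows "sets (cube_measure a :: 'a::euclidean_space measure) = sets borel"
    and "space (cube_measure a :: 'a::euclidean_space measure) = UNIV"
    and "emeasure (cube_measure a) (UNIV :: 'a::euclidean_space set) = 1"
    and "emeasure (cube_measure a) (cube 0 a :: 'a::euclidean_space set) = 1"
    and "AE y::'a::euclidean_space in cube_measure a. y \<in> cube 0 a"
proof -
  have e: "emeasure lborel (cube 0 a :: 'a set) = ennreal ((2 * a) ^ DIM('a))"
    using measure_cube[of a "0::'a"] emeasure_bounded_finite[OF bounded_cube[of "0::'a" a]] assms
    by (simp add: emeasure_eq_ennreal_measure)
  have e0: "emeasure lborel (cube 0 a :: 'a set) \<noteq> 0" unfolding e using assms by simp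
  have ei: "emeasure lborel (cube 0 a :: 'a set) \<noteq> \<infinity>" unfolding e by simp
  show "sets (cube_measure a :: 'a measure) = sets borel" "space (cube_measure a :: 'a measure) = UNIV"
    by (simp_all add: cube_measure_def)
  show "emeasure (cube_measure a) (cube 0 a :: 'a set) = 1"
    unfolding cube_measure_def using e0 ei by (rule emeasure_uniform_measure_1)
  show "emeasure (cube_measure a) (UNIV :: 'a set) = 1"
    unfolding cube_measure_def using e0 ei
    by (subst emeasure_uniform_measure) (auto simp: ennreal_divide_self less_top[symmetric])
  show "AE y::'a in cube_measure a. y \<in> cube 0 a"
    unfolding cube_measure_def by (rule AE_uniform_measureI) auto
qed

text \<open>Growth of order \<open>d - 1\<close>: the points of the cube that flatten into a ball of
  radius \<rho> lie in a box of length \<open>2 * a\<close> along \<open>b\<close> and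
  \<open>2 * \<rho>\<close> in all other directions.\<close>

lemma cube_measure_slab:
  fixes w :: "'a::euclidean_space"
  assumes "0 < a" "b \<in> Basis" "0 \<le> \<rho>"
  shows "emeasure (cube_measure a) {y. norm (w - flatten b y) \<le> \<rho>} \<le> ennreal ((\<rho> / a) ^ (DIM('a) - 1))"
proof -
  \<comment> \<open>The multiples of \<open>b\<close> are tuned so that the coordinates along
    \<open>b\<close> become \<open>- a\<close> and \<open>a\<close>.\<close>
  let ?l = "w - \<rho> *\<^sub>R One + (\<rho> - a - w \<bullet> b) *\<^sub>R b" and ?u = "w + \<rho> *\<^sub>R One + (a - \<rho> - w \<bullet> b) *\<^sub>R b"
  let ?A = "{y. norm (w - flatten b y) \<le> \<rho>}"
  have [measurable]: "?A \<in> sets borel" by measurable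
  have sub: "cube 0 a \<inter> ?A \<subseteq> cbox ?l ?u"
  proof
    fix y assume y: "y \<in> cube 0 a \<inter> ?A"
    show "y \<in> cbox ?l ?u" unfolding mem_box
    proof
      fix i :: 'a assume i: "i \<in> Basis"
      have "\<bar>(w - flatten b y) \<bullet> i\<bar> \<le> \<rho>" using Basis_le_norm[OF i, of "w - flatten b y"] y by simp
      moreover have "\<bar>y \<bullet> i\<bar> \<le> a" using y i by (simp add: mem_cube)
      ultimately show "?l \<bullet> i \<le> y \<bullet> i \<and> y \<bullet> i \<le> ?u \<bullet> i"
        using i assms(2) by (auto simp: inner_diff_left inner_add_left flatten_inner inner_Basis split: if_splits)
    qed
  qed
  have m: "vol (cbox ?l ?u) = (2 * a) * (2 * \<rho>) ^ (DIM('a) - 1)"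
    by (rule measure_cbox_slab[OF assms(2)])
      (use assms in \<open>auto simp: inner_diff_left inner_add_left inner_Basis\<close>)
  have ec: "emeasure lborel (cube 0 a :: 'a set) = ennreal ((2 * a) ^ DIM('a))"
    using measure_cube[of a "0::'a"] emeasure_bounded_finite[OF bounded_cube[of "0::'a" a]] assms
    by (simp add: emeasure_eq_ennreal_measure)
  have "emeasure (cube_measure a) ?A = emeasure lborel (cube 0 a \<inter> ?A) / emeasure lborel (cube 0 a :: 'a set)"
    unfolding cube_measure_def by (rule emeasure_uniform_measure) auto
  also have "\<dots> \<le> emeasure lborel (cbox ?l ?u) / emeasure lborel (cube 0 a :: 'a set)"
    by (intro divide_right_mono_ennreal emeasure_mono sub) auto
  also have "\<dots> = ennreal ((2 * a) * (2 * \<rho>) ^ (DIM('a) - 1)) / ennreal ((2 * a) ^ DIM('a))"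
  proof -
    have "emeasure lborel (cbox ?l ?u) = ennreal (vol (cbox ?l ?u))"
      using emeasure_bounded_finite[OF bounded_cbox[of ?l ?u]] by (intro emeasure_eq_ennreal_measure) auto
    then show ?thesis unfolding ec m by (rule arg_cong)
  qed
  also have "\<dots> = ennreal ((2 * a) * (2 * \<rho>) ^ (DIM('a) - 1) / (2 * a) ^ DIM('a))"
    using assms by (intro divide_ennreal) auto
  also have "(2 * a) * (2 * \<rho>) ^ (DIM('a) - 1) / (2 * a) ^ DIM('a) = (\<rho> / a) ^ (DIM('a) - 1)"
  proof -
    obtain n where n: "DIM('a) = Suc n" using DIM_positive[where 'a='a] gr0_implies_Suc by blast
    show ?thesis unfolding n using assms(1) by (simp add: power_divide power_mult_distrib)
  qed
  finally show ?thesis .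
qed

text \<open>In the dyadic sum the kernel grows by \<open>2 powr \<alpha>\<close> per scale while the
  mass shrinks by \<open>(1 / 2) ^ (DIM('a) - 1)\<close>. The product \<open>q\<close> is below 1
  precisely because \<alpha> is less than \<open>d - 1\<close>, and a geometric series
  remains.\<close>

lemma flat_potential_bounded:
  assumes "0 < a" "b \<in> (Basis :: 'a::euclidean_space set)" "0 < \<alpha>" "\<alpha> < real DIM('a) - 1"
  obtains C where "0 < C" "\<And>w. (\<integral>\<^sup>+y. riesz_kernel \<alpha> w (flatten b y) \<partial>cube_measure a) \<le> ennreal C"
proof -
  define A where "A = 2 powr \<alpha>"
  define q where "q = A * (1 / 2) ^ (DIM('a) - 1)"
  have A: "A > 0" by (simp add: A_def)
  have "A < 2 powr (real (DIM('a) - 1))"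
    unfolding A_def using assms(4) DIM_positive[where 'a='a] by (intro powr_less_mono) (auto simp: of_nat_diff Suc_leI)
  then have "A < 2 ^ (DIM('a) - 1)" by (simp only: powr_realpow[OF zero_less_numeral])
  then have q: "0 < q" "q < 1" using A by (auto simp: q_def power_one_over field_simps)
  define K where "K = A * (1 / a) ^ (DIM('a) - 1)"
  have K: "K > 0" using A assms(1) by (simp add: K_def)
  define C where "C = 1 + K * (1 / (1 - q))"
  have [measurable_cong]: "sets (cube_measure a :: 'a measure) = sets borel" by (rule cube_measure_basic(1)[OF assms(1)])
  have bound: "(\<integral>\<^sup>+y. riesz_kernel \<alpha> w (flatten b y) \<partial>cube_measure a) \<le> ennreal C" for w
  proof -
    let ?A = "\<lambda>k::nat. {y. norm (w - flatten b y) \<le> (1 / 2) ^ k}"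
    have [measurable]: "?A k \<in> sets borel" for k by measurable
    have "(\<integral>\<^sup>+y. riesz_kernel \<alpha> w (flatten b y) \<partial>cube_measure a)
       \<le> (\<integral>\<^sup>+y. 1 + (\<Sum>k. ennreal (A ^ Suc k) * indicator (?A k) y) \<partial>cube_measure a)"
    proof (rule nn_integral_mono)
      fix y
      show "riesz_kernel \<alpha> w (flatten b y) \<le> 1 + (\<Sum>k. ennreal (A ^ Suc k) * indicator (?A k) y)"
        using riesz_kernel_dyadic[OF assms(3), of w "flatten b y"] unfolding A_def by (simp add: indicator_def)
    qed
    also have "\<dots> = emeasure (cube_measure a) (UNIV :: 'a set) + (\<Sum>k. ennreal (A ^ Suc k) * emeasure (cube_measure a) (?A k))"
      by (subst nn_integral_add, simp, simp, subst nn_integral_suminf, simp)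
        (simp add: cube_measure_basic[OF assms(1)] nn_integral_cmult_indicator)
    also have "\<dots> \<le> 1 + (\<Sum>k. ennreal (K * q ^ k))"
    proof (rule add_mono)
      show "emeasure (cube_measure a) (UNIV :: 'a set) \<le> 1"
        by (simp add: cube_measure_basic(3)[OF assms(1)])
      show "(\<Sum>k. ennreal (A ^ Suc k) * emeasure (cube_measure a) (?A k)) \<le> (\<Sum>k. ennreal (K * q ^ k))"
      proof (rule suminf_le)
        fix k
        have "ennreal (A ^ Suc k) * emeasure (cube_measure a) (?A k)
            \<le> ennreal (A ^ Suc k) * ennreal (((1 / 2) ^ k / a) ^ (DIM('a) - 1))"
          by (intro mult_left_mono cube_measure_slab[OF assms(1,2)]) auto
        also have "\<dots> = ennreal (A ^ Suc k * ((1 / 2) ^ k / a) ^ (DIM('a) - 1))"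
          using A assms(1) by (intro ennreal_mult[symmetric]) auto
        also have "A ^ Suc k * ((1 / 2) ^ k / a) ^ (DIM('a) - 1) = K * q ^ k"
        proof -
          have 1: "((1 / 2) ^ k / a) ^ N = ((1 / 2 :: real) ^ k) ^ N * (1 / a) ^ N" for N
            by (simp add: power_divide power_mult_distrib)
          have 2: "((1 / 2 :: real) ^ k) ^ N = ((1 / 2) ^ N) ^ k" for N
            by (simp only: power_mult[symmetric] mult.commute)
          show ?thesis unfolding K_def q_def 1 2 power_mult_distrib power_Suc by (simp only: mult_ac)
        qed
        finally show "ennreal (A ^ Suc k) * emeasure (cube_measure a) (?A k) \<le> ennreal (K * q ^ k)" .
      qed auto
    qed
    also have "(\<Sum>k. ennreal (K * q ^ k)) = ennreal (K * (1 / (1 - q)))"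
      using q K by (intro suminf_ennreal_eq sums_mult geometric_sums) auto
    also have "1 + ennreal (K * (1 / (1 - q))) = ennreal C"
      unfolding C_def using K q by (subst ennreal_plus) auto
    finally show ?thesis .
  qed
  have "C > 0" unfolding C_def using K q by (intro add_pos_nonneg) auto
  then show thesis using bound by (rule that)
qed

lemma scaled_flat_potential:
  fixes p w :: "'a::euclidean_space"
  assumes "0 < a" "0 < \<alpha>" "0 < s"
    and C: "\<And>w::'a. (\<integral>\<^sup>+y. riesz_kernel \<alpha> w (flatten b y) \<partial>cube_measure a) \<le> ennreal C"
  shows "(\<integral>\<^sup>+y. riesz_kernel \<alpha> w (p + s *\<^sub>R flatten b y) \<partial>cube_measure a) \<le> ennreal (s powr - \<alpha> * C)"
proof -
  have [measurable_cong]: "sets (cube_measure a :: 'a measure) = sets borel" by (rule cube_measure_basic(1)[OF assms(1)])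
  have "(\<integral>\<^sup>+y. riesz_kernel \<alpha> w (p + s *\<^sub>R flatten b y) \<partial>cube_measure a)
    = ennreal (s powr - \<alpha>) * (\<integral>\<^sup>+y. riesz_kernel \<alpha> ((1 / s) *\<^sub>R (w - p)) (flatten b y) \<partial>cube_measure a)"
    unfolding riesz_kernel_scale[OF assms(2,3)] by (rule nn_integral_cmult) measurable
  also have "\<dots> \<le> ennreal (s powr - \<alpha>) * ennreal C" by (intro mult_left_mono C) auto
  also have "\<dots> = ennreal (s powr - \<alpha> * C)" by (rule ennreal_mult'[symmetric]) simp
  finally show ?thesis .
qed

text \<open>Taking the first centre in a fixed enumeration whose ball contains \<open>x\<close>
  gives a Borel map; off \<open>S\<close> its value is arbitrary.\<close>

lemma measurable_finite_selection:
  fixes S :: "'a::euclidean_space set" and Z :: "'a set" and q :: "'a \<Rightarrow> 'a"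
  assumes "finite Z" "S \<subseteq> (\<Union>z\<in>Z. ball z \<delta>)"
  obtains p where "p \<in> borel_measurable borel" "\<And>x. x \<in> S \<Longrightarrow> \<exists>z\<in>Z. x \<in> ball z \<delta> \<and> p x = q z"
proof -
  obtain zs where zs: "set zs = Z" using finite_list[OF assms(1)] by blast
  define P where "P = (\<lambda>n x. n < length zs \<and> x \<in> ball (zs ! n) \<delta>)"
  define idx where "idx = (\<lambda>x. LEAST n. P n x)"
  have [measurable]: "Measurable.pred borel (P n)" for n
    unfolding P_def mem_ball by measurable
  have "idx \<in> measurable borel (count_space UNIV)" unfolding idx_def by measurable
  then have "(\<lambda>x. q (zs ! idx x)) \<in> borel_measurable borel"
    by (rule measurable_compose) simp
  moreover have "\<exists>z\<in>Z. x \<in> ball z \<delta> \<and> q (zs ! idx x) = q z" if xS: "x \<in> S" for x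
  proof -
    obtain z where z: "z \<in> Z" "x \<in> ball z \<delta>" using assms(2) xS by blast
    then obtain n where "n < length zs" "zs ! n = z" using zs by (metis in_set_conv_nth)
    then have "P n x" using z by (simp add: P_def)
    then have "P (idx x) x" unfolding idx_def by (rule LeastI)
    then have "zs ! idx x \<in> Z" "x \<in> ball (zs ! idx x) \<delta>" using zs by (auto simp: P_def)
    then show ?thesis by blast
  qed
  ultimately show thesis by (rule that)
qed

text \<open>The kernel is infinite on the diagonal, so finite energy makes the diagonal a null set
  of the product measure. The energies of the shrinking neighbourhoods then decrease to
  zero.\<close>

lemma near_diagonal_energy:
  fixes \<mu> :: "'a::euclidean_space measure"
  assumes s: "sets \<mu> = sets borel" and fin: "finite_measure \<mu>" and "0 < \<alpha>"
    and V: "self_energy \<alpha> \<mu> < top" and "0 < \<eta>" "0 < r"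
  obtains n where "(\<integral>\<^sup>+x. \<integral>\<^sup>+y. riesz_kernel \<alpha> x y * indicator {z. dist x z < r / real (Suc n)} y \<partial>\<mu> \<partial>\<mu>) < ennreal \<eta>"
proof -
  interpret finite_measure \<mu> by (rule fin)
  have [measurable_cong]: "sets \<mu> = sets borel" by (rule s)
  have sp: "space \<mu> = UNIV" using sets_eq_imp_space_eq[OF s] by simp
  let ?M = "\<mu> \<Otimes>\<^sub>M \<mu>"
  let ?K = "\<lambda>z :: 'a \<times> 'a. riesz_kernel \<alpha> (fst z) (snd z)"
  let ?D = "\<lambda>n (z :: 'a \<times> 'a). indicator {z. dist (fst z) (snd z) < r / real (Suc n)} z :: ennreal"
  have [measurable]: "?K \<in> borel_measurable ?M" by measurable
  have [measurable]: "{z. dist (fst z) (snd z) < t} \<in> sets ?M" for t :: real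
  proof -
    have "{z \<in> space ?M. dist (fst z) (snd z) < t} \<in> sets ?M" by measurable
    then show ?thesis by (simp add: space_pair_measure sp)
  qed
  have VK: "(\<integral>\<^sup>+z. ?K z \<partial>?M) < top"
    using nn_integral_fst[of ?K \<mu>] V by simp
  have dec: "decseq (\<lambda>n z. ?K z * ?D n z)"
  proof (rule decseq_SucI, rule le_funI)
    fix n and z :: "'a \<times> 'a"
    have "r / real (Suc (Suc n)) \<le> r / real (Suc n)" using \<open>0 < r\<close> by (intro divide_left_mono) auto
    then show "?K z * ?D (Suc n) z \<le> ?K z * ?D n z" by (intro mult_left_mono) (auto simp: indicator_def)
  qed
  have lim: "(INF n. ?K z * ?D n z) = 0" if "?K z \<noteq> top" for z
  proof -
    have "fst z \<noteq> snd z" using that riesz_kernel_diagonal[OF \<open>0 < \<alpha>\<close>] by metis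
    then have "0 < dist (fst z) (snd z) / r" using \<open>0 < r\<close> by simp
    then obtain n where "inverse (real (Suc n)) < dist (fst z) (snd z) / r" using reals_Archimedean by blast
    then have "r / real (Suc n) < dist (fst z) (snd z)" using \<open>0 < r\<close> by (simp add: field_simps)
    then have "?K z * ?D n z = 0" by simp
    moreover have "(INF n. ?K z * ?D n z) \<le> ?K z * ?D n z" by (rule INF_lower) simp
    ultimately have "(INF n. ?K z * ?D n z) \<le> 0" by (simp only:)
    then show ?thesis by (simp only: le_zero_eq)
  qed
  have "(INF n. \<integral>\<^sup>+z. ?K z * ?D n z \<partial>?M) = (\<integral>\<^sup>+z. (INF n. ?K z * ?D n z) \<partial>?M)"
  proof (rule nn_integral_monotone_convergence_INF_decseq[symmetric, OF dec])
    have "(\<integral>\<^sup>+z. ?K z * ?D 0 z \<partial>?M) \<le> (\<integral>\<^sup>+z. ?K z \<partial>?M)"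
      by (intro nn_integral_mono) (auto simp: indicator_def)
    then show "(\<integral>\<^sup>+z. ?K z * ?D 0 z \<partial>?M) < \<infinity>" using VK by simp
  qed measurable
  also have "\<dots> = 0"
  proof -
    have "AE z in ?M. ?K z \<noteq> top"
      using nn_integral_noteq_infinite[of ?K ?M] VK by (simp add: less_top)
    then have "AE z in ?M. (INF n. ?K z * ?D n z) = 0" using lim by auto
    then show ?thesis by (subst nn_integral_0_iff_AE) auto
  qed
  also have "\<dots> < ennreal \<eta>" using \<open>0 < \<eta>\<close> by simp
  finally obtain n where n: "(\<integral>\<^sup>+z. ?K z * ?D n z \<partial>?M) < ennreal \<eta>" by (auto simp: INF_less_iff)
  have "(\<integral>\<^sup>+x. \<integral>\<^sup>+y. riesz_kernel \<alpha> x y * indicator {z. dist x z < r / real (Suc n)} y \<partial>\<mu> \<partial>\<mu>)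
     = (\<integral>\<^sup>+x. \<integral>\<^sup>+y. ?K (x, y) * ?D n (x, y) \<partial>\<mu> \<partial>\<mu>)"
    by (intro nn_integral_cong) (simp add: indicator_def)
  also have "\<dots> = (\<integral>\<^sup>+z. ?K z * ?D n z \<partial>?M)" by (rule nn_integral_fst) measurable
  finally show thesis using n by (intro that[of n]) (simp only:)
qed

text \<open>Charge spread over hyperplane pieces of side comparable to \<open>\<delta>\<close>, placed in \<open>U\<close> near its old
  position: pairs at distance at least \<open>L \<delta>\<close> keep their interaction up to a factor
  \<open>\<theta> powr - \<alpha>\<close>, and the interaction of closer pairs grows by a bounded factor only. The carrier is a
  Lebesgue null set because \<open>\<alpha> < d - 1\<close> permits charging hyperplanes.\<close>

lemma riesz_energy_null_set:
  fixes U :: "'a::euclidean_space set"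
  assumes U: "open U" "bounded U" "smooth_boundary U"
    and \<alpha>: "0 < \<alpha>" "\<alpha> < real DIM('a) - 1"
    and I: "riesz_energy \<alpha> (closure U) < ennreal V" and "0 < \<epsilon>"
  obtains F where "compact F" "F \<subseteq> closure U" "emeasure lborel F = 0" "riesz_energy \<alpha> F \<le> ennreal ((1 + \<epsilon>) * V + \<epsilon>)"
proof -
  obtain \<mu>0 :: "'a measure" where \<mu>0: "sets \<mu>0 = sets borel" "emeasure \<mu>0 (closure U) = 1"
    "self_energy \<alpha> \<mu>0 < ennreal V"
    using I unfolding riesz_energy_def INF_less_iff by blast
  have b\<Omega>: "closure U \<in> sets borel" by simp
  from riesz_restrict[OF \<mu>0(1) b\<Omega> \<mu>0(2), of \<alpha>] obtain \<mu> where \<mu>: "sets \<mu> = sets borel" "emeasure \<mu> UNIV = 1"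
    "\<And>A. A \<in> sets borel \<Longrightarrow> emeasure \<mu> A = emeasure \<mu>0 (closure U \<inter> A)"
    "self_energy \<alpha> \<mu> \<le> self_energy \<alpha> \<mu>0"
    by metis
  have E\<mu>: "self_energy \<alpha> \<mu> < ennreal V" using \<mu>(4) \<mu>0(3) by (rule le_less_trans)
  have V0: "0 < V" using E\<mu> by (cases "0 < V") (auto simp: ennreal_neg not_less)
  have sp\<mu>: "space \<mu> = UNIV" using sets_eq_imp_space_eq[OF \<mu>(1)] by simp
  have fm\<mu>: "finite_measure \<mu>" by (rule finite_measureI) (simp add: sp\<mu> \<mu>(2))
  interpret M: finite_measure \<mu> by (rule fm\<mu>)
  have [measurable_cong]: "sets \<mu> = sets borel" by (rule \<mu>(1))
  have m\<Omega>: "emeasure \<mu> (closure U) = 1" using \<mu>(3)[OF b\<Omega>] \<mu>0(2) by simp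
  have AE\<Omega>: "AE x in \<mu>. x \<in> closure U"
  proof (rule AE_I)
    show "emeasure \<mu> (- closure U) = 0" using \<mu>(3)[of "- closure U"] by simp
    show "- closure U \<in> sets \<mu>" unfolding \<mu>(1) by simp
  qed (auto simp: sp\<mu>)
  obtain c \<delta>\<^sub>0 where c: "0 < c" "c \<le> 1" "0 < \<delta>\<^sub>0"
    and cork: "\<And>x \<delta>. x \<in> closure U \<Longrightarrow> 0 < \<delta> \<Longrightarrow> \<delta> < \<delta>\<^sub>0 \<Longrightarrow> \<exists>p. dist p x \<le> \<delta> \<and> cball p (c * \<delta>) \<subseteq> U"
    using interior_corkscrew[OF U] by blast
  \<comment> \<open>Half the side is chosen so that the flattened cube fits into the unit
    ball.\<close>
  define a where "a = 1 / real DIM('a)"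
  have a: "0 < a" by (simp add: a_def)
  obtain b :: 'a where b: "b \<in> Basis" using nonempty_Basis by blast
  obtain C where C: "0 < C" "\<And>w::'a. (\<integral>\<^sup>+y. riesz_kernel \<alpha> w (flatten b y) \<partial>cube_measure a) \<le> ennreal C"
    using flat_potential_bounded[OF a b \<alpha>] by blast
  define N :: "'a measure" where "N = cube_measure a"
  note Nb = cube_measure_basic[OF a, where 'a='a, folded N_def]
  have [measurable_cong]: "sets N = sets borel" by (rule Nb(1))
  interpret N: finite_measure N by (rule finite_measureI) (simp add: Nb)
  \<comment> \<open>Shrinking a distance by \<theta> raises the kernel exactly by the factor
    \<open>1 + \<epsilon>\<close>.\<close>
  define \<theta> where "\<theta> = (1 + \<epsilon>) powr (- (1 / \<alpha>))"
  have \<theta>: "0 < \<theta>" "\<theta> < 1" "\<theta> powr - \<alpha> = 1 + \<epsilon>"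
  proof -
    show "0 < \<theta>" using \<open>0 < \<epsilon>\<close> by (simp add: \<theta>_def)
    show "\<theta> < 1" unfolding \<theta>_def using \<open>0 < \<epsilon>\<close> \<alpha>(1) by (intro powr_less_one) auto
    show "\<theta> powr - \<alpha> = 1 + \<epsilon>" unfolding \<theta>_def powr_powr using \<open>0 < \<epsilon>\<close> \<alpha>(1) by simp
  qed
  \<comment> \<open>Two points moving by up to \<open>3 * \<delta>\<close> each lose at most
    \<open>6 * \<delta>\<close> of their distance. From distance \<open>L * \<delta>\<close> on,
    this is at most the fraction \<open>1 - \<theta>\<close>.\<close>
  define L where "L = 6 / (1 - \<theta>)"
  have L: "0 < L" "L * (1 - \<theta>) = 6"
    using \<theta>(2) nonzero_eq_divide_eq[of "1 - \<theta>" L 6] by (auto simp: L_def)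
  \<comment> \<open>The potential of a piece of scale \<open>c * \<delta>\<close> is at most
    \<open>C * (c * \<delta>) powr - \<alpha>\<close>, which equals
    \<open>B * (L * \<delta>) powr - \<alpha>\<close> and is thus at most \<open>B\<close> times the
    kernel of any pair closer than \<open>L * \<delta>\<close>.\<close>
  define B where "B = C * (L / c) powr \<alpha>"
  have B: "0 < B" using C(1) L(1) c(1) by (simp add: B_def)
  have "L * \<delta>\<^sub>0 / 2 > 0" using L c by simp
  then obtain n where n: "(\<integral>\<^sup>+x. \<integral>\<^sup>+y. riesz_kernel \<alpha> x y * indicator {z. dist x z < (L * \<delta>\<^sub>0 / 2) / real (Suc n)} y \<partial>\<mu> \<partial>\<mu>) < ennreal (\<epsilon> / B)"
    using near_diagonal_energy[OF \<mu>(1) fm\<mu> \<alpha>(1) less_le_trans[OF E\<mu> top_greatest], of "\<epsilon> / B" "L * \<delta>\<^sub>0 / 2"] B \<open>0 < \<epsilon>\<close> by auto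
  \<comment> \<open>Fixed so that \<open>L * \<delta>\<close> is the radius found above, at which
    near pairs carry energy below \<open>\<epsilon> / B\<close>.\<close>
  define \<delta> where "\<delta> = \<delta>\<^sub>0 / 2 / real (Suc n)"
  have L\<delta>: "(L * \<delta>\<^sub>0 / 2) / real (Suc n) = L * \<delta>" by (simp add: \<delta>_def)
  have \<delta>: "0 < \<delta>" "\<delta> < \<delta>\<^sub>0"
  proof -
    show "0 < \<delta>" using c(3) by (simp add: \<delta>_def)
    have "\<delta> \<le> \<delta>\<^sub>0 / 2 / 1" unfolding \<delta>_def using c(3) by (intro divide_left_mono) auto
    then show "\<delta> < \<delta>\<^sub>0" using c(3) by simp
  qed
  have cpt: "compact (closure U)" using U(2) by simp
  have cov: "closure U \<subseteq> (\<Union>z\<in>closure U. ball z \<delta>)"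
  proof
    fix x assume x: "x \<in> closure U"
    have "x \<in> ball x \<delta>" using \<delta>(1) by simp
    with x show "x \<in> (\<Union>z\<in>closure U. ball z \<delta>)" by blast
  qed
  obtain Z where Z: "Z \<subseteq> closure U" "finite Z" "closure U \<subseteq> (\<Union>z\<in>Z. ball z \<delta>)"
    by (rule compactE_image[OF cpt open_ball cov])
  have "\<forall>z\<in>closure U. \<exists>p. dist p z \<le> \<delta> \<and> cball p (c * \<delta>) \<subseteq> U" using cork[OF _ \<delta>] by blast
  from bchoice[OF this] obtain q where q: "\<forall>z\<in>closure U. dist (q z) z \<le> \<delta> \<and> cball (q z) (c * \<delta>) \<subseteq> U" by blast
  obtain p where p [measurable]: "p \<in> borel_measurable borel" and pz: "\<And>x. x \<in> closure U \<Longrightarrow> \<exists>z\<in>Z. x \<in> ball z \<delta> \<and> p x = q z"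
    using measurable_finite_selection[OF Z(2,3), of q] by blast
  define s where "s = c * \<delta>"
  have s: "0 < s" "s \<le> \<delta>" using c \<delta> by (auto simp: s_def mult_left_le_one_le)
  define T where "T = (\<lambda>z. p (fst z) + s *\<^sub>R flatten b (snd z))"
  have [measurable]: "T \<in> borel_measurable (\<mu> \<Otimes>\<^sub>M N)" unfolding T_def by measurable
  \<comment> \<open>One \<delta> each from \<open>x\<close> to its net point, from there to the
    centre of the piece, and within the piece.\<close>
  have near: "dist x (T (x, y)) \<le> 3 * \<delta>" if xy: "x \<in> closure U" "y \<in> cube 0 a" for x y
  proof -
    obtain z where z: "z \<in> Z" "x \<in> ball z \<delta>" "p x = q z" using pz[OF xy(1)] by blast
    have "dist (q z) z \<le> \<delta>" using q z(1) Z(1) by blast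
    moreover have "dist z x \<le> \<delta>" using z(2) by simp
    ultimately have 2: "dist x (p x) \<le> 2 * \<delta>" using dist_triangle[of x "q z" z] z(3) by (simp add: dist_commute)
    have "norm (flatten b y) \<le> 1" using norm_flatten_cube[OF b] xy(2) by (simp add: a_def)
    then have "s * norm (flatten b y) \<le> s" using s(1) by simp
    moreover have "dist (p x) (T (x, y)) = s * norm (flatten b y)" using s(1) by (simp add: T_def dist_norm)
    ultimately have "dist (p x) (T (x, y)) \<le> \<delta>" using s(2) by linarith
    then show ?thesis using 2 dist_triangle[of x "T (x, y)" "p x"] by linarith
  qed
  define F where "F = (\<Union>z\<in>Z. (\<lambda>y. q z + s *\<^sub>R flatten b y) ` cube 0 a)"
  have cF: "compact F"
    unfolding F_def using Z(2)
    by (intro compact_UN compact_continuous_image compact_cube continuous_intros continuous_flatten)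
  have FU: "F \<subseteq> closure U"
  proof
    fix x assume "x \<in> F"
    then obtain z y where zy: "z \<in> Z" "y \<in> cube 0 a" "x = q z + s *\<^sub>R flatten b y" unfolding F_def by blast
    have "norm (flatten b y) \<le> 1" using norm_flatten_cube[OF b] zy(2) by (simp add: a_def)
    then have "s * norm (flatten b y) \<le> s" using s(1) by simp
    then have "x \<in> cball (q z) (c * \<delta>)" using s(1) zy(3) unfolding s_def[symmetric] by (simp add: dist_norm)
    then have "x \<in> U" using q zy(1) Z(1) by blast
    then show "x \<in> closure U" by (rule closure_subset[THEN subsetD])
  qed
  have null: "emeasure lborel F = 0"
  proof -
    have "b \<bullet> flatten b y = 0" for y using flatten_inner[OF b b] by (simp add: inner_commute)
    then have "b \<bullet> (q z + s *\<^sub>R flatten b y) = b \<bullet> q z" for z y by (simp add: inner_add_right)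
    then have "F \<subseteq> (\<Union>z\<in>Z. {x. b \<bullet> x = b \<bullet> q z})" unfolding F_def by blast
    moreover have "negligible (\<Union>z\<in>Z. {x. b \<bullet> x = b \<bullet> q z})"
      using Z(2) b nonzero_Basis[OF b] by (intro negligible_Union) (auto intro!: negligible_hyperplane)
    ultimately have "negligible F" by (rule negligible_subset[rotated])
    then have "F \<in> null_sets lebesgue" by (simp add: negligible_iff_null_sets)
    moreover have "F \<in> sets borel" using cF by (rule borel_compact)
    ultimately show ?thesis by (simp add: null_sets_def)
  qed
  \<comment> \<open>The new charge: \<open>x\<close> is drawn from \<mu> and replaced by a uniformly
    random point of the piece assigned to it.\<close>
  define \<nu> where "\<nu> = distr (\<mu> \<Otimes>\<^sub>M N) borel T"
  have s\<nu>: "sets \<nu> = sets borel" by (simp add: \<nu>_def)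
  have F\<nu>: "emeasure \<nu> F = 1"
  proof (rule antisym)
    have [measurable]: "F \<in> sets borel" using cF by (rule borel_compact)
    have eq: "emeasure \<nu> F = emeasure (\<mu> \<Otimes>\<^sub>M N) (T -` F \<inter> space (\<mu> \<Otimes>\<^sub>M N))"
      unfolding \<nu>_def by (rule emeasure_distr) measurable
    have times: "emeasure (\<mu> \<Otimes>\<^sub>M N) (A \<times> D) = emeasure \<mu> A * emeasure N D" if "A \<in> sets borel" "D \<in> sets borel" for A D
      using that by (intro N.emeasure_pair_measure_Times) (auto simp: \<mu>(1) Nb(1))
    have "emeasure \<nu> F \<le> emeasure (\<mu> \<Otimes>\<^sub>M N) (space (\<mu> \<Otimes>\<^sub>M N))" unfolding eq by (rule emeasure_space)
    also have "\<dots> = 1" using times[of UNIV UNIV] by (simp add: space_pair_measure sp\<mu> Nb(2,3) \<mu>(2))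
    finally show "emeasure \<nu> F \<le> 1" .
    have "1 = emeasure (\<mu> \<Otimes>\<^sub>M N) (closure U \<times> cube 0 a)"
      using times[of "closure U" "cube 0 a"] m\<Omega> Nb(4) by simp
    also have "\<dots> \<le> emeasure (\<mu> \<Otimes>\<^sub>M N) (T -` F \<inter> space (\<mu> \<Otimes>\<^sub>M N))"
    proof (rule emeasure_mono)
      show "closure U \<times> cube 0 a \<subseteq> T -` F \<inter> space (\<mu> \<Otimes>\<^sub>M N)"
      proof
        fix z :: "'a \<times> 'a" assume "z \<in> closure U \<times> cube 0 a"
        then have z: "fst z \<in> closure U" "snd z \<in> cube 0 a" by auto
        obtain w where w: "w \<in> Z" "p (fst z) = q w" using pz[OF z(1)] by blast
        have "T z = q w + s *\<^sub>R flatten b (snd z)" by (simp add: T_def w(2))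
        then have "T z \<in> F" unfolding F_def by (intro UN_I[OF w(1)] image_eqI[OF _ z(2)])
        then show "z \<in> T -` F \<inter> space (\<mu> \<Otimes>\<^sub>M N)" by (simp add: space_pair_measure sp\<mu> Nb(2))
      qed
    qed measurable
    finally show "1 \<le> emeasure \<nu> F" unfolding eq .
  qed
  let ?k = "riesz_kernel \<alpha> :: 'a \<Rightarrow> 'a \<Rightarrow> ennreal"
  let ?H = "\<lambda>x x' :: 'a. ennreal (1 + \<epsilon>) * ?k x x' + ennreal B * (?k x x' * indicator {z. dist x z < L * \<delta>} x')"
  \<comment> \<open>Averaging over the position of the second point suffices, since the flat
    potential is bounded uniformly in the position of the first.\<close>
  have key: "(\<integral>\<^sup>+y'. ?k (T (x, y)) (T (x', y')) \<partial>N) \<le> ?H x x'"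
    if x: "x \<in> closure U" "y \<in> cube 0 a" "x' \<in> closure U" for x y x'
  proof (cases "dist x x' < L * \<delta>")
    case True
    have "(\<integral>\<^sup>+y'. ?k (T (x, y)) (T (x', y')) \<partial>N) \<le> ennreal (s powr - \<alpha> * C)"
      unfolding T_def fst_conv snd_conv N_def by (rule scaled_flat_potential[OF a \<alpha>(1) s(1) C(2)])
    also have "s powr - \<alpha> * C = B * (L * \<delta>) powr - \<alpha>"
    proof -
      have "s powr - \<alpha> = (L / c) powr \<alpha> * (L * \<delta>) powr - \<alpha>"
        unfolding s_def using c(1) L(1) \<delta>(1) by (simp add: powr_divide powr_mult powr_minus field_simps)
      then show ?thesis by (simp add: B_def)
    qed
    also have "ennreal (B * (L * \<delta>) powr - \<alpha>) = ennreal B * ennreal ((L * \<delta>) powr - \<alpha>)"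
      using B by (intro ennreal_mult) auto
    also have "\<dots> \<le> ennreal B * ?k x x'"
      using True L(1) \<delta>(1) \<alpha>(1) by (intro mult_left_mono riesz_kernel_ge) (auto simp: dist_norm)
    also have "\<dots> \<le> ?H x x'" using True by (simp add: add_increasing)
    finally show ?thesis .
  next
    case False
    then have far: "L * \<delta> \<le> dist x x'" by simp
    have d0: "0 < dist x x'" using far mult_pos_pos[OF L(1) \<delta>(1)] by linarith
    have "AE y' in N. ?k (T (x, y)) (T (x', y')) \<le> ennreal (1 + \<epsilon>) * ?k x x'"
      using Nb(5)
    proof eventually_elim
      fix y' :: 'a assume y': "y' \<in> cube 0 a"
      have "6 * \<delta> = L * \<delta> * (1 - \<theta>)" using L(2) by (simp add: mult_ac)
      also have "\<dots> \<le> dist x x' * (1 - \<theta>)" using far \<theta>(2) by (intro mult_right_mono) auto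
      finally have 6: "6 * \<delta> \<le> dist x x' - \<theta> * dist x x'" by (simp add: algebra_simps)
      have "dist x x' \<le> dist x (T (x, y)) + dist (T (x, y)) (T (x', y')) + dist x' (T (x', y'))"
        using dist_triangle[of x x' "T (x, y)"] dist_triangle[of "T (x, y)" x' "T (x', y')"] by (simp add: dist_commute)
      then have "\<theta> * dist x x' \<le> dist (T (x, y)) (T (x', y'))"
        using near[OF x(1,2)] near[OF x(3) y'] 6 by linarith
      then have "?k (T (x, y)) (T (x', y')) \<le> ennreal ((\<theta> * dist x x') powr - \<alpha>)"
        using \<theta>(1) d0 \<alpha>(1) by (intro riesz_kernel_le) (auto simp: dist_norm)
      also have "(\<theta> * dist x x') powr - \<alpha> = (1 + \<epsilon>) * dist x x' powr - \<alpha>"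
        using \<theta>(1,3) d0 by (simp add: powr_mult)
      also have "ennreal ((1 + \<epsilon>) * dist x x' powr - \<alpha>) = ennreal (1 + \<epsilon>) * ennreal (dist x x' powr - \<alpha>)"
        using \<open>0 < \<epsilon>\<close> by (intro ennreal_mult) auto
      also have "ennreal (dist x x' powr - \<alpha>) = ?k x x'" using d0 by (simp add: riesz_kernel_eq dist_norm)
      finally show "?k (T (x, y)) (T (x', y')) \<le> ennreal (1 + \<epsilon>) * ?k x x'" .
    qed
    then have "(\<integral>\<^sup>+y'. ?k (T (x, y)) (T (x', y')) \<partial>N) \<le> (\<integral>\<^sup>+y'. ennreal (1 + \<epsilon>) * ?k x x' \<partial>N)"
      by (rule nn_integral_mono_AE)
    also have "\<dots> = ennreal (1 + \<epsilon>) * ?k x x'" by (simp add: Nb(2,3))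
    also have "\<dots> \<le> ?H x x'" by (simp add: add_increasing2)
    finally show ?thesis .
  qed
  define h where "h = (\<lambda>x. \<integral>\<^sup>+x'. ?H x x' \<partial>\<mu>)"
  have [measurable]: "h \<in> borel_measurable borel" unfolding h_def by measurable
  have inner: "(\<integral>\<^sup>+z'. ?k (T (x, y)) (T z') \<partial>(\<mu> \<Otimes>\<^sub>M N)) \<le> h x" if "x \<in> closure U" "y \<in> cube 0 a" for x y
  proof -
    have "(\<integral>\<^sup>+z'. ?k (T (x, y)) (T z') \<partial>(\<mu> \<Otimes>\<^sub>M N)) = (\<integral>\<^sup>+x'. \<integral>\<^sup>+y'. ?k (T (x, y)) (T (x', y')) \<partial>N \<partial>\<mu>)"
      by (rule N.nn_integral_fst[symmetric]) measurable
    also have "\<dots> \<le> h x" unfolding h_def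
      by (rule nn_integral_mono_AE, rule AE_mp[OF AE\<Omega>], rule AE_I2, rule impI, rule key[OF that])
    finally show ?thesis .
  qed
  interpret MN: pair_sigma_finite \<mu> N ..
  define G where "G = (\<lambda>u. \<integral>\<^sup>+z'. ?k u (T z') \<partial>(\<mu> \<Otimes>\<^sub>M N))"
  have [measurable]: "G \<in> borel_measurable borel" unfolding G_def by measurable
  have "(\<integral>\<^sup>+v. ?k u v \<partial>\<nu>) = G u" for u
    unfolding \<nu>_def G_def by (rule nn_integral_distr) measurable
  then have "(\<integral>\<^sup>+u. \<integral>\<^sup>+v. ?k u v \<partial>\<nu> \<partial>\<nu>) = (\<integral>\<^sup>+u. G u \<partial>\<nu>)" by (simp only:)
  also have "\<dots> = (\<integral>\<^sup>+z. G (T z) \<partial>(\<mu> \<Otimes>\<^sub>M N))"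
    unfolding \<nu>_def by (rule nn_integral_distr) measurable
  also have "\<dots> = (\<integral>\<^sup>+x. \<integral>\<^sup>+y. G (T (x, y)) \<partial>N \<partial>\<mu>)"
    by (rule N.nn_integral_fst[symmetric]) measurable
  also have "\<dots> \<le> (\<integral>\<^sup>+x. \<integral>\<^sup>+y. h x \<partial>N \<partial>\<mu>)"
  proof (rule nn_integral_mono_AE)
    show "AE x in \<mu>. (\<integral>\<^sup>+y. G (T (x, y)) \<partial>N) \<le> (\<integral>\<^sup>+y. h x \<partial>N)"
      using AE\<Omega>
    proof eventually_elim
      fix x assume x: "x \<in> closure U"
      show "(\<integral>\<^sup>+y. G (T (x, y)) \<partial>N) \<le> (\<integral>\<^sup>+y. h x \<partial>N)"
        unfolding G_def
        by (rule nn_integral_mono_AE, rule AE_mp[OF Nb(5)], rule AE_I2, rule impI, rule inner[OF x])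
    qed
  qed
  also have "\<dots> = (\<integral>\<^sup>+x. h x \<partial>\<mu>)" by (simp add: Nb(2,3))
  also have "\<dots> = ennreal (1 + \<epsilon>) * (\<integral>\<^sup>+x. \<integral>\<^sup>+x'. ?k x x' \<partial>\<mu> \<partial>\<mu>)
     + ennreal B * (\<integral>\<^sup>+x. \<integral>\<^sup>+x'. ?k x x' * indicator {z. dist x z < L * \<delta>} x' \<partial>\<mu> \<partial>\<mu>)"
  proof -
    have "h x = ennreal (1 + \<epsilon>) * (\<integral>\<^sup>+x'. ?k x x' \<partial>\<mu>)
        + ennreal B * (\<integral>\<^sup>+x'. ?k x x' * indicator {z. dist x z < L * \<delta>} x' \<partial>\<mu>)" for x
      unfolding h_def by (subst nn_integral_add) (auto simp: nn_integral_cmult)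
    then show ?thesis by (simp only:) (subst nn_integral_add, auto simp: nn_integral_cmult)
  qed
  also have "\<dots> \<le> ennreal (1 + \<epsilon>) * ennreal V + ennreal B * ennreal (\<epsilon> / B)"
    using E\<mu> n unfolding L\<delta> by (intro add_mono mult_left_mono) (auto simp: less_imp_le)
  also have "\<dots> = ennreal ((1 + \<epsilon>) * V + \<epsilon>)"
    using V0 B \<open>0 < \<epsilon>\<close> by (simp add: ennreal_mult[symmetric] ennreal_plus[symmetric] del: ennreal_plus)
  finally have "riesz_energy \<alpha> F \<le> ennreal ((1 + \<epsilon>) * V + \<epsilon>)"
    unfolding riesz_energy_def using s\<nu> F\<nu> by (intro INF_lower2[of \<nu>]) auto
  with cF FU null show thesis by (rule that)
qed

section \<open>The infimum of the charged energy\<close>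

lemma perimeter_cong_AE:
  fixes E E' :: "'a::euclidean_space set"
  assumes "E \<in> sets lebesgue" "E' \<in> sets lebesgue" "AE x in lebesgue. x \<in> E \<longleftrightarrow> x \<in> E'"
  shows "perimeter E = perimeter E'"
  unfolding perimeter_def
proof (rule SUP_cong[OF refl])
  fix \<phi> :: "'a \<Rightarrow> 'a"
  assume "\<phi> \<in> {\<phi>. Ck 1 \<phi> \<and> compact (closure {x. \<phi> x \<noteq> 0}) \<and> (\<forall>x. norm (\<phi> x) \<le> 1)}"
  then have "test_field \<phi>" by (simp add: test_field_def)
  then have "divergence \<phi> \<in> borel_measurable borel"
    by (intro borel_measurable_continuous_onI continuous_on_divergence)
  then have [measurable]: "divergence \<phi> \<in> borel_measurable lebesgue" by (simp add: measurable_completion)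
  have [measurable]: "E \<in> sets lebesgue" "E' \<in> sets lebesgue" by (fact assms)+
  have "(\<integral>x. indicator E x *\<^sub>R divergence \<phi> x \<partial>lebesgue) = (\<integral>x. indicator E' x *\<^sub>R divergence \<phi> x \<partial>lebesgue)"
  proof (rule integral_cong_AE)
    show "AE x in lebesgue. indicator E x *\<^sub>R divergence \<phi> x = indicator E' x *\<^sub>R divergence \<phi> x"
      using assms(3) by eventually_elim (simp add: indicator_def)
  qed measurable
  then show "ennreal (LINT x:E|lebesgue. divergence \<phi> x) = ennreal (LINT x:E'|lebesgue. divergence \<phi> x)"
    by (simp add: set_lebesgue_integral_def)
qed

text \<open>The Borel part of a Lebesgue set differs from it by a null set and lies inside it, so it
  still lies in \<Omega>.\<close>

lemma borel_representative:
  fixes E :: "'a::euclidean_space set"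
  assumes "E \<in> sets lebesgue"
  obtains E' where "E' \<in> sets borel" "E' \<subseteq> E" "vol E' = measure lebesgue E" "perimeter E' = perimeter E"
proof -
  obtain C T N where CT: "E = C \<union> T" "T \<subseteq> N" "N \<in> null_sets lborel" "C \<in> sets lborel"
    by (rule sets_completionE[OF assms])
  have C: "C \<in> sets borel" using CT(4) by simp
  have T: "T \<in> null_sets lebesgue"
    using CT(2) null_sets_completionI[OF CT(3)] by (rule null_sets_completion_subset)
  have "AE x in lebesgue. x \<in> C \<longleftrightarrow> x \<in> E"
    using AE_not_in[OF T] by eventually_elim (use CT(1) in auto)
  then have "perimeter C = perimeter E" using C assms by (intro perimeter_cong_AE) auto
  moreover have "measure lebesgue (C \<union> T) = measure lebesgue C"
    using T C by (intro measure_Un_null_set) auto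
  then have "vol C = measure lebesgue E" using CT(1) C by simp
  ultimately show thesis using that[of C] C CT(1) by blast
qed

lemma ennreal_square_top: "0 < Q \<Longrightarrow> ennreal (Q\<^sup>2) * top = top"
  by (simp add: ennreal_mult_top)

theorem theorem1p2:
  fixes \<Omega> E\<^sub>0 :: "'a::euclidean_space set" and m \<alpha> Q :: real
  assumes "DIM('a) \<ge> 2"
    and "compact_smooth_domain \<Omega>"
    and "0 < m" and "m < measure lebesgue \<Omega>"
    and "isoperimetric_solution \<Omega> m E\<^sub>0"
    and "0 < \<alpha>" and "\<alpha> < real DIM('a) - 1"
    and "Q > 0"
  shows "(INF E \<in> {E. compact E \<and> E \<subseteq> \<Omega> \<and> measure lebesgue E = m}. charged_energy \<alpha> Q E)
           = perimeter E\<^sub>0 + ennreal (Q\<^sup>2) * riesz_energy \<alpha> \<Omega>"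
proof (rule antisym)
  obtain U where U: "open U" "bounded U" "smooth_boundary U" and \<Omega>: "\<Omega> = closure U"
    using assms(2) unfolding compact_smooth_domain_def by blast
  have E0: "E\<^sub>0 \<in> sets lebesgue" "E\<^sub>0 \<subseteq> \<Omega>" "measure lebesgue E\<^sub>0 = m"
    and min: "\<And>E. E \<in> sets lebesgue \<Longrightarrow> E \<subseteq> \<Omega> \<Longrightarrow> measure lebesgue E = m \<Longrightarrow> perimeter E\<^sub>0 \<le> perimeter E"
    using assms(5) unfolding isoperimetric_solution_def by auto
  have b\<Omega>: "\<Omega> \<in> sets borel" by (simp add: \<Omega>)
  show "perimeter E\<^sub>0 + ennreal (Q\<^sup>2) * riesz_energy \<alpha> \<Omega>
      \<le> (INF E \<in> {E. compact E \<and> E \<subseteq> \<Omega> \<and> measure lebesgue E = m}. charged_energy \<alpha> Q E)"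
  proof (rule INF_greatest)
    fix E assume "E \<in> {E. compact E \<and> E \<subseteq> \<Omega> \<and> measure lebesgue E = m}"
    then have E: "compact E" "E \<subseteq> \<Omega>" "measure lebesgue E = m" by auto
    have bE: "E \<in> sets borel" using E(1) by (rule borel_compact)
    show "perimeter E\<^sub>0 + ennreal (Q\<^sup>2) * riesz_energy \<alpha> \<Omega> \<le> charged_energy \<alpha> Q E"
      unfolding charged_energy_def using bE
      by (intro add_mono mult_left_mono min riesz_energy_antimono E b\<Omega>) auto
  qed
  let ?I = "INF E \<in> {E. compact E \<and> E \<subseteq> \<Omega> \<and> measure lebesgue E = m}. charged_energy \<alpha> Q E"
  show "?I \<le> perimeter E\<^sub>0 + ennreal (Q\<^sup>2) * riesz_energy \<alpha> \<Omega>"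
  proof (rule ennreal_le_epsilon)
    fix e :: real
    assume fin: "perimeter E\<^sub>0 + ennreal (Q\<^sup>2) * riesz_energy \<alpha> \<Omega> < top" and "0 < e"
    \<comment> \<open>An infinite right-hand side is excluded by \<open>fin\<close>. As
      \<open>Q\<close> is positive, an infinite energy would make it infinite.\<close>
    have "perimeter E\<^sub>0 \<noteq> top" "riesz_energy \<alpha> \<Omega> \<noteq> top"
      using fin ennreal_square_top[OF assms(8)] by auto
    then obtain p V where p: "perimeter E\<^sub>0 = ennreal p" "0 \<le> p" and V: "riesz_energy \<alpha> \<Omega> = ennreal V" "0 \<le> V"
      by (cases "perimeter E\<^sub>0"; cases "riesz_energy \<alpha> \<Omega>") auto
    obtain E' where E': "E' \<in> sets borel" "E' \<subseteq> E\<^sub>0" "vol E' = measure lebesgue E\<^sub>0" "perimeter E' = perimeter E\<^sub>0"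
      by (rule borel_representative[OF E0(1)])
    have "\<exists>A. compact A \<and> A \<subseteq> closure U \<and> vol A = m \<and> perimeter A \<le> ennreal (p + e / 2)"
    proof (rule compact_isoperimetric_approximation[OF assms(1) U E'(1)])
      show "m < vol (closure U)" using assms(4) b\<Omega> by (simp add: \<Omega>)
    qed (use E' E0 \<Omega> assms(3) p \<open>0 < e\<close> in auto)
    then obtain A where A: "compact A" "A \<subseteq> \<Omega>" "vol A = m" "perimeter A \<le> ennreal (p + e / 2)"
      unfolding \<Omega> by blast
    \<comment> \<open>For \<open>\<epsilon> \<le> 1\<close> the energy bound
      \<open>(1 + \<epsilon>) * (V + \<epsilon>) + \<epsilon>\<close> is at most
      \<open>V + \<epsilon> * (V + 3)\<close>; the quotient makes the excess, times
      \<open>Q\<^sup>2\<close>, at most \<open>e / 2\<close>.\<close>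
    define \<epsilon> where "\<epsilon> = min 1 (e / (2 * Q\<^sup>2 * (V + 3)))"
    have Q2: "0 < Q\<^sup>2" using assms(8) by simp
    have \<epsilon>: "0 < \<epsilon>" "\<epsilon> \<le> 1" using \<open>0 < e\<close> Q2 V(2) by (auto simp: \<epsilon>_def)
    have \<epsilon>Q: "Q\<^sup>2 * (\<epsilon> * (V + 3)) \<le> e / 2"
    proof -
      have "0 < 2 * Q\<^sup>2 * (V + 3)" using Q2 V(2) by simp
      then have "\<epsilon> * (2 * Q\<^sup>2 * (V + 3)) \<le> e"
        using pos_le_divide_eq[of "2 * Q\<^sup>2 * (V + 3)" \<epsilon> e] by (simp add: \<epsilon>_def)
      then show ?thesis by (simp add: mult_ac)
    qed
    have "riesz_energy \<alpha> (closure U) < ennreal (V + \<epsilon>)"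
      using V \<epsilon>(1) unfolding \<Omega>[symmetric] by (simp add: ennreal_lessI)
    from riesz_energy_null_set[OF U assms(6,7) this \<epsilon>(1)]
    obtain F where F: "compact F" "F \<subseteq> \<Omega>" "emeasure lborel F = 0"
      "riesz_energy \<alpha> F \<le> ennreal ((1 + \<epsilon>) * (V + \<epsilon>) + \<epsilon>)" unfolding \<Omega> by blast
    have bA: "A \<in> sets borel" and bF: "F \<in> sets borel" using A(1) F(1) by (auto intro: borel_compact)
    have nF: "F \<in> null_sets lebesgue" using F(3) bF by (intro null_setsI) auto
    have "measure lebesgue (A \<union> F) = measure lebesgue A"
      using nF bA by (intro measure_Un_null_set) auto
    then have mAF: "measure lebesgue (A \<union> F) = m" using A(3) bA by simp
    have "AE x in lebesgue. x \<in> A \<union> F \<longleftrightarrow> x \<in> A"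
      using AE_not_in[OF nF] by eventually_elim auto
    then have pAF: "perimeter (A \<union> F) = perimeter A" using bA bF by (intro perimeter_cong_AE) auto
    have "riesz_energy \<alpha> (A \<union> F) \<le> riesz_energy \<alpha> F"
      using bA bF by (intro riesz_energy_antimono) auto
    also note F(4)
    also have "ennreal ((1 + \<epsilon>) * (V + \<epsilon>) + \<epsilon>) \<le> ennreal (V + \<epsilon> * (V + 3))"
    proof (rule ennreal_leI)
      have "\<epsilon> * \<epsilon> \<le> \<epsilon> * 1" using \<epsilon> by (intro mult_left_mono) auto
      then show "(1 + \<epsilon>) * (V + \<epsilon>) + \<epsilon> \<le> V + \<epsilon> * (V + 3)" by (simp add: algebra_simps)
    qed
    finally have rAF: "riesz_energy \<alpha> (A \<union> F) \<le> ennreal (V + \<epsilon> * (V + 3))" .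
    have "?I \<le> charged_energy \<alpha> Q (A \<union> F)"
      using A(1,2) F(1,2) mAF by (intro INF_lower) (auto intro: compact_Un)
    also have "\<dots> \<le> ennreal (p + e / 2) + ennreal (Q\<^sup>2) * ennreal (V + \<epsilon> * (V + 3))"
      unfolding charged_energy_def pAF by (intro add_mono mult_left_mono A(4) rAF) auto
    also have "\<dots> = ennreal (p + e / 2 + Q\<^sup>2 * (V + \<epsilon> * (V + 3)))"
      using p(2) V(2) \<epsilon>(1) \<open>0 < e\<close> by (simp add: ennreal_mult[symmetric] ennreal_plus[symmetric] del: ennreal_plus)
    also have "\<dots> \<le> ennreal (p + Q\<^sup>2 * V + e)"
      using \<epsilon>Q by (intro ennreal_leI) (simp add: distrib_left)
    also have "\<dots> = perimeter E\<^sub>0 + ennreal (Q\<^sup>2) * riesz_energy \<alpha> \<Omega> + ennreal e"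
      unfolding p(1) V(1) using p(2) V(2) \<open>0 < e\<close> by (simp add: ennreal_mult[symmetric] ennreal_plus[symmetric] del: ennreal_plus)
    finally show "?I \<le> perimeter E\<^sub>0 + ennreal (Q\<^sup>2) * riesz_energy \<alpha> \<Omega> + ennreal e" .
  qed
qed

end
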